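(* Let $n \geq 3$, let $\Gamma$ be an open subset of $\mathbb{R}^n$ and $f \in C^0(\bar\Gamma)$ be such that $(f,\Gamma)$ satisfies the structural conditions (S1)--(S6) listed in the context. If $v \in C^{1,1}_{\rm loc}(\mathbb{R}^n)$ is a viscosity solution of $$f(\lambda(A^v)) = 1,\qquad \lambda(A^v) \in \Gamma,\qquad v > 0 \quad\text{on } \mathbb{R}^n,$$ then $v$ is either a constant or of the form $$v(x) = \Big(\frac{a}{1 + b^2|x - x_0|^2}\Big)^{\frac{n-2}{2}}$$ for some $x_0 \in \mathbb{R}^n$ and some $a,b>0$.
   Context: For $n \geq 3$ and a positive function $u$, the conformal Hessian of $u$ is $$A^u = -\frac{2}{n-2} u^{-\frac{n+2}{n-2}} \nabla^2 u + \frac{2n}{(n-2)^2} u^{-\frac{2n}{n-2}} \nabla u \otimes \nabla u - \frac{2}{(n-2)^2} u^{-\frac{2n}{n-2}} |\nabla u|^2 I,$$ where $I$ is the $n\times n$ identity matrix; $\lambda(A^u)$ denotes the eigenvalues of $A^u$. Let $\Gamma_n := \{\mu \in \mathbb{R}^n: \mu_i > 0 \text{ for all } i\}$. Structural conditions on $(f,\Gamma)$: (S1) (symmetry) if $\lambda \in \Gamma$ and $\lambda'$ is a permutation of $\lambda$, then $\lambda' \in \Gamma$ and $f(\lambda') = f(\lambda)$. (S2) (ellipticity) if $\lambda \in \Gamma$ and $\mu \in \bar\Gamma_n$, then $\lambda + \mu \in \Gamma$ and $f(\lambda + \mu) \geq f(\lambda)$. (S3) (local strict ellipticity) for any compact subset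 $K$ of $\Gamma$, there is some constant $\delta(K) > 0$ such that $f(\lambda + \mu) - f(\lambda) \geq \delta(K) |\mu|$ for all $\lambda \in K$, $\mu \in \bar\Gamma_n$. (S4) (local Lipschitz) for any compact subset $K$ of $\Gamma$, there is some constant $C(K) > 0$ such that $|f(\lambda') - f(\lambda)| \leq C(K) |\lambda' - \lambda|$ for all $\lambda, \lambda' \in K$. (S5) $f^{-1}([1,\infty)) \subset \Gamma$. (S6) $\Gamma \subset \Gamma_1 := \{\mu \in \mathbb{R}^n: \mu_1 + \ldots + \mu_n > 0\}$. Viscosity solutions of $f(\lambda(A^u))=1$, $\lambda(A^u)\in\Gamma$, in an open set $\Omega$: a positive continuous function $u$ on $\Omega$ is a viscosity solution if it is both a sub-solution and a super-solution in the following sense. - Sub-solution: for any $x_0\in\Omega$ and any positive $\varphi \in C^2(\Omega)$ with $(u-\varphi)(x_0)=0$ and $u-\varphi\leq 0$ near $x_0$, either $\lambda(A^\varphi(x_0)) \notin \bar\Gamma$ or $f(\lambda(A^\varphi(x_0))) \leq 1$. - Super-solution: for any $x_0\in\Omega$ and any positive $\varphi \in C^2(\Omega)$ with $(u-\varphi)(x_0)=0$ and $u-\varphi\geq 0$ near $x_0$, one has $\lambda(A^\varphi(x_0)) \in \bar\Gamma$ and $f(\lambda(A^\varphi(x_0))) \geq 1$ (hence $\lambda(A^\varphi(x_0))\in\Gamma$ by (S5)). *)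

theory Defs
  imports "HOL-Analysis.Analysis"
begin

definition grad :: "(real^'n \<Rightarrow> real) \<Rightarrow> real^'n \<Rightarrow> real^'n" where
  "grad u x = (\<chi> i. frechet_derivative u (at x) (axis i 1))"

definition hessian :: "(real^'n \<Rightarrow> real) \<Rightarrow> real^'n \<Rightarrow> real^'n^'n" where
  "hessian u x = (\<chi> i j. frechet_derivative (\<lambda>y. grad u y $ i) (at x) (axis j 1))"

text \<open>
  The two regularity classes are meant for open \<open>\<Omega>\<close>. For \<open>C\<^sup>2\<close>, continuity of \<open>u\<close> and of
  \<open>grad u\<close> follows from their differentiability.
\<close>

definition C2_on :: "(real^'n) set \<Rightarrow> (real^'n \<Rightarrow> real) \<Rightarrow> bool" where
  "C2_on \<Omega> u \<longleftrightarrow>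
     (\<forall>x\<in>\<Omega>. u differentiable (at x)) \<and>
     (\<forall>x\<in>\<Omega>. grad u differentiable (at x)) \<and>
     continuous_on \<Omega> (hessian u)"

definition C11_loc_on :: "(real^'n) set \<Rightarrow> (real^'n \<Rightarrow> real) \<Rightarrow> bool" where
  "C11_loc_on \<Omega> u \<longleftrightarrow>
     (\<forall>x\<in>\<Omega>. u differentiable (at x)) \<and>
     (\<forall>K. compact K \<and> K \<subseteq> \<Omega> \<longrightarrow> (\<exists>L. L-lipschitz_on K (grad u)))"

definition conformal_hessian :: "(real^'n \<Rightarrow> real) \<Rightarrow> real^'n \<Rightarrow> real^'n^'n" where
  "conformal_hessian u x =
     (let n = real CARD('n); p = grad u x in
       (- (2 / (n - 2)) * u x powr (- ((n + 2) / (n - 2)))) *\<^sub>R hessian u x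
       + (2 * n / (n - 2)\<^sup>2 * u x powr (- (2 * n / (n - 2)))) *\<^sub>R (\<chi> i j. p $ i * p $ j)
       - (2 / (n - 2)\<^sup>2 * u x powr (- (2 * n / (n - 2))) * (norm p)\<^sup>2) *\<^sub>R mat 1)"

text \<open>
  The eigenvalues of a matrix listed with multiplicity, i.e. the roots of its characteristic
  polynomial. For a symmetric matrix such a vector exists and is unique up to a permutation of
  its entries; the choice among the orderings is immaterial below, since \<open>\<Gamma>\<close> and \<open>f\<close> are
  symmetric.
\<close>

definition eigvals :: "real^'n^'n \<Rightarrow> real^'n" where
  "eigvals A = (SOME \<nu>. \<forall>t. det (mat t - A) = (\<Prod>i\<in>UNIV. (t - \<nu> $ i)))"

definition Gamma_pos :: "(real^'n) set" where
  "Gamma_pos = {\<mu>. \<forall>i. \<mu> $ i > 0}"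

definition Gamma_1 :: "(real^'n) set" where
  "Gamma_1 = {\<mu>. (\<Sum>i\<in>UNIV. \<mu> $ i) > 0}"

text \<open>
  A function on \<open>closure \<Gamma>\<close> is represented by a total function whose values outside
  \<open>closure \<Gamma>\<close> are never used; in particular the preimage in \<open>cond_S5\<close> is taken in
  \<open>closure \<Gamma>\<close>.
\<close>

definition cond_S1 :: "(real^'n \<Rightarrow> real) \<Rightarrow> (real^'n) set \<Rightarrow> bool" where
  "cond_S1 f \<Gamma> \<longleftrightarrow>
     (\<forall>\<nu>\<in>\<Gamma>. \<forall>\<pi>. bij \<pi> \<longrightarrow>
        (\<chi> i. \<nu> $ \<pi> i) \<in> \<Gamma> \<and> f (\<chi> i. \<nu> $ \<pi> i) = f \<nu>)"

definition cond_S2 :: "(real^'n \<Rightarrow> real) \<Rightarrow> (real^'n) set \<Rightarrow> bool" where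
  "cond_S2 f \<Gamma> \<longleftrightarrow>
     (\<forall>\<nu>\<in>\<Gamma>. \<forall>\<mu>\<in>closure Gamma_pos. \<nu> + \<mu> \<in> \<Gamma> \<and> f (\<nu> + \<mu>) \<ge> f \<nu>)"

definition cond_S3 :: "(real^'n \<Rightarrow> real) \<Rightarrow> (real^'n) set \<Rightarrow> bool" where
  "cond_S3 f \<Gamma> \<longleftrightarrow>
     (\<forall>K. compact K \<and> K \<subseteq> \<Gamma> \<longrightarrow>
        (\<exists>\<delta>>0. \<forall>\<nu>\<in>K. \<forall>\<mu>\<in>closure Gamma_pos. f (\<nu> + \<mu>) - f \<nu> \<ge> \<delta> * norm \<mu>))"

definition cond_S4 :: "(real^'n \<Rightarrow> real) \<Rightarrow> (real^'n) set \<Rightarrow> bool" where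
  "cond_S4 f \<Gamma> \<longleftrightarrow>
     (\<forall>K. compact K \<and> K \<subseteq> \<Gamma> \<longrightarrow>
        (\<exists>C>0. \<forall>\<nu>\<in>K. \<forall>\<nu>'\<in>K. \<bar>f \<nu>' - f \<nu>\<bar> \<le> C * norm (\<nu>' - \<nu>)))"

definition cond_S5 :: "(real^'n \<Rightarrow> real) \<Rightarrow> (real^'n) set \<Rightarrow> bool" where
  "cond_S5 f \<Gamma> \<longleftrightarrow> {\<nu> \<in> closure \<Gamma>. f \<nu> \<ge> 1} \<subseteq> \<Gamma>"

definition cond_S6 :: "(real^'n) set \<Rightarrow> bool" where
  "cond_S6 \<Gamma> \<longleftrightarrow> \<Gamma> \<subseteq> Gamma_1"

definition viscosity_subsolution ::
  "(real^'n \<Rightarrow> real) \<Rightarrow> (real^'n) set \<Rightarrow> (real^'n) set \<Rightarrow> (real^'n \<Rightarrow> real) \<Rightarrow> bool" where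
  "viscosity_subsolution f \<Gamma> \<Omega> u \<longleftrightarrow>
     (\<forall>x0\<in>\<Omega>. \<forall>\<phi>. C2_on \<Omega> \<phi> \<and> (\<forall>x\<in>\<Omega>. \<phi> x > 0) \<and> u x0 - \<phi> x0 = 0 \<and>
          (\<forall>\<^sub>F x in nhds x0. u x - \<phi> x \<le> 0) \<longrightarrow>
        eigvals (conformal_hessian \<phi> x0) \<notin> closure \<Gamma> \<or>
        f (eigvals (conformal_hessian \<phi> x0)) \<le> 1)"

definition viscosity_supersolution ::
  "(real^'n \<Rightarrow> real) \<Rightarrow> (real^'n) set \<Rightarrow> (real^'n) set \<Rightarrow> (real^'n \<Rightarrow> real) \<Rightarrow> bool" where
  "viscosity_supersolution f \<Gamma> \<Omega> u \<longleftrightarrow>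
     (\<forall>x0\<in>\<Omega>. \<forall>\<phi>. C2_on \<Omega> \<phi> \<and> (\<forall>x\<in>\<Omega>. \<phi> x > 0) \<and> u x0 - \<phi> x0 = 0 \<and>
          (\<forall>\<^sub>F x in nhds x0. u x - \<phi> x \<ge> 0) \<longrightarrow>
        eigvals (conformal_hessian \<phi> x0) \<in> closure \<Gamma> \<and>
        f (eigvals (conformal_hessian \<phi> x0)) \<ge> 1)"

definition viscosity_solution ::
  "(real^'n \<Rightarrow> real) \<Rightarrow> (real^'n) set \<Rightarrow> (real^'n) set \<Rightarrow> (real^'n \<Rightarrow> real) \<Rightarrow> bool" where
  "viscosity_solution f \<Gamma> \<Omega> u \<longleftrightarrow>
     (\<forall>x\<in>\<Omega>. u x > 0) \<and> continuous_on \<Omega> u \<and>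
     viscosity_subsolution f \<Gamma> \<Omega> u \<and> viscosity_supersolution f \<Gamma> \<Omega> u"

end

theory Submission
  imports Defs "HOL-Combinatorics.Permutations" "HOL-Computational_Algebra.Polynomial"
    "HOL-Library.Landau_Symbols"
begin

text \<open>
  Put \<open>w = v powr (- 2 / (n - 2))\<close>. Then \<open>A\<^sup>v = w D\<^sup>2w - \<bar>Dw\<bar>\<^sup>2/2 I\<close>, the functions
  \<open>a + b \<bullet> x + c \<bar>x\<bar>\<^sup>2\<close> are preserved by inversions, and the claim is that \<open>w\<close> is one of them.

  The method is that of moving spheres: \<open>w\<close> is compared with its reflections in the spheres
  around a point \<open>x\<close>, starting from small radii. The reflection solves the same equation, so that
  the comparison can fail only at infinity; hence it holds up to the radius \<open>sqrt (w x / \<beta>)\<close>, where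
  \<open>\<beta>\<close> is the upper limit of \<open>w y / \<bar>y\<bar>\<^sup>2\<close>. The strong maximum principle and the Hopf lemma needed here
  compare two viscosity solutions. Since they are \<open>C11\<close>, the gradient of their difference maps null
  sets to null sets and fills a ball of slopes near a minimum; by Rademacher's theorem
  one of the contact points is a point where \<open>w\<close> has a second-order expansion.

  If \<open>\<beta> = 0\<close>, differentiating the comparison in the radius gives \<open>Dw = 0\<close>. If \<open>\<beta> > 0\<close>, the comparison
  at the critical radius gives at infinity the bound
  \<open>w y / \<bar>y\<bar>\<^sup>2 \<le> \<beta> + (Dw x - 2 \<beta> x) \<bullet> y / \<bar>y\<bar>\<^sup>2 + o(1 / \<bar>y\<bar>)\<close> for every \<open>x\<close>. The left-hand side is
  subharmonic as a function of \<open>y / \<bar>y\<bar>\<^sup>2\<close> with upper limit \<open>\<beta>\<close> at \<open>0\<close>, so two different vectors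
  \<open>Dw x - 2 \<beta> x\<close> would contradict the mean value inequality. Thus \<open>Dw\<close> is affine.
\<close>

subsection \<open>Spectral theory of symmetric matrices\<close>

text \<open>The equation is not proper: raising \<open>w\<close> by a constant adds a multiple of
  the Hessian to \<open>conf_mat\<close>, and the Hessian has no sign. So two viscosity solutions
  cannot be compared by monotonicity in the unknown; a bound on the Hessian has to replace it. At a
  contact point with a second-order expansion, \<open>w\<close> is its own test function and its
  spectrum lies in a fixed compact part of \<Gamma>. Then \<open>w\<close> plus a barrier plus an
  affine function is a test function for the reflection, of which no second derivative is ever
  taken. What must be shown is that a gain in one direction beats small losses in all directions:
  this is \<open>strict_ellipticity\<close>, where (S3) competes with (S4).

  At infinity nothing is known about \<open>w\<close> beforehand. There (S6) acts, through the trace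
  alone: the inversion \<open>kelvin 1 w\<close> is subharmonic off the puncture 0. Logarithms
  absorb the puncture in every dimension n \<ge> 3. This yields first the quadratic growth of
  \<open>w\<close>, which starts the moving spheres, and at the end the mean value inequality across
  the puncture.\<close>

definition orthonormal_family :: "('n \<Rightarrow> real^'n) \<Rightarrow> bool" where
  "orthonormal_family q \<longleftrightarrow> (\<forall>i j. q i \<bullet> q j = (if i = j then 1 else 0))"

lemma symmetric_matrix_inner:
  fixes A :: "real^'n^'n"
  assumes "transpose A = A"
  shows "(A *v x) \<bullet> y = x \<bullet> (A *v y)"
  using assms by (metis dot_lmul_matrix transpose_matrix_vector)

text \<open>First-order condition at a minimum, without derivatives. At t = -c/D with D = |d| + 1
  the expression equals c^2 (d - 2D) / D^2, negative unless c = 0.\<close>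

lemma linear_coeff_zero_if_quadratic_nonneg:
  fixes c d :: real
  assumes "\<And>t. 2 * t * c + t\<^sup>2 * d \<ge> 0"
  shows "c = 0"
proof (rule ccontr)
  assume "c \<noteq> 0"
  define D where "D = \<bar>d\<bar> + 1"
  have D: "D > 0" "d < D" unfolding D_def by auto
  have "2 * (- c / D) * c + (- c / D)\<^sup>2 * d = (c\<^sup>2 / D\<^sup>2) * (d - 2 * D)"
    using D by (simp add: field_simps power2_eq_square)
  also have "\<dots> < 0" using D \<open>c \<noteq> 0\<close> by (intro mult_pos_neg) auto
  finally show False using assms[of "- c / D"] by simp
qed

text \<open>A maximiser e of the quadratic form on the unit sphere of \<open>U\<close> is an
  eigenvector: the first variation in directions of \<open>U\<close> makes l e - A e orthogonal to
  \<open>U\<close>, while invariance puts it into \<open>U\<close>.\<close>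

lemma eigenvector_in_invariant_subspace:
  fixes A :: "real^'n^'n"
  assumes sym: "transpose A = A" and U: "subspace U" "\<And>x. x \<in> U \<Longrightarrow> A *v x \<in> U" "U \<noteq> {0}"
  obtains e l where "e \<in> U" "norm e = 1" "A *v e = l *\<^sub>R e"
proof -
  let ?S = "U \<inter> sphere 0 1"
  obtain x where "x \<in> U" "x \<noteq> 0" using U subspace_0 by blast
  then have "x /\<^sub>R norm x \<in> ?S" using U(1) by (auto simp: subspace_mul)
  then have ne: "?S \<noteq> {}" by blast
  have "compact ?S" using U(1) by (simp add: closed_subspace closed_Int_compact)
  moreover have "continuous_on ?S (\<lambda>x. x \<bullet> (A *v x))"
    by (intro continuous_intros linear_continuous_on_compose matrix_vector_mul_linear) 
  ultimately obtain e where e: "e \<in> ?S" and mx: "\<And>y. y \<in> ?S \<Longrightarrow> y \<bullet> (A *v y) \<le> e \<bullet> (A *v e)"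
    using continuous_attains_sup[OF _ ne] by blast
  define l where "l = e \<bullet> (A *v e)"
  have q: "y \<bullet> (A *v y) \<le> l * (y \<bullet> y)" if "y \<in> U" for y
  proof (cases "y = 0")
    case False
    have "y /\<^sub>R norm y \<in> ?S" using that False U(1) by (auto simp: subspace_mul)
    from mx[OF this] have "(y \<bullet> (A *v y)) / (norm y)\<^sup>2 \<le> l"
      by (simp add: l_def matrix_vector_mult_scaleR power2_eq_square divide_inverse ac_simps)
    then show ?thesis using False by (simp add: field_simps power2_norm_eq_inner)
  qed simp
  have ee: "e \<bullet> e = 1" using e by (simp add: dot_square_norm)
  have "y \<bullet> (l *\<^sub>R e - A *v e) = 0" if y: "y \<in> U" for y
  proof (rule linear_coeff_zero_if_quadratic_nonneg)
    fix t
    have "e + t *\<^sub>R y \<in> U" using e y U(1) by (simp add: subspace_add subspace_mul)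
    from q[OF this] have "(e + t *\<^sub>R y) \<bullet> (A *v (e + t *\<^sub>R y)) \<le> l * ((e + t *\<^sub>R y) \<bullet> (e + t *\<^sub>R y))" .
    moreover have "e \<bullet> (A *v y) = y \<bullet> (A *v e)"
      using symmetric_matrix_inner[OF sym, of e y] by (simp add: inner_commute)
    ultimately show "0 \<le> 2 * t * (y \<bullet> (l *\<^sub>R e - A *v e)) + t\<^sup>2 * (l * (y \<bullet> y) - y \<bullet> (A *v y))"
      using ee by (simp add: matrix_vector_right_distrib matrix_vector_mult_scaleR
            inner_simps algebra_simps power2_eq_square l_def[symmetric] inner_commute)
  qed
  moreover have "l *\<^sub>R e - A *v e \<in> U"
    using e U by (simp add: subspace_diff subspace_mul)
  ultimately have "A *v e = l *\<^sub>R e" by (metis inner_eq_zero_iff right_minus_eq)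
  then show ?thesis using that e by auto
qed

text \<open>Induction on the number of orthonormal eigenvectors: by symmetry, the orthogonal
  complement of those already found is invariant, and it is nonzero as long as there are fewer than
  n.\<close>

lemma orthonormal_eigenbasis_exists:
  fixes A :: "real^'n^'n"
  assumes sym: "transpose A = A"
  obtains q d where "orthonormal_family q" "\<And>i. A *v q i = d i *\<^sub>R q i"
proof -
  have *: "\<exists>S. card S = k \<and> finite S \<and> pairwise orthogonal S \<and> (\<forall>x\<in>S. norm x = 1 \<and> (\<exists>l. A *v x = l *\<^sub>R x))"
    if "k \<le> CARD('n)" for k
    using that
  proof (induction k)
    case (Suc k)
    then obtain S where S: "card S = k" "finite S" "pairwise orthogonal S"
      "\<And>x. x \<in> S \<Longrightarrow> norm x = 1 \<and> (\<exists>l. A *v x = l *\<^sub>R x)" by auto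
    define U where "U = {x. \<forall>s\<in>S. s \<bullet> x = 0}"
    have sU: "subspace U" unfolding subspace_def U_def by (auto simp: inner_simps)
    have inv: "A *v x \<in> U" if "x \<in> U" for x
      unfolding U_def
    proof (intro CollectI ballI)
      fix s assume "s \<in> S"
      with S(4) obtain l where "A *v s = l *\<^sub>R s" by blast
      then show "s \<bullet> (A *v x) = 0"
        using symmetric_matrix_inner[OF sym, of s x] that \<open>s \<in> S\<close> by (auto simp: U_def)
    qed
    have "dim S \<le> k" using dim_le_card'[OF S(2)] S(1) by simp
    then have "dim S < DIM(real^'n)" using Suc.prems by simp
    from orthogonal_to_subspace_exists[OF this]
    obtain x where x: "x \<noteq> 0" "\<And>y. y \<in> span S \<Longrightarrow> orthogonal x y" by blast
    then have "x \<in> U" unfolding U_def by (auto simp: orthogonal_def inner_commute span_base)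
    then have "U \<noteq> {0}" using x by auto
    from eigenvector_in_invariant_subspace[OF sym sU inv this]
    obtain e l where e: "e \<in> U" "norm e = 1" "A *v e = l *\<^sub>R e" by metis
    have "e \<notin> S" using e by (force simp: U_def)
    moreover have "pairwise orthogonal (insert e S)"
      using S(3) e(1) by (auto simp: pairwise_insert U_def orthogonal_def inner_commute)
    ultimately show ?case
      using S e by (intro exI[of _ "insert e S"]) auto
  qed (auto intro: exI[of _ "{}"])
  from *[of "CARD('n)"] obtain S where S: "card S = CARD('n)" "finite S" "pairwise orthogonal S"
      "\<And>x. x \<in> S \<Longrightarrow> norm x = 1 \<and> (\<exists>l. A *v x = l *\<^sub>R x)" by auto
  obtain q where q: "bij_betw q (UNIV::'n set) S"
    using S(1,2) by (metis finite_same_card_bij finite_class.finite_UNIV)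
  have qS: "q i \<in> S" for i using q by (auto simp: bij_betw_def)
  have "orthonormal_family q"
    unfolding orthonormal_family_def
  proof (intro allI)
    fix i j
    show "q i \<bullet> q j = (if i = j then 1 else 0)"
    proof (cases "i = j")
      case True then show ?thesis using S(4)[OF qS] by (simp add: dot_square_norm)
    next
      case False
      then have "q i \<noteq> q j" using q by (auto simp: bij_betw_def inj_on_def)
      then show ?thesis using S(3) qS False by (auto simp: pairwise_def orthogonal_def)
    qed
  qed
  moreover have "\<forall>i. \<exists>l. A *v q i = l *\<^sub>R q i" using S(4) qS by blast
  ultimately show ?thesis using that by metis
qed

lemma orthogonal_matrix_of_family:
  assumes "orthonormal_family (q :: 'n \<Rightarrow> real^'n)"
  shows "orthogonal_matrix (\<chi> i. q i)"
  using assms unfolding orthogonal_matrix_orthonormal_rows orthonormal_family_def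
  by (auto simp: row_def orthogonal_def norm_eq_1)

lemma matrix_conj_entry:
  fixes q :: "'n \<Rightarrow> real^'n"
  shows "((\<chi> i. q i) ** M ** transpose (\<chi> i. q i)) $ i $ j = q i \<bullet> (M *v q j)"
proof -
  have "((\<chi> i. q i) ** M ** transpose (\<chi> i. q i)) $ i $ j = (\<Sum>k\<in>UNIV. (\<Sum>l\<in>UNIV. q i $ l * M $ l $ k) * q j $ k)"
    by (simp add: matrix_matrix_mult_def transpose_def)
  also have "\<dots> = (\<Sum>l\<in>UNIV. q i $ l * (\<Sum>k\<in>UNIV. M $ l $ k * q j $ k))"
    by (simp add: sum_distrib_left sum_distrib_right mult.assoc) (rule sum.swap)
  also have "\<dots> = q i \<bullet> (M *v q j)"
    by (simp add: inner_vec_def matrix_vector_mult_def)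
  finally show ?thesis .
qed

lemma charpoly_of_eigenbasis:
  fixes A :: "real^'n^'n"
  assumes q: "orthonormal_family q" and A: "\<And>i. A *v q i = d i *\<^sub>R q i"
  shows "det (mat t - A) = (\<Prod>i\<in>UNIV. (t - d i))"
proof -
  let ?Q = "\<chi> i. q i" let ?D = "?Q ** (mat t - A) ** transpose ?Q"
  have e: "?D $ i $ j = (if i = j then t - d i else 0)" for i j
  proof -
    have "(mat t :: real^'n^'n) *v q j = t *\<^sub>R q j"
      by (simp add: vec_eq_iff matrix_vector_mult_def mat_def if_distrib[of "\<lambda>x. x * _"] cong: if_cong)
    then have "(mat t - A) *v q j = (t - d j) *\<^sub>R q j"
      by (simp add: A matrix_vector_mult_diff_rdistrib scaleR_left_diff_distrib)
    then show ?thesis using q by (simp add: matrix_conj_entry orthonormal_family_def)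
  qed
  have "det ?D = (\<Prod>i\<in>UNIV. ?D $ i $ i)" by (rule det_diagonal) (simp add: e)
  moreover have "det ?Q * det ?Q = 1"
    using det_orthogonal_matrix[OF orthogonal_matrix_of_family[OF q]] by auto
  moreover have "det ?D = det ?Q * det ?Q * det (mat t - A)" by (simp add: det_mul)
  ultimately show ?thesis by (simp add: e)
qed

text \<open>Both products have the same multiset of roots, and equality of two image multisets over
  one index type yields a permutation.\<close>

lemma linear_factors_unique:
  fixes a b :: "'n::finite \<Rightarrow> real"
  assumes "\<And>t. (\<Prod>i\<in>UNIV. (t - a i)) = (\<Prod>i\<in>UNIV. (t - b i))"
  obtains \<pi> where "bij \<pi>" "\<And>i. a i = b (\<pi> i)"
proof -
  let ?P = "\<lambda>a. \<Prod>i\<in>(UNIV::'n set). [:- a i, 1:]"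
  have "?P a = ?P b"
    by (intro poly_eqI_degree_lead_coeff poly_eq_poly_eq_iff[THEN iffD1] ext)
       (use assms in \<open>simp add: poly_prod\<close>)
  moreover have "proots (?P a) = image_mset a (mset_set UNIV)" for a :: "'n \<Rightarrow> real"
    by (subst proots_prod) (auto simp: sum_unfold_sum_mset)
  ultimately have "image_mset a (mset_set UNIV) = image_mset b (mset_set UNIV)" by metis
  from image_mset_eq_implies_permutes[OF _ this] obtain p
    where "p permutes (UNIV::'n set)" "\<forall>x\<in>UNIV. a x = b (p x)" by auto
  then show ?thesis using that[of p] by (auto simp: permutes_bij)
qed

text \<open>The eigenvalues along an eigenbasis are a witness for the choice in
  \<open>eigvals\<close>; the chosen vector therefore has the same characteristic polynomial and the
  same roots.\<close>

lemma eigvals_permutation: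
  fixes A :: "real^'n^'n"
  assumes "orthonormal_family q" and "\<And>i. A *v q i = d i *\<^sub>R q i"
  obtains \<pi> where "bij \<pi>" "\<And>i. eigvals A $ i = d (\<pi> i)"
proof -
  have "\<forall>t. det (mat t - A) = (\<Prod>i\<in>UNIV. (t - (\<chi> i. d i) $ i))"
    using charpoly_of_eigenbasis[OF assms] by simp
  then have "\<forall>t. det (mat t - A) = (\<Prod>i\<in>UNIV. (t - eigvals A $ i))"
    unfolding eigvals_def by (rule someI)
  then have "(\<Prod>i\<in>UNIV. (t - eigvals A $ i)) = (\<Prod>i\<in>UNIV. (t - d i))" for t
    using charpoly_of_eigenbasis[OF assms, of t] by simp
  from linear_factors_unique[of "\<lambda>i. eigvals A $ i" d, OF this] that show ?thesis by metis
qed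

lemma eigvals_eigenbasis:
  fixes A :: "real^'n^'n"
  assumes "transpose A = A"
  obtains q where "orthonormal_family q" "\<And>i. A *v q i = (eigvals A $ i) *\<^sub>R q i"
proof -
  obtain q d where q: "orthonormal_family q" "\<And>i. A *v q i = d i *\<^sub>R q i"
    using orthonormal_eigenbasis_exists[OF assms] by blast
  obtain \<pi> where p: "bij \<pi>" "\<And>i. eigvals A $ i = d (\<pi> i)" using eigvals_permutation[OF q] by blast
  have "orthonormal_family (q \<circ> \<pi>)"
    using q(1) p(1) by (auto simp: orthonormal_family_def bij_def inj_eq)
  then show ?thesis using that[of "q \<circ> \<pi>"] q(2) p(2) by simp
qed

text \<open>An exact equality, not one up to permutation: \<open>eigvals\<close> depends on the
  matrix through its characteristic polynomial alone, which conjugation preserves.\<close>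

lemma eigvals_orthogonal_conj:
  fixes A R :: "real^'n^'n"
  assumes "orthogonal_matrix R"
  shows "eigvals (transpose R ** A ** R) = eigvals A"
proof -
  have "det (mat t - transpose R ** A ** R) = det (mat t - A)" for t
  proof -
    have "transpose R ** mat t ** R = mat t"
    proof -
      have "mat t ** R = R ** mat t"
        by (simp add: matrix_matrix_mult_def mat_def vec_eq_iff if_distrib[of "\<lambda>x. x * _"]
            if_distrib[of "\<lambda>x. _ * x"] cong: if_cong)
      then show ?thesis
        using assms by (metis matrix_mul_assoc matrix_mul_lid orthogonal_matrix)
    qed
    then have "mat t - transpose R ** A ** R = transpose R ** (mat t - A) ** R"
      by (simp add: matrix_matrix_mult_def vec_eq_iff right_diff_distrib left_diff_distrib sum_subtractf)
    moreover have "det R * det R = 1" using det_orthogonal_matrix[OF assms] by auto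
    ultimately show ?thesis by (simp add: det_mul)
  qed
  then show ?thesis by (simp add: eigvals_def)
qed

lemma sum_eigvals:
  fixes A :: "real^'n^'n"
  assumes "transpose A = A"
  shows "(\<Sum>i\<in>UNIV. eigvals A $ i) = (\<Sum>i\<in>UNIV. A $ i $ i)"
proof -
  obtain q where q: "orthonormal_family q" "\<And>i. A *v q i = (eigvals A $ i) *\<^sub>R q i"
    using eigvals_eigenbasis[OF assms] by blast
  let ?Q = "\<chi> i. q i"
  have "trace (?Q ** (A ** transpose ?Q)) = trace (?Q ** A ** transpose ?Q)"
    by (simp add: matrix_mul_assoc)
  also have "\<dots> = (\<Sum>i\<in>UNIV. eigvals A $ i)"
    using q by (simp add: trace_def matrix_conj_entry orthonormal_family_def)
  finally have "trace (A ** (transpose ?Q ** ?Q)) = (\<Sum>i\<in>UNIV. eigvals A $ i)"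
    by (subst (asm) trace_mul_sym) (simp add: matrix_mul_assoc)
  then show ?thesis
    using orthogonal_matrix_of_family[OF q(1)] by (simp add: orthogonal_matrix_def trace_def)
qed

lemma eigvals_bound:
  fixes A :: "real^'n^'n"
  assumes "transpose A = A" and "\<And>x. \<bar>x \<bullet> (A *v x)\<bar> \<le> C * (x \<bullet> x)"
  shows "\<bar>eigvals A $ i\<bar> \<le> C"
proof -
  obtain q where q: "orthonormal_family q" "\<And>i. A *v q i = (eigvals A $ i) *\<^sub>R q i"
    using eigvals_eigenbasis[OF assms(1)] by blast
  show ?thesis using assms(2)[of "q i"] q by (simp add: orthonormal_family_def)
qed

text \<open>The hypothesis says that in increasing order each b is at least the corresponding a.
  Pairing the two minima and removing them preserves it, which gives the induction.\<close>

lemma matching_from_counting: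
  fixes a :: "'a \<Rightarrow> real" and b :: "'b \<Rightarrow> real"
  assumes "finite I" "finite J" "card I = card J"
    and "\<And>t. card {j\<in>J. b j < t} \<le> card {i\<in>I. a i < t}"
  shows "\<exists>\<pi>. bij_betw \<pi> I J \<and> (\<forall>i\<in>I. a i \<le> b (\<pi> i))"
  using assms
proof (induction "card I" arbitrary: I J)
  case 0
  then show ?case by (auto simp: bij_betw_def)
next
  case (Suc n)
  then have ne: "I \<noteq> {}" "J \<noteq> {}" by auto
  obtain i where i: "i \<in> I" "\<And>k. k \<in> I \<Longrightarrow> a i \<le> a k"
    using ne(1) Suc.prems(1) ex_min_if_finite[of "a ` I"] by (auto simp: not_less)
  obtain j where j: "j \<in> J" "\<And>k. k \<in> J \<Longrightarrow> b j \<le> b k"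
    using ne(2) Suc.prems(2) ex_min_if_finite[of "b ` J"] by (auto simp: not_less)
  have le: "a i \<le> b j"
  proof (rule ccontr)
    assume "\<not> a i \<le> b j"
    then have "{k\<in>I. a k < a i} = {}" "j \<in> {k\<in>J. b k < a i}" using i j by force+
    moreover have "finite {k\<in>J. b k < a i}" using Suc.prems by simp
    ultimately show False using Suc.prems(4)[of "a i"] by (metis card.empty card_0_eq empty_iff le_zero_eq)
  qed
  have "\<exists>\<pi>. bij_betw \<pi> (I - {i}) (J - {j}) \<and> (\<forall>k\<in>I - {i}. a k \<le> b (\<pi> k))"
  proof (rule Suc.hyps(1))
    fix t
    show "card {k \<in> J - {j}. b k < t} \<le> card {k \<in> I - {i}. a k < t}"
    proof (cases "b j < t")
      case True
      have "{k \<in> J - {j}. b k < t} = {k \<in> J. b k < t} - {j}"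
        "{k \<in> I - {i}. a k < t} = {k \<in> I. a k < t} - {i}" by auto
      moreover have "j \<in> {k \<in> J. b k < t}" "i \<in> {k \<in> I. a k < t}" using True le i j by auto
      ultimately show ?thesis using Suc.prems(4)[of t] by (simp add: card_Diff_singleton)
    next
      case False
      then have "{k \<in> J - {j}. b k < t} = {}" using j by force
      then show ?thesis by (metis card.empty zero_le)
    qed
  qed (use Suc i j in auto)
  then obtain \<pi> where p: "bij_betw \<pi> (I - {i}) (J - {j})" "\<And>k. k\<in>I - {i} \<Longrightarrow> a k \<le> b (\<pi> k)" by auto
  have "bij_betw (\<pi>(i := j)) (insert i (I - {i})) (insert j (J - {j}))"
    using p(1) by (auto simp: bij_betw_def inj_on_def)
  then show ?case using p le i j
    by (intro exI[of _ "\<pi>(i := j)"]) (auto simp: insert_absorb)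
qed

lemma orthonormal_span_inner:
  assumes q: "orthonormal_family (q :: 'n \<Rightarrow> real^'n)" and x: "x \<in> span (q ` I)"
  obtains c where "x = (\<Sum>i\<in>I. c i *\<^sub>R q i)"
proof -
  have "inj q"
    using q unfolding orthonormal_family_def inj_def by (metis zero_neq_one)
  then have "inj_on q I" by (simp add: inj_on_def inj_def)
  from x obtain u where "x = (\<Sum>v\<in>q ` I. u v *\<^sub>R v)" by (auto simp: span_finite)
  then have "x = (\<Sum>i\<in>I. u (q i) *\<^sub>R q i)" by (simp add: sum.reindex[OF \<open>inj_on q I\<close>])
  then show ?thesis using that[of "u \<circ> q"] by simp
qed

lemma orthonormal_sum_inner:
  assumes q: "orthonormal_family (q :: 'n \<Rightarrow> real^'n)"
  shows "(\<Sum>i\<in>I. c i *\<^sub>R q i) \<bullet> (\<Sum>i\<in>I. d i *\<^sub>R q i) = (\<Sum>i\<in>I. c i * d i)"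
proof -
  have "(\<Sum>i\<in>I. c i *\<^sub>R q i) \<bullet> (\<Sum>i\<in>I. d i *\<^sub>R q i) = (\<Sum>i\<in>I. \<Sum>j\<in>I. c i * d j * (q i \<bullet> q j))"
    by (simp add: inner_sum_left inner_sum_right algebra_simps sum_distrib_left) (rule sum.swap)
  also have "\<dots> = (\<Sum>i\<in>I. \<Sum>j\<in>I. if i = j then c i * d j else 0)"
    using q by (intro sum.cong) (auto simp: orthonormal_family_def)
  also have "\<dots> = (\<Sum>i\<in>I. c i * d i)" by (simp add: sum.delta)
  finally show ?thesis .
qed

lemma orthonormal_span_form:
  fixes A :: "real^'n^'n"
  assumes q: "orthonormal_family q" "\<And>i. A *v q i = a i *\<^sub>R q i" and x: "x \<in> span (q ` I)"
  obtains c where "x \<bullet> x = (\<Sum>i\<in>I. (c i)\<^sup>2)" "x \<bullet> (A *v x) = (\<Sum>i\<in>I. a i * (c i)\<^sup>2)"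
proof -
  obtain c where c: "x = (\<Sum>i\<in>I. c i *\<^sub>R q i)" using orthonormal_span_inner[OF q(1) x] by blast
  have "A *v x = (\<Sum>i\<in>I. (a i * c i) *\<^sub>R q i)"
    unfolding c by (simp add: linear_sum[OF matrix_vector_mul_linear] matrix_vector_mult_scaleR q(2) mult.commute)
  then have "x \<bullet> x = (\<Sum>i\<in>I. (c i)\<^sup>2)" "x \<bullet> (A *v x) = (\<Sum>i\<in>I. a i * (c i)\<^sup>2)"
    unfolding c using orthonormal_sum_inner[OF q(1)] by (simp_all add: power2_eq_square algebra_simps)
  then show ?thesis using that by blast
qed

lemma dim_orthonormal:
  assumes q: "orthonormal_family (q :: 'n \<Rightarrow> real^'n)"
  shows "dim (span (q ` I)) = card I"
proof -
  have inj: "inj_on q I" using q unfolding orthonormal_family_def inj_on_def by (metis zero_neq_one)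
  have "independent (q ` I)"
  proof (rule pairwise_orthogonal_independent)
    show "pairwise orthogonal (q ` I)" using q by (auto simp: pairwise_def orthogonal_def orthonormal_family_def)
    show "0 \<notin> q ` I"
    proof
      assume "0 \<in> q ` I"
      then obtain i where "q i = 0" by auto
      then have "q i \<bullet> q i = 0" by simp
      then show False using q unfolding orthonormal_family_def by (metis zero_neq_one)
    qed
  qed
  then show ?thesis using inj by (simp add: dim_eq_card_independent card_image)
qed

text \<open>Weyl's monotonicity with slack \<eta>. If more eigenvalues of \<open>B\<close> than of
  \<open>A\<close> (lowered by \<eta>) were below t, the span of the eigenvectors of
  \<open>B\<close> below t and the span of the remaining eigenvectors of \<open>A\<close> would
  share a nonzero vector by dimension count, and there the two forms contradict
  \<open>le\<close>.\<close>

lemma eigvals_monotone: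
  fixes A B :: "real^'n^'n"
  assumes sA: "transpose A = A" and sB: "transpose B = B"
    and le: "\<And>x. x \<bullet> (A *v x) - \<eta> * (x \<bullet> x) \<le> x \<bullet> (B *v x)"
  obtains \<pi> where "bij \<pi>" "\<And>i. eigvals A $ i - \<eta> \<le> eigvals B $ \<pi> i"
proof -
  let ?a = "\<lambda>i. eigvals A $ i - \<eta>" let ?b = "\<lambda>i. eigvals B $ i"
  obtain p where p: "orthonormal_family p" "\<And>i. A *v p i = (eigvals A $ i) *\<^sub>R p i"
    using eigvals_eigenbasis[OF sA] by blast
  obtain q where q: "orthonormal_family q" "\<And>i. B *v q i = ?b i *\<^sub>R q i"
    using eigvals_eigenbasis[OF sB] by blast
  have "\<exists>\<pi>. bij_betw \<pi> (UNIV::'n set) UNIV \<and> (\<forall>i\<in>UNIV. ?a i \<le> ?b (\<pi> i))"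
  proof (rule matching_from_counting)
    fix t
    let ?I = "{i. ?a i \<ge> t}" and ?J = "{i. ?b i < t}"
    show "card {j\<in>UNIV. ?b j < t} \<le> card {i\<in>UNIV. ?a i < t}"
    proof (rule ccontr)
      assume "\<not> ?thesis"
      then have gt: "card {i. ?a i < t} < card ?J" by simp
      have "UNIV - ?I = {i. ?a i < t}" by auto
      then have "card ?I + card {i. ?a i < t} = CARD('n)"
        by (metis card_Diff_subset card_mono finite subset_UNIV le_add_diff_inverse)
      with gt have sum: "card ?I + card ?J > CARD('n)" by simp
      let ?S = "span (p ` ?I)" and ?T = "span (q ` ?J)"
      have "dim {x + y |x y. x \<in> ?S \<and> y \<in> ?T} + dim (?S \<inter> ?T) = dim ?S + dim ?T"
        by (rule dim_sums_Int) auto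
      moreover have "dim {x + y |x y. x \<in> ?S \<and> y \<in> ?T} \<le> CARD('n)"
        using dim_subset_UNIV[of "{x + y |x y. x \<in> ?S \<and> y \<in> ?T}"] by simp
      ultimately have "dim (?S \<inter> ?T) \<noteq> 0"
        using sum dim_orthonormal[OF p(1), of ?I] dim_orthonormal[OF q(1), of ?J] by linarith
      then obtain x where x: "x \<in> ?S" "x \<in> ?T" "x \<noteq> 0" by (auto simp: dim_eq_0)
      obtain c where c: "x \<bullet> x = (\<Sum>i\<in>?I. (c i)\<^sup>2)" "x \<bullet> (A *v x) = (\<Sum>i\<in>?I. eigvals A $ i * (c i)\<^sup>2)"
        using orthonormal_span_form[OF p x(1)] by blast
      obtain d where d: "x \<bullet> x = (\<Sum>i\<in>?J. (d i)\<^sup>2)" "x \<bullet> (B *v x) = (\<Sum>i\<in>?J. ?b i * (d i)\<^sup>2)"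
        using orthonormal_span_form[OF q x(2)] by blast
      have xx: "x \<bullet> x > 0" using x by simp
      have "(t + \<eta>) * (x \<bullet> x) \<le> x \<bullet> (A *v x)"
        unfolding c sum_distrib_left by (intro sum_mono mult_right_mono) auto
      moreover have "x \<bullet> (B *v x) < t * (x \<bullet> x)"
      proof -
        obtain j where "j \<in> ?J" "d j \<noteq> 0"
          using xx d(1) by (metis (no_types, lifting) less_numeral_extra(3) sum.neutral zero_power2)
        then have "(\<Sum>i\<in>?J. ?b i * (d i)\<^sup>2) < (\<Sum>i\<in>?J. t * (d i)\<^sup>2)"
          by (intro sum_strict_mono_ex1) (auto intro!: mult_right_mono mult_strict_right_mono bexI[of _ j])
        then show ?thesis unfolding d sum_distrib_left .
      qed
      ultimately show False using le[of x] by (simp add: algebra_simps)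
    qed
  qed auto
  then show ?thesis using that by (auto simp: bij_def bij_betw_def)
qed

subsection \<open>Strict ellipticity\<close>

definition rank1 :: "real^'n \<Rightarrow> real^'n^'n" where
  "rank1 e = (\<chi> i j. e $ i * e $ j)"

lemma rank1_mult: "rank1 e *v x = (e \<bullet> x) *\<^sub>R e"
  by (simp add: rank1_def matrix_vector_mult_def vec_eq_iff inner_vec_def sum_distrib_left ac_simps)

lemma transpose_rank1 [simp]: "transpose (rank1 e) = rank1 e"
  by (simp add: rank1_def transpose_def vec_eq_iff mult.commute)

lemma trace_rank1: "trace (rank1 e) = e \<bullet> e"
  by (simp add: rank1_def trace_def inner_vec_def)

lemma transpose_add: "transpose (A + B) = transpose A + transpose (B :: real^'n^'m)"
  and transpose_diff: "transpose (A - B) = transpose A - transpose (B :: real^'n^'m)"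
  and transpose_uminus: "transpose (- B) = - transpose (B :: real^'n^'m)"
  by (simp_all add: transpose_def vec_eq_iff)

lemma trace_scaleR: "trace (c *\<^sub>R A) = c * trace (A :: real^'n^'n)"
  by (simp add: trace_def sum_distrib_left)

lemma scaleR_matrix_vector: "(c *\<^sub>R A) *v x = c *\<^sub>R (A *v (x :: real^'n))"
  by (simp add: matrix_vector_mult_def vec_eq_iff sum_distrib_left ac_simps)

lemmas sym_matrix_simps = transpose_add transpose_diff transpose_uminus transpose_scalar transpose_mat
lemmas quad_form_simps = matrix_vector_mult_add_rdistrib matrix_vector_mult_diff_rdistrib scaleR_matrix_vector
  rank1_mult

lemma closure_Gamma_pos:
  assumes "\<And>i. \<mu> $ i \<ge> 0"
  shows "\<mu> \<in> closure (Gamma_pos :: (real^'n) set)"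
proof -
  have "(\<lambda>k. \<mu> + (\<chi> i. inverse (real (Suc k)))) \<longlonglongrightarrow> \<mu> + (\<chi> i. 0)"
    by (intro tendsto_intros tendsto_vec_lambda LIMSEQ_inverse_real_of_nat)
  moreover have "(\<chi> i. 0) = (0 :: real^'n)" by (simp add: vec_eq_iff)
  moreover have "\<mu> + (\<chi> i. inverse (real (Suc k))) \<in> Gamma_pos" for k
    using assms by (auto simp: Gamma_pos_def intro!: add_nonneg_pos)
  ultimately show ?thesis
    unfolding closure_sequential
    by (intro exI[of _ "\<lambda>k. \<mu> + (\<chi> i. inverse (real (Suc k)))"]) (simp del: of_nat_Suc)
qed

lemma eigvals_add_scalar:
  fixes A :: "real^'n^'n"
  assumes "transpose A = A"
  obtains \<pi> where "bij \<pi>" "\<And>i. eigvals (A + t *\<^sub>R mat 1) $ i = eigvals A $ \<pi> i + t"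
proof -
  obtain q where q: "orthonormal_family q" "\<And>i. A *v q i = (eigvals A $ i) *\<^sub>R q i"
    using eigvals_eigenbasis[OF assms] by blast
  have "(A + t *\<^sub>R mat 1) *v q i = (eigvals A $ i + t) *\<^sub>R q i" for i
    by (simp add: quad_form_simps q scaleR_left_distrib)
  from eigvals_permutation[OF q(1) this] that show ?thesis by blast
qed

lemma Gamma_1_imp_trace_pos:
  fixes A :: "real^'n^'n"
  assumes "transpose A = A" "eigvals A \<in> Gamma_1"
  shows "trace A > 0"
  using assms sum_eigvals[OF assms(1)] by (simp add: Gamma_1_def trace_def)

locale conformal_equation =
  fixes f :: "real^'n \<Rightarrow> real" and \<Gamma> :: "(real^'n) set"
  assumes card_ge_3: "CARD('n) \<ge> 3"
    and open_Gamma: "open \<Gamma>"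
    and cont_f: "continuous_on (closure \<Gamma>) f"
    and S1: "cond_S1 f \<Gamma>" and S2: "cond_S2 f \<Gamma>" and S3: "cond_S3 f \<Gamma>"
    and S4: "cond_S4 f \<Gamma>" and S5: "cond_S5 f \<Gamma>" and S6: "cond_S6 \<Gamma>"
begin

lemma permuted:
  assumes "bij \<pi>" "\<And>i. \<nu> $ i = \<nu>' $ \<pi> i" "\<nu>' \<in> \<Gamma>"
  shows "\<nu> \<in> \<Gamma>" "f \<nu> = f \<nu>'"
proof -
  have "\<nu> = (\<chi> i. \<nu>' $ \<pi> i)" using assms(2) by (simp add: vec_eq_iff)
  then show "\<nu> \<in> \<Gamma>" "f \<nu> = f \<nu>'" using S1 assms unfolding cond_S1_def by auto
qed

lemma permuted':
  assumes "bij \<pi>" "\<And>i. \<nu> $ i = \<nu>' $ \<pi> i" "\<nu> \<in> \<Gamma>"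
  shows "\<nu>' \<in> \<Gamma>" "f \<nu>' = f \<nu>"
proof -
  have "\<nu>' $ i = \<nu> $ inv \<pi> i" for i using assms(1,2) by (simp add: bij_def surj_f_inv_f)
  then show "\<nu>' \<in> \<Gamma>" "f \<nu>' = f \<nu>" using permuted[of "inv \<pi>" \<nu>' \<nu>] assms bij_imp_bij_inv by auto
qed

lemma increasing:
  assumes "\<nu> \<in> \<Gamma>" "\<And>i. \<nu> $ i \<le> \<nu>' $ i"
  shows "\<nu>' \<in> \<Gamma>" "f \<nu> \<le> f \<nu>'"
proof -
  have "\<nu>' - \<nu> \<in> closure Gamma_pos" using assms(2) by (intro closure_Gamma_pos) auto
  then have "\<nu> + (\<nu>' - \<nu>) \<in> \<Gamma> \<and> f \<nu> \<le> f (\<nu> + (\<nu>' - \<nu>))"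
    using S2 assms(1) unfolding cond_S2_def by blast
  then show "\<nu>' \<in> \<Gamma>" "f \<nu> \<le> f \<nu>'" by auto
qed

lemma in_Gamma: "\<nu> \<in> closure \<Gamma> \<Longrightarrow> f \<nu> \<ge> 1 \<Longrightarrow> \<nu> \<in> \<Gamma>"
  using S5 unfolding cond_S5_def by blast

text \<open>A gain \<open>N\<close> in one direction outweighs a loss \<kappa> N in all directions,
  with \<kappa> uniform in \<open>N\<close>, \<open>e\<close> and the matrices. Adding
  \<open>N\<close> times \<open>rank1 e\<close> raises the eigenvalues by nonnegative amounts of
  total \<open>N\<close> (the trace), so (S3) raises f by a multiple of \<open>N\<close>; the loss
  costs at most a multiple of \<kappa> N by (S4).\<close>

lemma strict_ellipticity:
  obtains \<kappa> where "\<kappa> > 0"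
    "\<And>A B N e. \<lbrakk>transpose A = A; transpose B = B; \<And>i. \<bar>eigvals A $ i\<bar> \<le> C0; eigvals A \<in> closure \<Gamma>;
       f (eigvals A) \<ge> 1; 0 < N; N \<le> 1; norm e = 1;
       \<And>x. x \<bullet> (A *v x) + N * (e \<bullet> x)\<^sup>2 - \<kappa> * N * (x \<bullet> x) \<le> x \<bullet> (B *v x)\<rbrakk>
      \<Longrightarrow> eigvals B \<in> \<Gamma> \<and> f (eigvals B) > 1"
proof -
  \<comment> \<open>The possible spectra of \<open>A\<close>; (S5) keeps this closed bounded set
    inside \<Gamma>.\<close>
  define K0 where "K0 = {\<nu> \<in> closure \<Gamma> \<inter> cbox (\<chi> i. - C0) (\<chi> i. C0). f \<nu> \<ge> 1}"
  have "closed K0" unfolding K0_def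
  proof (rule continuous_on_closed_Collect_le)
    show "continuous_on (closure \<Gamma> \<inter> cbox (\<chi> i. - C0) (\<chi> i. C0)) f"
      by (rule continuous_on_subset[OF cont_f]) blast
  qed (auto intro: closed_Int[OF closed_closure closed_cbox])
  moreover have "bounded K0"
    by (rule bounded_subset[OF bounded_cbox]) (auto simp: K0_def)
  ultimately have K0: "compact K0" by (simp add: compact_eq_bounded_closed)
  have K0\<Gamma>: "K0 \<subseteq> \<Gamma>" using in_Gamma by (auto simp: K0_def)
  obtain \<delta> where \<delta>: "\<delta> > 0" "\<And>\<nu> \<mu>. \<nu> \<in> K0 \<Longrightarrow> \<mu> \<in> closure Gamma_pos \<Longrightarrow> f (\<nu> + \<mu>) - f \<nu> \<ge> \<delta> * norm \<mu>"
  proof -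
    from S3[unfolded cond_S3_def, rule_format, OF conjI[OF K0 K0\<Gamma>]] show ?thesis using that by blast
  qed
  \<comment> \<open>Room for the increments caused by the rank-one term, each between 0 and 1; (S2)
    keeps the sums in \<Gamma>.\<close>
  define K' where "K' = {x + y |x y. x \<in> K0 \<and> y \<in> cbox 0 (\<chi> i. 1)}"
  have cK': "compact K'" unfolding K'_def by (intro compact_sums K0 compact_cbox)
  have "K' \<subseteq> \<Gamma>"
  proof
    fix z assume "z \<in> K'"
    then obtain x y where "z = x + y" "x \<in> K0" "y \<in> cbox 0 (\<chi> i. 1)" unfolding K'_def by auto
    then show "z \<in> \<Gamma>" using K0\<Gamma> by (intro increasing(1)[of x z]) (auto simp: mem_box_cart)
  qed
  from compact_subset_open_imp_ball_epsilon_subset[OF cK' open_Gamma this]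
  obtain e1 where e1: "e1 > 0" "(\<Union>x\<in>K'. ball x e1) \<subseteq> \<Gamma>" .
  define e0 where "e0 = e1 / 2"
  \<comment> \<open>Room for the loss. The radius is half of \<open>e1\<close>, so that the closed
    balls stay inside the open neighbourhood of \<open>K'\<close>.\<close>
  define K1 where "K1 = {x + y |x y. x \<in> K' \<and> y \<in> cball 0 e0}"
  have cK1: "compact K1" unfolding K1_def by (intro compact_sums cK' compact_cball)
  have "K1 \<subseteq> \<Gamma>"
  proof
    fix z assume "z \<in> K1"
    then obtain x y where "z = x + y" "x \<in> K'" "norm y \<le> e0" unfolding K1_def by auto
    then have "z \<in> ball x e1" using e1(1) by (auto simp: dist_norm e0_def)
    then show "z \<in> \<Gamma>" using e1(2) \<open>x \<in> K'\<close> by blast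
  qed
  obtain C where C: "C > 0" "\<And>\<nu> \<nu>'. \<nu> \<in> K1 \<Longrightarrow> \<nu>' \<in> K1 \<Longrightarrow> \<bar>f \<nu>' - f \<nu>\<bar> \<le> C * norm (\<nu>' - \<nu>)"
  proof -
    from S4[unfolded cond_S4_def, rule_format, OF conjI[OF cK1 \<open>K1 \<subseteq> \<Gamma>\<close>]] show ?thesis using that by blast
  qed
  let ?n = "real CARD('n)"
  have n: "?n > 0" by simp
  \<comment> \<open>The first bound keeps the loss vector, of norm at most \<kappa> n, in the ball
    of radius \<open>e0\<close>; the second makes its Lipschitz cost at most half of the gain
    \<delta> N / n.\<close>
  define \<kappa> where "\<kappa> = min (e0 / ?n) (\<delta> / (2 * C * ?n * ?n))"
  have \<kappa>: "\<kappa> > 0" "\<kappa> * ?n \<le> e0" "C * \<kappa> * ?n < \<delta> / ?n"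
  proof -
    show "\<kappa> > 0" using e1 \<delta> C n by (simp add: \<kappa>_def e0_def)
    have "\<kappa> * ?n \<le> e0 / ?n * ?n" by (intro mult_right_mono) (auto simp: \<kappa>_def)
    then show "\<kappa> * ?n \<le> e0" by simp
    have "C * \<kappa> * ?n \<le> C * (\<delta> / (2 * C * ?n * ?n)) * ?n"
      using C by (intro mult_right_mono mult_left_mono) (auto simp: \<kappa>_def)
    also have "\<dots> < \<delta> / ?n" using C \<delta> n by (simp add: field_simps)
    finally show "C * \<kappa> * ?n < \<delta> / ?n" .
  qed
  show ?thesis
  proof (rule that[OF \<kappa>(1)])
    fix A B :: "real^'n^'n" and N and e :: "real^'n"
    assume sA: "transpose A = A" and sB: "transpose B = B" and bd: "\<And>i. \<bar>eigvals A $ i\<bar> \<le> C0"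
      and cl: "eigvals A \<in> closure \<Gamma>" and f1: "f (eigvals A) \<ge> 1" and N: "0 < N" "N \<le> 1" and e: "norm e = 1"
      and le: "\<And>x. x \<bullet> (A *v x) + N * (e \<bullet> x)\<^sup>2 - \<kappa> * N * (x \<bullet> x) \<le> x \<bullet> (B *v x)"
    let ?E = "eigvals A"
    have EK: "?E \<in> K0" using bd cl f1 unfolding K0_def by (auto simp: mem_box_cart abs_le_iff minus_le_iff)
    define A' where "A' = A + N *\<^sub>R rank1 e"
    have sA': "transpose A' = A'" by (simp add: A'_def sym_matrix_simps sA)
    have qA': "x \<bullet> (A' *v x) = x \<bullet> (A *v x) + N * (e \<bullet> x)\<^sup>2" for x
      by (simp add: A'_def quad_form_simps inner_simps power2_eq_square inner_commute)
    let ?E' = "eigvals A'" let ?F = "eigvals B"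
    obtain \<pi> where \<pi>: "bij \<pi>" "\<And>i. ?E $ i - 0 \<le> ?E' $ \<pi> i"
      by (rule eigvals_monotone[OF sA sA', of 0]) (use N in \<open>auto simp: qA'\<close>)
    obtain \<rho> where \<rho>: "bij \<rho>" "\<And>i. ?E' $ i - \<kappa> * N \<le> ?F $ \<rho> i"
      by (rule eigvals_monotone[OF sA' sB, of "\<kappa> * N"]) (use le in \<open>auto simp: qA'\<close>)
    \<comment> \<open>Increments of the eigenvalues after matching by \<pi>. They sum to the trace
      of the rank-one term, which is \<open>N\<close>, so \<mu> has norm at least N / n.\<close>
    define \<mu> where "\<mu> = (\<chi> i. ?E' $ \<pi> i - ?E $ i)"
    have \<mu>0: "\<mu> $ i \<ge> 0" for i using \<pi>(2)[of i] by (simp add: \<mu>_def)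
    have "(\<Sum>i\<in>UNIV. \<mu> $ i) = (\<Sum>i\<in>UNIV. ?E' $ \<pi> i) - (\<Sum>i\<in>UNIV. ?E $ i)"
      by (simp add: \<mu>_def sum_subtractf)
    also have "(\<Sum>i\<in>UNIV. ?E' $ \<pi> i) = (\<Sum>i\<in>UNIV. ?E' $ i)"
      using \<pi>(1) by (rule sum.reindex_bij_betw)
    also have "\<dots> - (\<Sum>i\<in>UNIV. ?E $ i) = trace A' - trace A"
      by (simp add: sum_eigvals sA sA' trace_def)
    also have "\<dots> = N" using e by (simp add: A'_def trace_add trace_scaleR trace_rank1 dot_square_norm)
    finally have sum: "(\<Sum>i\<in>UNIV. \<mu> $ i) = N" .
    have "\<mu> $ i \<le> (\<Sum>i\<in>UNIV. \<mu> $ i)" for i by (rule member_le_sum) (auto simp: \<mu>0)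
    then have \<mu>1: "\<mu> $ i \<le> 1" for i using sum N by (metis order_trans)
    have "N \<le> (\<Sum>i\<in>(UNIV::'n set). norm \<mu>)"
      unfolding sum[symmetric] using component_le_norm_cart[of \<mu>] by (intro sum_mono) (auto simp: abs_le_iff)
    then have \<mu>n: "N / ?n \<le> norm \<mu>" using n by (simp add: field_simps)
    have "\<mu> \<in> closure Gamma_pos" using \<mu>0 by (rule closure_Gamma_pos)
    from \<delta>(2)[OF EK this] have fE: "f (?E + \<mu>) \<ge> 1 + \<delta> * (N / ?n)"
      using f1 mult_left_mono[OF \<mu>n, of \<delta>] \<delta>(1) by linarith
    define s :: "real^'n" where "s = (\<chi> i. - \<kappa> * N)"
    have "norm s \<le> (\<Sum>i\<in>(UNIV::'n set). \<bar>s $ i\<bar>)" by (rule norm_le_l1_cart)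
    also have "\<dots> = \<kappa> * N * ?n" using \<kappa>(1) N by (simp add: s_def abs_mult)
    finally have ns: "norm s \<le> \<kappa> * N * ?n" .
    have "\<kappa> * N * ?n \<le> \<kappa> * 1 * ?n" using \<kappa> N n by (intro mult_right_mono mult_left_mono) auto
    then have ns': "norm s \<le> e0" using ns \<kappa>(2) by simp
    have EK': "?E + \<mu> \<in> K'"
      unfolding K'_def using EK \<mu>0 \<mu>1
      by (intro CollectI exI[of _ ?E] exI[of _ \<mu>]) (auto simp: mem_box_cart)
    have "?E + \<mu> + s \<in> K1"
      unfolding K1_def using ns' EK' by (intro CollectI exI[of _ "?E + \<mu>"] exI[of _ s]) auto
    moreover have "?E + \<mu> \<in> K1"
      unfolding K1_def using e1(1) EK' by (intro CollectI exI[of _ "?E + \<mu>"] exI[of _ 0]) (auto simp: e0_def)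
    ultimately have K1: "?E + \<mu> + s \<in> K1" "?E + \<mu> \<in> K1" .
    have "f (?E + \<mu> + s) \<ge> f (?E + \<mu>) - C * norm s"
      using C(2)[OF K1(2) K1(1)] by (simp add: abs_le_iff)
    moreover have "C * norm s \<le> (C * \<kappa> * ?n) * N" using mult_left_mono[OF ns, of C] C by (simp add: ac_simps)
    moreover have "(C * \<kappa> * ?n) * N < \<delta> / ?n * N" using \<kappa>(3) N by (intro mult_strict_right_mono) auto
    ultimately have f1: "f (?E + \<mu> + s) > 1" using fE by simp
    define G where "G = (\<chi> i. ?F $ \<rho> (\<pi> i))"
    have "(?E + \<mu> + s) $ i \<le> G $ i" for i using \<rho>(2)[of "\<pi> i"] by (simp add: \<mu>_def s_def G_def)
    from increasing[OF _ this] have G: "G \<in> \<Gamma>" "f G > 1" using K1 \<open>K1 \<subseteq> \<Gamma>\<close> f1 by auto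
    have "bij (\<rho> \<circ> \<pi>)" using \<pi> \<rho> by (simp add: bij_comp)
    from permuted'[OF this, of G ?F] G show "?F \<in> \<Gamma> \<and> f ?F > 1" by (simp add: G_def)
  qed
qed

end

subsection \<open>Second-order jets\<close>

text \<open>A Peano expansion at the single point \<open>x\<close>: no differentiability is asserted
  elsewhere. The filter \<open>nhds 0\<close> admits k = 0, where the remainder vanishes.\<close>

definition jet2 :: "(real^'n \<Rightarrow> real) \<Rightarrow> real^'n \<Rightarrow> real^'n \<Rightarrow> real^'n^'n \<Rightarrow> bool" where
  "jet2 W x p X \<longleftrightarrow>
     (\<lambda>k. W (x + k) - W x - p \<bullet> k - (k \<bullet> (X *v k)) / 2) \<in> o[nhds 0](\<lambda>k. norm k ^ 2)"

definition taylor2 :: "(real \<Rightarrow> real) \<Rightarrow> real \<Rightarrow> real \<Rightarrow> real \<Rightarrow> bool" where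
  "taylor2 g a g1 g2 \<longleftrightarrow>
     (\<lambda>s. g (a + s) - g a - g1 * s - g2 * s\<^sup>2 / 2) \<in> o[nhds 0](\<lambda>s. s\<^sup>2)"

lemma smallo_nhds_iff:
  fixes r :: "'a::real_normed_vector \<Rightarrow> real"
  shows "r \<in> o[nhds 0](\<lambda>k. norm k ^ 2) \<longleftrightarrow> (\<forall>\<epsilon>>0. \<forall>\<^sub>F k in nhds 0. \<bar>r k\<bar> \<le> \<epsilon> * norm k ^ 2)"
  by (auto simp: smallo_def)

lemma jet2D:
  "jet2 W x p X \<Longrightarrow> \<epsilon> > 0 \<Longrightarrow>
    \<forall>\<^sub>F k in nhds 0. \<bar>W (x + k) - W x - p \<bullet> k - (k \<bullet> (X *v k)) / 2\<bar> \<le> \<epsilon> * norm k ^ 2"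
  unfolding jet2_def smallo_nhds_iff by blast

lemma eventually_norm_le:
  "e > 0 \<Longrightarrow> \<forall>\<^sub>F k in nhds (0::'a::real_normed_vector). norm k \<le> e"
  using eventually_nhds_in_open[of "ball (0::'a) e" 0] by (auto elim!: eventually_mono)

lemma jet2_add:
  assumes "jet2 W x p X" "jet2 V x q Y"
  shows "jet2 (\<lambda>y. W y + V y) x (p + q) (X + Y)"
  using sum_in_smallo(1)[OF assms[unfolded jet2_def]]
  unfolding jet2_def by (simp add: quad_form_simps inner_simps algebra_simps add_divide_distrib)

lemma jet2_cmult:
  assumes "jet2 W x p X"
  shows "jet2 (\<lambda>y. c * W y) x (c *\<^sub>R p) (c *\<^sub>R X)"
proof (cases "c = 0")
  case False
  have eq: "c * W (x + k) - c * W x - (c *\<^sub>R p) \<bullet> k - k \<bullet> ((c *\<^sub>R X) *v k) / 2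
      = c * (W (x + k) - W x - p \<bullet> k - (k \<bullet> (X *v k)) / 2)" for k
    by (simp add: quad_form_simps algebra_simps)
  show ?thesis
    using assms unfolding jet2_def eq landau_o.small.cmult_in_iff[OF False] .
qed (simp add: jet2_def)

lemma jet2_affine_quadratic:
  fixes M :: "real^'n^'n"
  assumes "transpose M = M"
  shows "jet2 (\<lambda>y. c + b \<bullet> (y - z) + ((y - z) \<bullet> (M *v (y - z))) / 2) x (b + M *v (x - z)) M"
proof -
  have sq: "(u + k) \<bullet> (M *v (u + k)) = u \<bullet> (M *v u) + 2 * ((M *v u) \<bullet> k) + k \<bullet> (M *v k)" for u k
    using symmetric_matrix_inner[OF assms, of u k]
    by (simp add: matrix_vector_right_distrib inner_add_left inner_add_right inner_commute)
  have "(x + k - z) \<bullet> (M *v (x + k - z)) = (x - z) \<bullet> (M *v (x - z)) + 2 * ((M *v (x - z)) \<bullet> k) + k \<bullet> (M *v k)" for k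
    using sq[of "x - z" k] by (simp add: algebra_simps)
  moreover have "b \<bullet> (x + k - z) = b \<bullet> (x - z) + b \<bullet> k" for k by (simp add: inner_simps)
  ultimately show ?thesis unfolding jet2_def by (simp add: inner_add_left add_divide_distrib)
qed

lemma jet2_norm_sq:
  "jet2 (\<lambda>y. (norm (y - z))\<^sup>2) x (2 *\<^sub>R (x - z)) (2 *\<^sub>R mat 1)"
  using jet2_affine_quadratic[of "2 *\<^sub>R mat 1" 0 0 z x]
  by (simp add: sym_matrix_simps quad_form_simps power2_norm_eq_inner)

lemma quad_form_bound:
  fixes X :: "real^'n^'n"
  obtains C where "C > 0" "\<And>k. \<bar>k \<bullet> (X *v k)\<bar> \<le> C * norm k ^ 2" "\<And>k. norm (X *v k) \<le> C * norm k"
proof -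
  obtain C where C: "C > 0" "\<And>k. norm (X *v k) \<le> norm k * C"
    using bounded_linear.pos_bounded[OF matrix_vector_mul_bounded_linear, of X] by blast
  have "\<bar>k \<bullet> (X *v k)\<bar> \<le> C * norm k ^ 2" for k
  proof -
    have "\<bar>k \<bullet> (X *v k)\<bar> \<le> norm k * norm (X *v k)" by (rule Cauchy_Schwarz_ineq2)
    also have "\<dots> \<le> norm k * (norm k * C)" by (intro mult_left_mono C) auto
    finally show ?thesis by (simp add: power2_eq_square ac_simps)
  qed
  then show ?thesis using that C by (simp add: mult.commute)
qed

lemma jet2_increment_bound:
  assumes "jet2 W x p X"
  obtains C where "C > 0" "\<forall>\<^sub>F k in nhds 0. \<bar>W (x + k) - W x\<bar> \<le> C * norm k"
proof -
  obtain C where C: "C > 0" "\<And>k. \<bar>k \<bullet> (X *v k)\<bar> \<le> C * norm k ^ 2" using quad_form_bound by blast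
  have "\<forall>\<^sub>F k in nhds (0::real^'n). norm k \<le> 1" by (rule eventually_norm_le) simp
  with jet2D[OF assms zero_less_one]
  have "\<forall>\<^sub>F k in nhds 0. \<bar>W (x + k) - W x\<bar> \<le> (norm p + C + 1) * norm k"
  proof eventually_elim
    case (elim k)
    have "norm k ^ 2 \<le> norm k" using elim(2) by (simp add: power2_eq_square mult_left_le)
    then have "(C / 2 + 1) * norm k ^ 2 \<le> (C + 1) * norm k" using C(1) by (intro mult_mono) auto
    moreover have "\<bar>p \<bullet> k\<bar> \<le> norm p * norm k" by (rule Cauchy_Schwarz_ineq2)
    ultimately show ?case using elim(1) C(2)[of k] by (simp add: algebra_simps abs_if split: if_splits)
  qed
  then show ?thesis using that[of "norm p + C + 1"] C(1) by (simp add: add_nonneg_pos)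
qed

lemma filterlim_increment:
  assumes "C > 0" "\<forall>\<^sub>F k in nhds 0. \<bar>r k\<bar> \<le> C * norm (k :: 'a::real_normed_vector)"
  shows "filterlim r (nhds (0::real)) (nhds 0)"
proof (rule tendsto_rabs_zero_cancel, rule tendsto_sandwich[of "\<lambda>_. 0" _ _ "\<lambda>k. C * norm k"])
  show "((\<lambda>k. C * norm (k :: 'a)) \<longlongrightarrow> 0) (nhds 0)"
    using tendsto_mult_left[OF tendsto_norm[OF filterlim_ident[of "nhds (0::'a)"]], of C] by simp
qed (use assms in auto)

text \<open>With r the increment of \<open>W\<close>, the remainder consists of the Taylor remainder
  of \<open>g\<close> at r, of \<open>g1\<close> times the remainder R of \<open>W\<close>, and of
  half \<open>g2\<close> times r^2 - (p . k)^2. The last one is cubic, being the product of r - p .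
  k and r + p . k.\<close>

lemma jet2_compose:
  fixes W :: "real^'n \<Rightarrow> real"
  assumes W: "jet2 W x p X" and g: "taylor2 g (W x) g1 g2"
  shows "jet2 (\<lambda>y. g (W y)) x (g1 *\<^sub>R p) (g1 *\<^sub>R X + g2 *\<^sub>R rank1 p)"
proof -
  define r where "r k = W (x + k) - W x" for k
  define R where "R k = r k - p \<bullet> k - (k \<bullet> (X *v k)) / 2" for k
  obtain C where C: "C > 0" "\<forall>\<^sub>F k in nhds 0. \<bar>r k\<bar> \<le> C * norm k"
    using jet2_increment_bound[OF W] unfolding r_def by blast
  obtain D where D: "D > 0" "\<And>k. \<bar>k \<bullet> (X *v k)\<bar> \<le> D * norm k ^ 2" using quad_form_bound by blast
  show ?thesis unfolding jet2_def smallo_nhds_iff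
  proof (intro allI impI)
    fix \<epsilon> :: real assume "\<epsilon> > 0"
    \<comment> \<open>Each of the three errors gets a third of \<epsilon>: \<open>e1\<close> absorbs
      r^2 \<le> C^2 |k|^2, \<open>e2\<close> absorbs the factor \<open>g1\<close>, and
      \<open>e3\<close> is the radius below which the cubic error is quadratically small.\<close>
    define e1 where "e1 = \<epsilon> / 3 / C\<^sup>2"
    define e2 where "e2 = \<epsilon> / 3 / (\<bar>g1\<bar> + 1)"
    define e3 where "e3 = \<epsilon> / 3 / ((D + 1) * (C + norm p) * (\<bar>g2\<bar> + 1))"
    have "D + 1 > 0" "C + norm p > 0" "\<bar>g2\<bar> + 1 > 0" "\<bar>g1\<bar> + 1 > 0"
      using C(1) D(1) by (auto intro: add_pos_nonneg add_nonneg_pos)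
    then have pos: "e1 > 0" "e2 > 0" "e3 > 0"
      using C(1) \<open>\<epsilon> > 0\<close> unfolding e1_def e2_def e3_def by (intro divide_pos_pos mult_pos_pos; simp)+
    have "\<forall>\<^sub>F s in nhds 0. \<bar>g (W x + s) - g (W x) - g1 * s - g2 * s\<^sup>2 / 2\<bar> \<le> e1 * s\<^sup>2"
      using g pos(1) smallo_nhds_iff[of "\<lambda>s. g (W x + s) - g (W x) - g1 * s - g2 * s\<^sup>2 / 2"]
      unfolding taylor2_def by simp
    from eventually_compose_filterlim[OF this filterlim_increment[OF C]]
    have ev1: "\<forall>\<^sub>F k in nhds 0. \<bar>g (W (x + k)) - g (W x) - g1 * r k - g2 * (r k)\<^sup>2 / 2\<bar> \<le> e1 * (r k)\<^sup>2"
      by (simp add: r_def)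
    \<comment> \<open>The bound by 1 serves to estimate r - p . k by (D + 1) |k|^2 with a constant
      independent of \<epsilon>.\<close>
    have ev2: "\<forall>\<^sub>F k in nhds 0. \<bar>R k\<bar> \<le> min e2 1 * norm k ^ 2"
      using jet2D[OF W, of "min e2 1"] pos unfolding R_def r_def by simp
    have ev3: "\<forall>\<^sub>F k in nhds 0. norm k \<le> (e3 :: real)"
      using pos(3) by (rule eventually_norm_le)
    show "\<forall>\<^sub>F k in nhds 0. \<bar>g (W (x + k)) - g (W x) - (g1 *\<^sub>R p) \<bullet> k
        - (k \<bullet> ((g1 *\<^sub>R X + g2 *\<^sub>R rank1 p) *v k)) / 2\<bar> \<le> \<epsilon> * norm k ^ 2"
      using ev1 ev2 ev3 C(2)
    proof eventually_elim
      case (elim k)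
      have "(r k)\<^sup>2 \<le> (C * norm k)\<^sup>2" using elim(4) by (intro power2_le_iff_abs_le[THEN iffD2]) (use C in auto)
      then have "e1 * (r k)\<^sup>2 \<le> e1 * (C\<^sup>2 * norm k ^ 2)" using pos by (simp add: power_mult_distrib)
      then have b1: "e1 * (r k)\<^sup>2 \<le> \<epsilon> / 3 * norm k ^ 2" using C(1) by (simp add: e1_def field_simps)
      have "\<bar>g1\<bar> * \<bar>R k\<bar> \<le> (\<bar>g1\<bar> + 1) * (e2 * norm k ^ 2)"
      proof (intro mult_mono)
        show "\<bar>R k\<bar> \<le> e2 * norm k ^ 2"
          using elim(2) mult_right_mono[of "min e2 1" e2 "norm k ^ 2"] by linarith
      qed (use pos in auto)
      moreover have "(\<bar>g1\<bar> + 1) * e2 = \<epsilon> / 3"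
        using \<open>\<bar>g1\<bar> + 1 > 0\<close> unfolding e2_def by (metis less_irrefl nonzero_mult_div_cancel_left times_divide_eq_right)
      ultimately have b2: "\<bar>g1 * R k\<bar> \<le> \<epsilon> / 3 * norm k ^ 2"
        by (simp only: abs_mult mult.assoc[symmetric])
      have r: "r k = p \<bullet> k + (k \<bullet> (X *v k) / 2 + R k)" by (simp add: R_def)
      have "\<bar>k \<bullet> (X *v k) / 2 + R k\<bar> \<le> D * norm k ^ 2 + 1 * norm k ^ 2"
      proof -
        have "0 \<le> D * norm k ^ 2" "min e2 1 * norm k ^ 2 \<le> 1 * norm k ^ 2"
          using D(1) mult_right_mono[of "min e2 1" 1 "norm k ^ 2"] by auto
        then show ?thesis using elim(2) D(2)[of k] by linarith
      qed
      then have c1: "\<bar>r k - p \<bullet> k\<bar> \<le> (D + 1) * norm k ^ 2" using r by (simp add: algebra_simps)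
      have c2: "\<bar>r k + p \<bullet> k\<bar> \<le> (C + norm p) * norm k"
        using elim(4) Cauchy_Schwarz_ineq2[of p k] by (simp add: algebra_simps)
      have "\<bar>(r k)\<^sup>2 - (p \<bullet> k)\<^sup>2\<bar> = \<bar>r k - p \<bullet> k\<bar> * \<bar>r k + p \<bullet> k\<bar>"
        by (simp add: abs_mult[symmetric] power2_eq_square algebra_simps)
      also have "\<dots> \<le> ((D + 1) * norm k ^ 2) * ((C + norm p) * norm k)"
        using c1 c2 by (intro mult_mono) auto
      also have "\<dots> \<le> ((D + 1) * norm k ^ 2) * ((C + norm p) * e3)"
        using elim(3) C(1) D(1) by (intro mult_left_mono) auto
      finally have "\<bar>g2\<bar> * \<bar>(r k)\<^sup>2 - (p \<bullet> k)\<^sup>2\<bar> \<le> (\<bar>g2\<bar> + 1) * (((D + 1) * norm k ^ 2) * ((C + norm p) * e3))"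
        by (intro mult_mono) auto
      also have "\<dots> = \<epsilon> / 3 * norm k ^ 2"
      proof -
        have "((D + 1) * (C + norm p) * (\<bar>g2\<bar> + 1)) * e3 = \<epsilon> / 3"
          using \<open>D + 1 > 0\<close> \<open>C + norm p > 0\<close> \<open>\<bar>g2\<bar> + 1 > 0\<close> unfolding e3_def
          by (metis less_irrefl mult_pos_pos nonzero_mult_div_cancel_left times_divide_eq_right)
        then show ?thesis by (simp only: mult_ac) (metis mult.assoc mult.commute)
      qed
      finally have "\<bar>g2 * ((r k)\<^sup>2 - (p \<bullet> k)\<^sup>2)\<bar> \<le> \<epsilon> / 3 * norm k ^ 2" by (simp add: abs_mult)
      then have b3: "\<bar>g2 * ((r k)\<^sup>2 - (p \<bullet> k)\<^sup>2) / 2\<bar> \<le> \<epsilon> / 3 * norm k ^ 2" by linarith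
      have "k \<bullet> ((g1 *\<^sub>R X + g2 *\<^sub>R rank1 p) *v k) = g1 * (k \<bullet> (X *v k)) + g2 * (p \<bullet> k)\<^sup>2"
        by (simp add: quad_form_simps inner_simps power2_eq_square inner_commute)
      then have eq: "g (W (x + k)) - g (W x) - (g1 *\<^sub>R p) \<bullet> k - (k \<bullet> ((g1 *\<^sub>R X + g2 *\<^sub>R rank1 p) *v k)) / 2
        = (g (W (x + k)) - g (W x) - g1 * r k - g2 * (r k)\<^sup>2 / 2) + g1 * R k + g2 * ((r k)\<^sup>2 - (p \<bullet> k)\<^sup>2) / 2"
        by (simp add: R_def algebra_simps diff_divide_distrib add_divide_distrib)
      have "\<bar>a + b + c\<bar> \<le> \<epsilon> * norm k ^ 2"
        if "\<bar>a\<bar> \<le> \<epsilon> / 3 * norm k ^ 2" "\<bar>b\<bar> \<le> \<epsilon> / 3 * norm k ^ 2" "\<bar>c\<bar> \<le> \<epsilon> / 3 * norm k ^ 2" for a b c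
        using that by linarith
      from this[OF order_trans[OF elim(1) b1] b2 b3] show ?case unfolding eq .
    qed
  qed
qed

text \<open>Mean value inequality for \<phi>, whose derivative at t is the first-order remainder of
  \<open>g'\<close> at \<open>a\<close> and hence at most \<epsilon> |t|.\<close>

lemma taylor2_DERIV:
  assumes "open S" "a \<in> S" "\<And>s. s \<in> S \<Longrightarrow> (g has_real_derivative g' s) (at s)"
    and "(g' has_real_derivative g2) (at a)"
  shows "taylor2 g a (g' a) g2"
  unfolding taylor2_def smallo_def
proof (clarsimp)
  fix \<epsilon> :: real assume e: "\<epsilon> > 0"
  obtain d1 where d1: "d1 > 0" "ball a d1 \<subseteq> S" using assms(1,2) by (meson openE)
  from assms(4) have "(g' has_derivative (\<lambda>h. g2 * h)) (at a)"
    by (simp add: has_field_derivative_def mult_commute_abs)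
  then obtain d2 where d2: "d2 > 0" "\<And>y. norm (y - a) < d2 \<Longrightarrow> norm (g' y - g' a - g2 * (y - a)) \<le> \<epsilon> * norm (y - a)"
    unfolding has_derivative_at_alt using e by blast
  have "\<bar>g (a + s) - g a - g' a * s - g2 * s\<^sup>2 / 2\<bar> \<le> \<epsilon> * s\<^sup>2" if s: "\<bar>s\<bar> < min d1 d2" for s
  proof -
    define \<phi> where "\<phi> t = g (a + t) - g' a * t - g2 * t\<^sup>2 / 2" for t
    have d: "(\<phi> has_real_derivative (g' (a + t) - g' a - g2 * t)) (at t within cball 0 \<bar>s\<bar>)" if "t \<in> cball 0 \<bar>s\<bar>" for t :: real
    proof -
      have "a + t \<in> S" using d1 s that by (auto simp: dist_real_def)
      have "((+) a has_real_derivative 1) (at (t::real))" by (auto intro!: derivative_eq_intros)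
      from DERIV_chain2[where f = g and g = "(+) a", OF assms(3)[OF \<open>a + t \<in> S\<close>] this]
      have "((\<lambda>t. g (a + t)) has_real_derivative g' (a + t)) (at t)" by simp
      then have "(\<phi> has_real_derivative (g' (a + t) - g' a - g2 * t)) (at t)"
        unfolding \<phi>_def by (auto intro!: derivative_eq_intros)
      then show ?thesis by (rule has_field_derivative_at_within)
    qed
    have "norm (\<phi> s - \<phi> 0) \<le> (\<epsilon> * \<bar>s\<bar>) * norm (s - 0)"
    proof (rule field_differentiable_bound[of "cball 0 \<bar>s\<bar>", OF _ d])
      fix t :: real assume t: "t \<in> cball 0 \<bar>s\<bar>"
      then have "norm (g' (a + t) - g' a - g2 * (a + t - a)) \<le> \<epsilon> * norm (a + t - a)"
        using s by (intro d2(2)) auto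
      also have "\<dots> \<le> \<epsilon> * \<bar>s\<bar>" using t e by auto
      finally show "norm (g' (a + t) - g' a - g2 * t) \<le> \<epsilon> * \<bar>s\<bar>" by simp
    qed auto
    then show ?thesis by (simp add: \<phi>_def power2_eq_square algebra_simps abs_mult)
  qed
  then show "\<forall>\<^sub>F s in nhds 0. \<bar>g (a + s) - g a - g' a * s - g2 * s\<^sup>2 / 2\<bar> \<le> \<epsilon> * s\<^sup>2"
    using d1 d2 unfolding eventually_nhds_metric by (intro exI[of _ "min d1 d2"]) (auto simp: dist_real_def)
qed

subsection \<open>Inversion in a sphere\<close>

text \<open>Reflection in the sphere of radius \<mu> about the origin; other centres are reached by
  translating \<open>w\<close>. The origin goes to itself, by the convention on division by
  0.\<close>

definition inv_pt :: "real \<Rightarrow> real^'n \<Rightarrow> real^'n" where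
  "inv_pt \<mu> y = (\<mu>\<^sup>2 / (norm y)\<^sup>2) *\<^sub>R y"

text \<open>The usual Kelvin transform, expressed for \<open>v powr (- 2 / (n - 2))\<close>.\<close>

definition kelvin :: "real \<Rightarrow> (real^'n \<Rightarrow> real) \<Rightarrow> real^'n \<Rightarrow> real" where
  "kelvin \<mu> w y = (norm y)\<^sup>2 / \<mu>\<^sup>2 * w (inv_pt \<mu> y)"

text \<open>Householder reflection in the hyperplane orthogonal to z. Up to the factor \<mu>^2 /
  |z|^2 it is the differential of the inversion, which is why the inversion is conformal.\<close>

definition refl_mat :: "real^'n \<Rightarrow> real^'n^'n" where
  "refl_mat z = mat 1 - (2 / (norm z)\<^sup>2) *\<^sub>R rank1 z"

lemma norm_inv_pt: "norm (inv_pt \<mu> y) = \<mu>\<^sup>2 / norm y"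
  by (simp add: inv_pt_def power2_eq_square)

lemma inv_pt_nz: "\<mu> \<noteq> 0 \<Longrightarrow> y \<noteq> 0 \<Longrightarrow> inv_pt \<mu> y \<noteq> 0"
  by (simp add: inv_pt_def)

lemma inv_pt_inv_pt: "\<mu> \<noteq> 0 \<Longrightarrow> y \<noteq> 0 \<Longrightarrow> inv_pt \<mu> (inv_pt \<mu> y) = y"
proof -
  assume nz: "\<mu> \<noteq> 0" "y \<noteq> 0"
  have "\<mu>\<^sup>2 / (norm (inv_pt \<mu> y))\<^sup>2 * (\<mu>\<^sup>2 / (norm y)\<^sup>2) = 1"
    using nz by (simp add: norm_inv_pt power_divide)
  then show "inv_pt \<mu> (inv_pt \<mu> y) = y" by (simp add: inv_pt_def[of \<mu> "inv_pt \<mu> y"]) (simp add: inv_pt_def)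
qed

lemma kelvin_kelvin: "\<mu> \<noteq> 0 \<Longrightarrow> y \<noteq> 0 \<Longrightarrow> kelvin \<mu> (kelvin \<mu> w) y = w y"
  by (simp add: kelvin_def inv_pt_inv_pt norm_inv_pt field_simps power2_eq_square)

lemma transpose_refl_mat [simp]: "transpose (refl_mat z) = refl_mat z"
  by (simp add: refl_mat_def sym_matrix_simps)

lemma refl_mat_mult: "refl_mat z *v x = x - (2 * (z \<bullet> x) / (norm z)\<^sup>2) *\<^sub>R z"
  by (simp add: refl_mat_def quad_form_simps)

lemma refl_mat_refl_mat:
  assumes "z \<noteq> 0"
  shows "refl_mat z *v (refl_mat z *v x) = x"
proof -
  define c where "c = 2 * (z \<bullet> x) / (norm z)\<^sup>2"
  have "c * (norm z)\<^sup>2 = 2 * (z \<bullet> x)" using assms by (simp add: c_def)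
  then have "2 * (z \<bullet> (x - c *\<^sub>R z)) / (norm z)\<^sup>2 = - c"
    using assms by (simp add: inner_diff_right power2_norm_eq_inner field_simps)
  then show ?thesis by (simp add: refl_mat_mult c_def[symmetric])
qed

lemma orthogonal_refl_mat:
  assumes "z \<noteq> 0"
  shows "orthogonal_matrix (refl_mat z)"
proof -
  have "refl_mat z ** refl_mat z = mat 1"
    by (simp add: matrix_eq matrix_vector_mul_assoc[symmetric] refl_mat_refl_mat[OF assms])
  then show ?thesis by (simp add: orthogonal_matrix)
qed

lemma has_derivative_inv_pt:
  assumes "y \<noteq> 0"
  shows "(inv_pt \<mu> has_derivative (\<lambda>h. (\<mu>\<^sup>2 / (norm y)\<^sup>2) *\<^sub>R (refl_mat y *v h))) (at y)"
proof -
  have eq: "inv_pt \<mu> = (\<lambda>y. (\<mu>\<^sup>2 / (y \<bullet> y)) *\<^sub>R y)" by (simp add: inv_pt_def power2_norm_eq_inner fun_eq_iff)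
  have "y \<bullet> y \<noteq> 0" using assms by simp
  then show ?thesis unfolding eq refl_mat_mult power2_norm_eq_inner
    by (auto intro!: derivative_eq_intros
      simp: inner_commute field_simps scaleR_diff_right power2_eq_square fun_eq_iff)
qed

lemma inv_pt_expansion:
  fixes \<mu> :: real and y :: "real^'n"
  assumes "y \<noteq> 0"
  defines "L \<equiv> \<lambda>k. (\<mu>\<^sup>2 / (norm y)\<^sup>2) *\<^sub>R (refl_mat y *v k)"
  defines "\<kappa> \<equiv> \<lambda>k. inv_pt \<mu> (y + k) - inv_pt \<mu> y"
  shows "(\<lambda>k. norm (\<kappa> k - L k)) \<in> o[nhds 0](\<lambda>k. norm k)"
    and "(\<lambda>k. norm (L k)) \<in> O[nhds 0](\<lambda>k. norm k)"
    and "(\<lambda>k. norm (\<kappa> k)) \<in> O[nhds 0](\<lambda>k. norm k)"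
    and "(\<kappa> \<longlongrightarrow> 0) (nhds 0)"
proof -
  note D = has_derivative_inv_pt[OF assms(1), of \<mu>, folded L_def]
  show 1: "(\<lambda>k. norm (\<kappa> k - L k)) \<in> o[nhds 0](\<lambda>k. norm k)"
    unfolding smallo_def
  proof clarsimp
    fix e :: real assume "e > 0"
    with D obtain d where d: "d > 0" "\<And>z. norm (z - y) < d \<Longrightarrow>
        norm (inv_pt \<mu> z - inv_pt \<mu> y - L (z - y)) \<le> e * norm (z - y)"
      unfolding has_derivative_at_alt by blast
    have "norm (\<kappa> k - L k) \<le> e * norm k" if "norm k < d" for k
      using d(2)[of "y + k"] that by (simp add: \<kappa>_def)
    then show "\<forall>\<^sub>F k in nhds 0. norm (\<kappa> k - L k) \<le> e * norm k"
      unfolding eventually_nhds_metric using d(1) by (intro exI[of _ d]) simp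
  qed
  obtain C where C: "C > 0" "\<And>k. norm (L k) \<le> norm k * C"
    using bounded_linear.pos_bounded[OF has_derivative_bounded_linear[OF D]] by blast
  then show 2: "(\<lambda>k. norm (L k)) \<in> O[nhds 0](\<lambda>k. norm k)"
    by (intro bigoI[of _ C]) (simp add: mult.commute)
  have "(\<lambda>k. norm (\<kappa> k - L k) + norm (L k)) \<in> O[nhds 0](\<lambda>k. norm k)"
    using landau_o.small_imp_big[OF 1] 2 by (rule sum_in_bigo)
  moreover have "(\<lambda>k. norm (\<kappa> k)) \<in> O[nhds 0](\<lambda>k. norm (\<kappa> k - L k) + norm (L k))"
    using norm_triangle_sub[of "\<kappa> _" "L _"] by (intro bigoI[of _ 1]) (auto intro!: always_eventually simp: add.commute)
  ultimately show 3: "(\<lambda>k. norm (\<kappa> k)) \<in> O[nhds 0](\<lambda>k. norm k)" by (rule landau_o.big_trans[rotated])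
  have "isCont (inv_pt \<mu>) y" using has_derivative_continuous[OF D] by (simp add: continuous_at)
  then have "((\<lambda>k. inv_pt \<mu> (y + k)) \<longlongrightarrow> inv_pt \<mu> (y + 0)) (nhds 0)"
    by (intro isCont_tendsto_compose[of _ "inv_pt \<mu>"]) (auto intro!: tendsto_eq_intros filterlim_ident)
  then show "(\<kappa> \<longlongrightarrow> 0) (nhds 0)"
    unfolding \<kappa>_def using tendsto_diff[OF _ tendsto_const[of "inv_pt \<mu> y"]] by fastforce
qed

text \<open>A function \<open>\<alpha> + \<beta> \<bullet> x + \<gamma> |x|\<^sup>2\<close> is mapped to one of the same form by the inversion, so
  only the second-order remainder of \<open>U\<close> beyond its affine part has to be transported.\<close>

lemma jet2_kelvin:
  fixes X :: "real^'n^'n"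
  assumes y: "y \<noteq> 0" and l: "\<mu> > 0" and J: "jet2 U (inv_pt \<mu> y) p X"
  defines "a \<equiv> (U (inv_pt \<mu> y) - p \<bullet> inv_pt \<mu> y) / \<mu>\<^sup>2"
  shows "jet2 (kelvin \<mu> U) y ((2 * a) *\<^sub>R y + p)
    ((2 * a) *\<^sub>R mat 1 + (\<mu>\<^sup>2 / (norm y)\<^sup>2) *\<^sub>R (refl_mat y ** X ** refl_mat y))"
proof -
  define L where "L k = (\<mu>\<^sup>2 / (norm y)\<^sup>2) *\<^sub>R (refl_mat y *v k)" for k
  define \<kappa> where "\<kappa> k = inv_pt \<mu> (y + k) - inv_pt \<mu> y" for k
  define m where "m k = (norm (y + k))\<^sup>2 / \<mu>\<^sup>2" for k
  define \<rho> where "\<rho> h = U (inv_pt \<mu> y + h) - U (inv_pt \<mu> y) - p \<bullet> h - (h \<bullet> (X *v h)) / 2" for h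
  note exp = inv_pt_expansion[OF y, of \<mu>, folded L_def \<kappa>_def]
  have "((\<lambda>k. (norm (y + k))\<^sup>2 / \<mu>\<^sup>2) \<longlongrightarrow> (norm (y + 0))\<^sup>2 / \<mu>\<^sup>2) (nhds 0)"
    by (intro tendsto_intros filterlim_ident) (use l in auto)
  then have m: "(m \<longlongrightarrow> m 0) (nhds 0)" unfolding m_def by simp
  have mO: "m \<in> O[nhds 0](\<lambda>_. 1)"
    by (rule bigoI_tendsto[of _ _ "m 0"]) (use m in auto)
  have "((\<lambda>k. m k - m 0) \<longlongrightarrow> 0) (nhds 0)" using tendsto_diff[OF m tendsto_const[of "m 0"]] by simp
  then have mo: "(\<lambda>k. m k - m 0) \<in> o[nhds 0](\<lambda>_. 1)" by (intro smalloI_tendsto) auto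
  have \<kappa>2: "(\<lambda>k. norm (\<kappa> k) ^ 2) \<in> O[nhds 0](\<lambda>k. norm k ^ 2)"
    using landau_o.big.mult[OF exp(3) exp(3)] by (simp add: power2_eq_square)
  have "(\<lambda>k. \<rho> (\<kappa> k)) \<in> o[nhds 0](\<lambda>k. norm (\<kappa> k) ^ 2)"
    using landau_o.small.compose[OF J[unfolded jet2_def, folded \<rho>_def] exp(4)] .
  then have \<rho>o: "(\<lambda>k. \<rho> (\<kappa> k)) \<in> o[nhds 0](\<lambda>k. norm k ^ 2)" by (rule landau_o.small_big_trans) (rule \<kappa>2)
  have r1: "(\<lambda>k. m k * \<rho> (\<kappa> k)) \<in> o[nhds 0](\<lambda>k. norm k ^ 2)"
    using landau_o.big_small_mult[OF mO \<rho>o] by simp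
  obtain C where C: "C > 0" "\<And>k. \<bar>k \<bullet> (X *v k)\<bar> \<le> C * norm k ^ 2" "\<And>k. norm (X *v k) \<le> C * norm k"
    using quad_form_bound by blast
  have "(\<lambda>k. \<kappa> k \<bullet> (X *v \<kappa> k)) \<in> O[nhds 0](\<lambda>k. norm (\<kappa> k) ^ 2)"
    by (rule bigoI[of _ C]) (use C in auto)
  then have "(\<lambda>k. \<kappa> k \<bullet> (X *v \<kappa> k)) \<in> O[nhds 0](\<lambda>k. norm k ^ 2)" using \<kappa>2 by (rule landau_o.big_trans)
  from landau_o.small_big_mult[OF mo this]
  have r2: "(\<lambda>k. (m k - m 0) * (\<kappa> k \<bullet> (X *v \<kappa> k))) \<in> o[nhds 0](\<lambda>k. norm k ^ 2)" by simp
  have "(\<lambda>k. (\<kappa> k \<bullet> (X *v \<kappa> k) - L k \<bullet> (X *v L k)))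
      \<in> O[nhds 0](\<lambda>k. norm (\<kappa> k - L k) * (norm (\<kappa> k) + norm (L k)))"
  proof (rule bigoI[of _ C], rule always_eventually, rule allI)
    fix k
    have "\<kappa> k \<bullet> (X *v \<kappa> k) - L k \<bullet> (X *v L k) = (\<kappa> k - L k) \<bullet> (X *v \<kappa> k) + L k \<bullet> (X *v (\<kappa> k - L k))"
      by (simp add: matrix_vector_mult_diff_distrib inner_simps)
    then have "\<bar>\<kappa> k \<bullet> (X *v \<kappa> k) - L k \<bullet> (X *v L k)\<bar>
        \<le> norm (\<kappa> k - L k) * norm (X *v \<kappa> k) + norm (L k) * norm (X *v (\<kappa> k - L k))"
      using Cauchy_Schwarz_ineq2[of "\<kappa> k - L k" "X *v \<kappa> k"]
        Cauchy_Schwarz_ineq2[of "L k" "X *v (\<kappa> k - L k)"] by linarith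
    also have "\<dots> \<le> norm (\<kappa> k - L k) * (C * norm (\<kappa> k)) + norm (L k) * (C * norm (\<kappa> k - L k))"
      by (intro add_mono mult_left_mono C) auto
    finally show "norm (\<kappa> k \<bullet> (X *v \<kappa> k) - L k \<bullet> (X *v L k))
        \<le> C * norm (norm (\<kappa> k - L k) * (norm (\<kappa> k) + norm (L k)))"
      using C(1) by (simp add: abs_mult algebra_simps)
  qed
  moreover have "(\<lambda>k. norm (\<kappa> k - L k) * (norm (\<kappa> k) + norm (L k))) \<in> o[nhds 0](\<lambda>k. norm k ^ 2)"
    using landau_o.small_big_mult[OF exp(1) sum_in_bigo(1)[OF exp(3) exp(2)]] by (simp add: power2_eq_square)
  ultimately have r3: "(\<lambda>k. (\<kappa> k \<bullet> (X *v \<kappa> k) - L k \<bullet> (X *v L k))) \<in> o[nhds 0](\<lambda>k. norm k ^ 2)"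
    by (rule landau_o.big_small_trans)
  \<comment> \<open>Three sources of error: the remainder of \<open>U\<close>, freezing the factor m
    at k = 0, and replacing the increment \<kappa> by its differential L.\<close>
  have r: "(\<lambda>k. m k * \<rho> (\<kappa> k) + (1/2 * ((m k - m 0) * (\<kappa> k \<bullet> (X *v \<kappa> k)))
      + (m 0 / 2) * (\<kappa> k \<bullet> (X *v \<kappa> k) - L k \<bullet> (X *v L k)))) \<in> o[nhds 0](\<lambda>k. norm k ^ 2)"
    by (intro sum_in_smallo r1 landau_o.small.cmult_in_iff[THEN iffD2, OF _ r2]
        landau_o.small.cmult_in_iff[THEN iffD2, OF _ r3]) (use y l in \<open>auto simp: m_def\<close>)
  have "\<forall>\<^sub>F k in nhds 0. y + k \<noteq> 0"
    using eventually_norm_le[of "norm y / 2"] y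
    by (auto elim!: eventually_mono simp: eq_neg_iff_add_eq_0[symmetric])
  then have "\<forall>\<^sub>F k in nhds 0. kelvin \<mu> U (y + k) - kelvin \<mu> U y - ((2 * a) *\<^sub>R y + p) \<bullet> k
     - (k \<bullet> (((2 * a) *\<^sub>R mat 1 + (\<mu>\<^sup>2 / (norm y)\<^sup>2) *\<^sub>R (refl_mat y ** X ** refl_mat y)) *v k)) / 2
     = m k * \<rho> (\<kappa> k) + (1/2 * ((m k - m 0) * (\<kappa> k \<bullet> (X *v \<kappa> k)))
      + (m 0 / 2) * (\<kappa> k \<bullet> (X *v \<kappa> k) - L k \<bullet> (X *v L k)))"
  proof eventually_elim
    case (elim k)
    let ?u = "U (inv_pt \<mu> y)" and ?I = "inv_pt \<mu> (y + k)"
    have mI: "m k *\<^sub>R ?I = y + k" using elim l by (simp add: m_def inv_pt_def)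
    have mI0: "m 0 *\<^sub>R inv_pt \<mu> y = y" using y l by (simp add: m_def inv_pt_def)
    have pI: "m k * (p \<bullet> ?I) = p \<bullet> y + p \<bullet> k" "m 0 * (p \<bullet> inv_pt \<mu> y) = p \<bullet> y"
      using arg_cong[OF mI, of "\<lambda>z. p \<bullet> z"] arg_cong[OF mI0, of "\<lambda>z. p \<bullet> z"] by (simp_all add: inner_add_right)
    have kel: "kelvin \<mu> U (y + k) = m k * (?u + p \<bullet> \<kappa> k + (\<kappa> k \<bullet> (X *v \<kappa> k)) / 2 + \<rho> (\<kappa> k))"
      "kelvin \<mu> U y = m 0 * ?u"
      by (simp_all add: kelvin_def m_def \<rho>_def \<kappa>_def)
    \<comment> \<open>Together with \<open>pI\<close> this shows that the affine part of
      \<open>U\<close> is transformed exactly into a |y|^2 + p . y; it contributes no error.\<close>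
    have ma: "m k * (?u - p \<bullet> inv_pt \<mu> y) = a * (norm (y + k))\<^sup>2" "m 0 * (?u - p \<bullet> inv_pt \<mu> y) = a * (norm y)\<^sup>2"
      by (simp_all add: m_def a_def)
    have nn: "(norm (y + k))\<^sup>2 = (norm y)\<^sup>2 + 2 * (y \<bullet> k) + k \<bullet> k"
      by (simp add: power2_norm_eq_inner inner_simps inner_commute)
    have LL: "m 0 * (L k \<bullet> (X *v L k)) = (\<mu>\<^sup>2 / (norm y)\<^sup>2) * (k \<bullet> ((refl_mat y ** X ** refl_mat y) *v k))"
    proof -
      have "k \<bullet> ((refl_mat y ** X ** refl_mat y) *v k) = (refl_mat y *v k) \<bullet> (X *v (refl_mat y *v k))"
        by (simp add: matrix_vector_mul_assoc[symmetric] symmetric_matrix_inner)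
      moreover have "m 0 * ((\<mu>\<^sup>2 / (norm y)\<^sup>2) * (\<mu>\<^sup>2 / (norm y)\<^sup>2)) = \<mu>\<^sup>2 / (norm y)\<^sup>2"
        using y l by (simp add: m_def field_simps power2_eq_square power4_eq_xxxx)
      moreover have "L k \<bullet> (X *v L k) = (\<mu>\<^sup>2 / (norm y)\<^sup>2) * (\<mu>\<^sup>2 / (norm y)\<^sup>2) * ((refl_mat y *v k) \<bullet> (X *v (refl_mat y *v k)))"
        unfolding L_def by (simp add: matrix_vector_mult_scaleR)
      ultimately show ?thesis by (metis mult.assoc)
    qed
    have "m k * (p \<bullet> \<kappa> k) = p \<bullet> y + p \<bullet> k - m k * (p \<bullet> inv_pt \<mu> y)"
      by (simp add: \<kappa>_def inner_diff_right right_diff_distrib pI)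
    then have "m k * (?u + p \<bullet> \<kappa> k) = a * (norm (y + k))\<^sup>2 + p \<bullet> y + p \<bullet> k"
      using ma(1) by (simp add: algebra_simps)
    moreover have "m 0 * ?u = a * (norm y)\<^sup>2 + p \<bullet> y" using ma(2) pI(2) by (simp add: algebra_simps)
    ultimately have "kelvin \<mu> U (y + k) - kelvin \<mu> U y = a * (2 * (y \<bullet> k) + k \<bullet> k) + p \<bullet> k
      + m k * ((\<kappa> k \<bullet> (X *v \<kappa> k)) / 2) + m k * \<rho> (\<kappa> k)"
      unfolding kel nn by (simp add: algebra_simps)
    moreover have "k \<bullet> (((2 * a) *\<^sub>R mat 1 + (\<mu>\<^sup>2 / (norm y)\<^sup>2) *\<^sub>R (refl_mat y ** X ** refl_mat y)) *v k)
       = 2 * a * (k \<bullet> k) + m 0 * (L k \<bullet> (X *v L k))"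
      unfolding LL by (simp add: quad_form_simps inner_add_right)
    ultimately show ?case by (simp add: inner_add_left algebra_simps)
  qed
  then show ?thesis unfolding jet2_def
    by (subst landau_o.small.in_cong[of _ "\<lambda>k. m k * \<rho> (\<kappa> k) + (1/2 * ((m k - m 0) * (\<kappa> k \<bullet> (X *v \<kappa> k)))
      + (m 0 / 2) * (\<kappa> k \<bullet> (X *v \<kappa> k) - L k \<bullet> (X *v L k)))"]) (use r in auto)
qed

text \<open>The conformal Hessian of \<open>v\<close> in terms of the 2-jet \<open>(w, p, X)\<close> of \<open>v powr (- 2 / (n - 2))\<close>.\<close>

definition conf_mat :: "real \<Rightarrow> real^'n \<Rightarrow> real^'n^'n \<Rightarrow> real^'n^'n" where
  "conf_mat w p X = w *\<^sub>R X - ((norm p)\<^sup>2 / 2) *\<^sub>R mat 1"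

text \<open>Conformal invariance at the level of jets. By \<open>e\<close> the multiples of the
  identity again add up to - |p|^2 / 2, and by \<open>m\<close> the conformal factors in front of X
  cancel; a conjugation by the reflection is left.\<close>

lemma conf_mat_kelvin:
  fixes X :: "real^'n^'n" and \<mu> :: real and p y :: "real^'n" and U :: "real^'n \<Rightarrow> real"
  assumes y: "y \<noteq> 0" and l: "\<mu> > 0"
  defines "a \<equiv> (U (inv_pt \<mu> y) - p \<bullet> inv_pt \<mu> y) / \<mu>\<^sup>2"
  shows "conf_mat (kelvin \<mu> U y) ((2 * a) *\<^sub>R y + p)
      ((2 * a) *\<^sub>R mat 1 + (\<mu>\<^sup>2 / (norm y)\<^sup>2) *\<^sub>R (refl_mat y ** X ** refl_mat y))
    = transpose (refl_mat y) ** conf_mat (U (inv_pt \<mu> y)) p X ** refl_mat y"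
proof -
  let ?u = "U (inv_pt \<mu> y)" and ?N = "(norm y)\<^sup>2"
  have "?N > 0" using y by simp
  have py: "p \<bullet> inv_pt \<mu> y = \<mu>\<^sup>2 / ?N * (p \<bullet> y)" by (simp add: inv_pt_def)
  have "(norm ((2 * a) *\<^sub>R y + p))\<^sup>2 = 4 * a\<^sup>2 * ?N + 4 * a * (p \<bullet> y) + (norm p)\<^sup>2"
  proof -
    have "((2 * a) *\<^sub>R y + p) \<bullet> ((2 * a) *\<^sub>R y + p) = 4 * (a * a) * (y \<bullet> y) + 4 * a * (p \<bullet> y) + p \<bullet> p"
      by (simp add: inner_simps algebra_simps inner_commute)
    then show ?thesis unfolding power2_norm_eq_inner by (simp add: power2_eq_square)
  qed
  moreover have "?u = a * \<mu>\<^sup>2 + \<mu>\<^sup>2 / ?N * (p \<bullet> y)" using l py by (simp add: a_def)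
  ultimately have e: "kelvin \<mu> U y * (2 * a) - (norm ((2 * a) *\<^sub>R y + p))\<^sup>2 / 2 = - (norm p)\<^sup>2 / 2"
    using l \<open>?N > 0\<close> by (simp add: kelvin_def field_simps power2_eq_square)
  have m: "kelvin \<mu> U y * (\<mu>\<^sup>2 / ?N) = ?u" using l y by (simp add: kelvin_def)
  show ?thesis
    unfolding matrix_eq
  proof
    fix x
    have "conf_mat (kelvin \<mu> U y) ((2 * a) *\<^sub>R y + p)
      ((2 * a) *\<^sub>R mat 1 + (\<mu>\<^sup>2 / ?N) *\<^sub>R (refl_mat y ** X ** refl_mat y)) *v x
      = (kelvin \<mu> U y * (2 * a) - (norm ((2 * a) *\<^sub>R y + p))\<^sup>2 / 2) *\<^sub>R x
        + (kelvin \<mu> U y * (\<mu>\<^sup>2 / ?N)) *\<^sub>R ((refl_mat y ** X ** refl_mat y) *v x)"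
      by (simp add: conf_mat_def quad_form_simps scaleR_right_distrib scaleR_left_diff_distrib algebra_simps)
    also have "\<dots> = (- (norm p)\<^sup>2 / 2) *\<^sub>R x + ?u *\<^sub>R (refl_mat y *v (X *v (refl_mat y *v x)))"
      unfolding e m by (simp add: matrix_vector_mul_assoc matrix_mul_assoc)
    also have "\<dots> = (transpose (refl_mat y) ** conf_mat ?u p X ** refl_mat y) *v x"
      by (simp add: conf_mat_def matrix_vector_mul_assoc[symmetric] quad_form_simps
          matrix_vector_mult_diff_distrib matrix_vector_mult_scaleR refl_mat_refl_mat[OF y])
    finally show "conf_mat (kelvin \<mu> U y) ((2 * a) *\<^sub>R y + p)
      ((2 * a) *\<^sub>R mat 1 + (\<mu>\<^sup>2 / ?N) *\<^sub>R (refl_mat y ** X ** refl_mat y)) *v x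
      = (transpose (refl_mat y) ** conf_mat ?u p X ** refl_mat y) *v x" .
  qed
qed

subsection \<open>Viscosity inequalities for jets\<close>

context
  fixes c :: real and b x :: "real^'n" and M :: "real^'n^'n"
  assumes M: "transpose M = M"
begin

text \<open>Exponential of a quadratic polynomial centred at \<open>x\<close>: positive and of class
  C2 on the whole space, as the viscosity definition requires of a test function, with a free choice
  of the 2-jet of its logarithm at \<open>x\<close>.\<close>

definition "expq y = exp (c + b \<bullet> (y - x) + ((y - x) \<bullet> (M *v (y - x))) / 2)"
definition "expq_slope y = b + M *v (y - x)"

lemma matrix_vector_has_derivative [derivative_intros]:
  "((\<lambda>y. A *v (y - z)) has_derivative (\<lambda>h. (A :: real^'n^'n) *v h)) (at y)"
  by (rule has_derivative_eq_rhs[OF bounded_linear.has_derivative[OF matrix_vector_mul_bounded_linear]])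
    (auto intro!: derivative_eq_intros)

lemma expq_has_derivative: "(expq has_derivative (\<lambda>h. expq y * (expq_slope y \<bullet> h))) (at y)"
proof -
  have "((\<lambda>y. c + b \<bullet> (y - x) + ((y - x) \<bullet> (M *v (y - x))) / 2) has_derivative
      (\<lambda>h. b \<bullet> h + ((y - x) \<bullet> (M *v h) + h \<bullet> (M *v (y - x))) / 2)) (at y)"
    by (rule has_derivative_eq_rhs, (rule derivative_intros)+) (auto simp: fun_eq_iff)
  moreover have "(\<lambda>h. b \<bullet> h + ((y - x) \<bullet> (M *v h) + h \<bullet> (M *v (y - x))) / 2) = (\<lambda>h. expq_slope y \<bullet> h)"
    using symmetric_matrix_inner[OF M, of "y - x"]
    by (auto simp: fun_eq_iff expq_slope_def inner_add_left inner_add_right inner_commute)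
  ultimately have "((\<lambda>y. c + b \<bullet> (y - x) + ((y - x) \<bullet> (M *v (y - x))) / 2) has_derivative
      (\<lambda>h. expq_slope y \<bullet> h)) (at y)" by simp
  from has_derivative_exp[OF this] show ?thesis
    unfolding expq_def by (simp add: mult.commute)
qed

lemma grad_expq: "grad expq y = expq y *\<^sub>R expq_slope y"
  unfolding grad_def frechet_derivative_at[OF expq_has_derivative, symmetric]
  by (simp add: vec_eq_iff inner_axis)

lemma grad_expq_has_derivative:
  "(grad expq has_derivative (\<lambda>h. (expq y * (expq_slope y \<bullet> h)) *\<^sub>R expq_slope y + expq y *\<^sub>R (M *v h))) (at y)"
  unfolding grad_expq[abs_def] expq_slope_def
  by (rule has_derivative_eq_rhs, (rule derivative_intros expq_has_derivative)+)
    (auto simp: fun_eq_iff expq_slope_def add.commute)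

lemma hessian_expq: "hessian expq y = expq y *\<^sub>R (M + rank1 (expq_slope y))"
proof -
  have d: "((\<lambda>y. grad expq y $ i) has_derivative
      (\<lambda>h. ((expq y * (expq_slope y \<bullet> h)) *\<^sub>R expq_slope y + expq y *\<^sub>R (M *v h)) $ i)) (at y)" for i
    by (rule bounded_linear.has_derivative[OF bounded_linear_vec_nth grad_expq_has_derivative])
  have "(M *v axis j 1) $ i = M $ i $ j" for i j
    by (simp add: matrix_vector_mult_def axis_def if_distrib cong: if_cong)
  then show ?thesis
    unfolding hessian_def frechet_derivative_at[OF d, symmetric]
    by (simp add: vec_eq_iff inner_axis rank1_def algebra_simps)
qed

lemma C2_expq: "C2_on UNIV expq"
proof -
  have "continuous_on UNIV expq"
    using expq_has_derivative has_derivative_continuous continuous_at_imp_continuous_on by blast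
  moreover have "continuous_on UNIV expq_slope"
    unfolding expq_slope_def by (intro continuous_intros matrix_vector_mult_linear_continuous_on
        continuous_on_compose2[OF matrix_vector_mult_linear_continuous_on]) auto
  ultimately have "continuous_on UNIV (hessian expq)"
    unfolding hessian_expq[abs_def] rank1_def
    by (intro continuous_on_scaleR continuous_on_add continuous_on_const continuous_on_vec_lambda
        continuous_on_mult continuous_on_component)
  then show ?thesis
    unfolding C2_on_def differentiable_def using expq_has_derivative grad_expq_has_derivative by blast
qed

text \<open>The Hessian carries one factor u and the gradient terms carry two; \<open>e1\<close> and
  \<open>e2\<close> show that in both cases the powers of u collapse to W^2.\<close>

lemma conformal_hessian_expq:
  assumes "CARD('n) \<ge> 3"
  defines "W \<equiv> expq x powr (- 2 / (real CARD('n) - 2))"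
  shows "conformal_hessian expq x = conf_mat W ((- 2 / (real CARD('n) - 2) * W) *\<^sub>R b)
     (W *\<^sub>R ((- 2 / (real CARD('n) - 2)) *\<^sub>R M + (4 / (real CARD('n) - 2)\<^sup>2) *\<^sub>R rank1 b))"
proof -
  define n where "n = real CARD('n)"
  define u where "u = expq x"
  have n: "n - 2 > 0" using assms(1) by (simp add: n_def)
  have u: "u > 0" by (simp add: u_def expq_def)
  have s: "expq_slope x = b" by (simp add: expq_slope_def)
  have W2: "W * W = u powr (- 4 / (n - 2))"
    by (simp add: W_def u_def[symmetric] n_def[symmetric] powr_add[symmetric])
  have e1: "u powr (- ((n + 2) / (n - 2))) * u = W * W"
  proof -
    have "- ((n + 2) / (n - 2)) + 1 = - 4 / (n - 2)" using n by (simp add: field_simps)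
    then show ?thesis unfolding W2 using u by (metis powr_add powr_one less_imp_le)
  qed
  have e2: "u powr (- (2 * n / (n - 2))) * (u * u) = W * W"
  proof -
    have "- (2 * n / (n - 2)) + 2 = - 4 / (n - 2)" using n by (simp add: field_simps)
    moreover have "u powr 2 = u * u" using u by (simp add: powr_numeral power2_eq_square)
    ultimately show ?thesis unfolding W2 using u by (metis powr_add)
  qed
  have k: "2 * n / (n - 2)\<^sup>2 - 2 / (n - 2) = 4 / (n - 2)\<^sup>2"
  proof -
    have "2 / t = 2 * t / t\<^sup>2" for t :: real by (simp add: power2_eq_square)
    from this[of "n - 2"] show ?thesis by (simp add: diff_divide_distrib[symmetric])
  qed
  \<comment> \<open>The identity for one matrix entry: m, r and d stand for the entries of M, of
    \<open>rank1 b\<close> and of the identity, and N for |b|^2.\<close>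
  have key: "- (a1 * A) * (u * (m + r)) + a2 * P * (u * u * r) - a3 * P * (u * u * N) * d
      = W * (W * (- a1 * m + a4 * r)) - a4 * (W * W) * N / 2 * d"
    if "A * u = W * W" "P * (u * u) = W * W" "a2 - a1 = a4" "a4 = 2 * a3" for A P a1 a2 a3 a4 m r N d
  proof -
    have "- (a1 * A) * (u * (m + r)) + a2 * P * (u * u * r) - a3 * P * (u * u * N) * d
      = - a1 * (A * u) * (m + r) + a2 * (P * (u * u)) * r - a3 * (P * (u * u)) * N * d" by (simp add: algebra_simps)
    also have "\<dots> = (W * W) * (- a1 * m + (a2 - a1) * r) - a3 * (W * W) * N * d"
      unfolding that(1,2) by (simp add: algebra_simps)
    finally show ?thesis using that(3,4) by (simp add: algebra_simps)
  qed
  have N: "(norm (u *\<^sub>R b))\<^sup>2 = u * u * (norm b)\<^sup>2"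
    "(norm ((- 2 / (n - 2) * W) *\<^sub>R b))\<^sup>2 = 4 / (n - 2)\<^sup>2 * (W * W) * (norm b)\<^sup>2"
    by (simp_all add: power_mult_distrib power_divide power2_eq_square)
  show ?thesis
    unfolding conformal_hessian_def Let_def hessian_expq grad_expq s u_def[symmetric] n_def[symmetric] conf_mat_def N
    apply (subst vec_eq_iff, rule allI, subst vec_eq_iff, rule allI)
    subgoal for i j
      using key[OF e1 e2 k, of "2 / (n - 2)\<^sup>2" "M $ i $ j" "b $ i * b $ j" "(norm b)\<^sup>2" "(mat 1 :: real^'n^'n) $ i $ j"]
      by (simp add: rank1_def mult_ac)
    done
qed

end

text \<open>The logarithm of \<phi> is -m times the 2-jet of ln W for a function with 2-jet (W, p,
  Y), so that the power -1/m of \<phi> has this 2-jet at \<open>x\<close>.\<close>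

lemma conformal_test_function:
  fixes Y :: "real^'n^'n" and p x :: "real^'n"
  assumes n: "CARD('n) \<ge> 3" and Y: "transpose Y = Y" and W: "W > 0"
  defines "m \<equiv> (real CARD('n) - 2) / 2"
  obtains \<phi> where "C2_on UNIV \<phi>" "\<And>y. \<phi> y > 0" "\<phi> x = W powr - m" "conformal_hessian \<phi> x = conf_mat W p Y"
    "\<And>k. ln (\<phi> (x + k)) = - m * (ln W + (p \<bullet> k) / W + (k \<bullet> ((Y /\<^sub>R W - rank1 p /\<^sub>R W\<^sup>2) *v k)) / 2)"
proof -
  define M where "M = (- m) *\<^sub>R (Y /\<^sub>R W - rank1 p /\<^sub>R W\<^sup>2)"
  define b where "b = (- m / W) *\<^sub>R p"
  have m: "m > 0" "- 2 / (real CARD('n) - 2) = - (1 / m)" "4 / (real CARD('n) - 2)\<^sup>2 = 1 / m\<^sup>2"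
    using n by (auto simp: m_def power_divide)
  have M: "transpose M = M" by (simp add: M_def sym_matrix_simps Y)
  define \<phi> where "\<phi> = expq (- m * ln W) b x M"
  have \<phi>x: "\<phi> x = W powr - m" using W by (simp add: \<phi>_def expq_def[OF M] powr_def)
  have w: "\<phi> x powr - (1 / m) = W" using m W by (simp add: \<phi>x powr_powr)
  have e1: "(- (1 / m) * W) *\<^sub>R b = p" using m W by (simp add: b_def)
  have "rank1 b = (m\<^sup>2 / W\<^sup>2) *\<^sub>R rank1 p"
    by (simp add: b_def rank1_def vec_eq_iff power2_eq_square)
  then have e2: "W *\<^sub>R (- (1 / m) *\<^sub>R M + (1 / m\<^sup>2) *\<^sub>R rank1 b) = Y"
    using m W by (simp add: M_def algebra_simps) (simp add: divide_inverse)
  have "conformal_hessian \<phi> x = conf_mat W p Y"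
    using conformal_hessian_expq[OF M n, of "- m * ln W" b x] w e1 e2 unfolding \<phi>_def[symmetric] m(2,3) by simp
  moreover have "ln (\<phi> (x + k)) = - m * (ln W + (p \<bullet> k) / W + (k \<bullet> ((Y /\<^sub>R W - rank1 p /\<^sub>R W\<^sup>2) *v k)) / 2)" for k
    unfolding \<phi>_def expq_def[OF M] by (simp add: b_def M_def scaleR_matrix_vector algebra_simps)
  ultimately show ?thesis
    using that[of \<phi>] C2_expq[OF M] \<phi>x by (simp add: \<phi>_def expq_def[OF M])
qed

lemma jet2_ln:
  assumes "jet2 W x p X" "W x > 0"
  shows "jet2 (\<lambda>y. ln (W y)) x (p /\<^sub>R W x) (X /\<^sub>R W x - rank1 p /\<^sub>R (W x)\<^sup>2)"
proof -
  have "taylor2 ln (W x) (inverse (W x)) (- inverse ((W x)\<^sup>2))"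
    by (rule taylor2_DERIV[of "{0<..}"])
      (use assms(2) in \<open>auto intro!: derivative_eq_intros simp: power2_eq_square divide_inverse\<close>)
  from jet2_compose[OF assms(1) this] show ?thesis by (simp add: divide_inverse)
qed

lemma abs_remainder_le:
  fixes L l P Q e :: real
  assumes "\<bar>L - l - P - Q / 2\<bar> \<le> e / 2"
  shows "L \<le> l + P + (Q + e) / 2" "l + P + (Q - e) / 2 \<le> L"
  using assms by (simp_all add: abs_le_iff field_simps)

text \<open>Both viscosity inequalities at once: \<open>R\<close> is the comparison with the test
  function and \<open>Q\<close> the conclusion about the spectrum, so that inversions and
  translations are treated a single time. A test function is anything with a 2-jet at the point,
  which admits \<open>w\<close> plus a barrier.\<close>

definition tested ::
  "(real \<Rightarrow> real \<Rightarrow> bool) \<Rightarrow> (real^'n \<Rightarrow> bool) \<Rightarrow> (real^'n) set \<Rightarrow> (real^'n \<Rightarrow> real) \<Rightarrow> bool" where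
  "tested R Q D w \<longleftrightarrow> (\<forall>x\<in>D. \<forall>p X W. transpose X = X \<longrightarrow> jet2 W x p X \<longrightarrow> W x = w x \<longrightarrow>
     (\<forall>\<^sub>F y in nhds x. R (w y) (W y)) \<longrightarrow> Q (eigvals (conf_mat (w x) p X)))"

text \<open>The power -2 / (n - 2) is decreasing: a supersolution is tested from below in terms of
  \<open>v\<close>, hence from above in terms of \<open>w\<close>.\<close>

abbreviation w_supersolution where
  "w_supersolution f \<Gamma> \<equiv> tested (\<lambda>s t. s \<le> t) (\<lambda>\<nu>. \<nu> \<in> \<Gamma> \<and> f \<nu> \<ge> 1)"

abbreviation w_subsolution where
  "w_subsolution f \<Gamma> \<equiv> tested (\<lambda>s t. s \<ge> t) (\<lambda>\<nu>. \<not> (\<nu> \<in> \<Gamma> \<and> f \<nu> > 1))"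

lemma eventually_nhds_shift:
  fixes x :: "'a::real_normed_vector"
  shows "(\<forall>\<^sub>F y in nhds x. P y) \<longleftrightarrow> (\<forall>\<^sub>F k in nhds 0. P (x + k))"
proof -
  have "nhds x = filtermap (\<lambda>k. k + x) (nhds 0)" using filtermap_nhds_shift[of "- x" 0] by (simp add: add.commute)
  then show ?thesis by (simp add: eventually_filtermap add.commute)
qed

lemma eigvals_conf_mat_shift:
  assumes "transpose X = X"
  obtains \<pi> where "bij \<pi>" "\<And>i. eigvals (conf_mat W p (X + t *\<^sub>R mat 1)) $ i = eigvals (conf_mat W p X) $ \<pi> i + W * t"
proof -
  have "conf_mat W p (X + t *\<^sub>R mat 1) = conf_mat W p X + (W * t) *\<^sub>R mat 1"
    by (simp add: conf_mat_def algebra_simps)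
  moreover have "transpose (conf_mat W p X) = conf_mat W p X"
    by (simp add: conf_mat_def sym_matrix_simps assms)
  ultimately show ?thesis using eigvals_add_scalar[of "conf_mat W p X" "W * t"] that by metis
qed

context conformal_equation
begin

context
  fixes v w :: "real^'n \<Rightarrow> real"
  assumes v: "\<And>x. v x > 0" and w: "\<And>x. w x = v x powr (- 2 / (real CARD('n) - 2))"
begin

lemma ln_v: "ln (v x) = - ((real CARD('n) - 2) / 2) * ln (w x)"
  using card_ge_3 v[of x] by (simp add: w ln_powr)

lemma v_powr: "v x = w x powr - ((real CARD('n) - 2) / 2)"
proof -
  have "- 2 / t * - (t / 2) = 1" if "t \<noteq> 0" for t :: real using that by simp
  then have "- 2 / (real CARD('n) - 2) * - ((real CARD('n) - 2) / 2) = 1" using card_ge_3 by simp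
  then show ?thesis
    by (simp only: w powr_powr powr_one less_imp_le[OF v])
qed

lemma w_pos: "w x > 0" using v[of x] by (simp add: w)

text \<open>Adding \<epsilon> I to the Hessian makes room for the remainder of the 2-jet of W, so
  that the function of \<open>conformal_test_function\<close> is a legitimate test function for
  \<open>v\<close>.\<close>

lemma test_from_above:
  assumes "viscosity_supersolution f \<Gamma> UNIV v" and X: "transpose X = X" and J: "jet2 W x p X" and Wx: "W x = w x"
    and le: "\<forall>\<^sub>F y in nhds x. w y \<le> W y" and e: "\<epsilon> > 0"
  shows "eigvals (conf_mat (w x) p (X + \<epsilon> *\<^sub>R mat 1)) \<in> \<Gamma>" "f (eigvals (conf_mat (w x) p (X + \<epsilon> *\<^sub>R mat 1))) \<ge> 1"
proof -
  let ?Y = "X + \<epsilon> *\<^sub>R mat 1" let ?m = "(real CARD('n) - 2) / 2"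
  have Y: "transpose ?Y = ?Y" by (simp add: sym_matrix_simps X)
  obtain \<phi> where \<phi>: "C2_on UNIV \<phi>" "\<And>y. \<phi> y > 0" "\<phi> x = w x powr - ?m" "conformal_hessian \<phi> x = conf_mat (w x) p ?Y"
    "\<And>k. ln (\<phi> (x + k)) = - ?m * (ln (w x) + (p \<bullet> k) / w x + (k \<bullet> ((?Y /\<^sub>R w x - rank1 p /\<^sub>R (w x)\<^sup>2) *v k)) / 2)"
    using conformal_test_function[OF card_ge_3 Y w_pos[of x], where p = p and x = x] by metis
  \<comment> \<open>In the logarithm, \<epsilon> I contributes \<epsilon> |k|^2 / (2 w x), exactly
    the tolerance granted to the remainder.\<close>
  have "\<epsilon> / (2 * w x) > 0" using e w_pos by simp
  from jet2D[OF jet2_ln[OF J] this]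
  have "\<forall>\<^sub>F k in nhds 0. \<bar>ln (W (x + k)) - ln (w x) - (p /\<^sub>R w x) \<bullet> k
      - (k \<bullet> ((X /\<^sub>R w x - rank1 p /\<^sub>R (w x)\<^sup>2) *v k)) / 2\<bar> \<le> \<epsilon> / (2 * w x) * norm k ^ 2"
    unfolding Wx using w_pos by blast
  moreover have "\<forall>\<^sub>F k in nhds 0. w (x + k) \<le> W (x + k)" using le unfolding eventually_nhds_shift[of _ x] .
  ultimately have "\<forall>\<^sub>F k in nhds 0. v (x + k) - \<phi> (x + k) \<ge> 0"
  proof eventually_elim
    case (elim k)
    have q: "k \<bullet> ((?Y /\<^sub>R w x - rank1 p /\<^sub>R (w x)\<^sup>2) *v k)
        = k \<bullet> ((X /\<^sub>R w x - rank1 p /\<^sub>R (w x)\<^sup>2) *v k) + \<epsilon> / w x * norm k ^ 2"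
      by (simp add: quad_form_simps inner_simps scaleR_right_distrib power2_norm_eq_inner divide_inverse)
    have pk: "(p /\<^sub>R w x) \<bullet> k = (p \<bullet> k) / w x" by (simp add: divide_inverse mult.commute)
    have ew: "\<epsilon> / (2 * w x) * norm k ^ 2 = (\<epsilon> / w x * norm k ^ 2) / 2" by simp
    have "ln (w (x + k)) \<le> ln (W (x + k))" using elim(2) w_pos[of "x + k"] by (simp add: ln_le_cancel_iff)
    also have "\<dots> \<le> ln (w x) + (p \<bullet> k) / w x + (k \<bullet> ((?Y /\<^sub>R w x - rank1 p /\<^sub>R (w x)\<^sup>2) *v k)) / 2"
      using abs_remainder_le(1)[OF elim(1)[unfolded pk ew]] unfolding q .
    finally have "ln (\<phi> (x + k)) \<le> ln (v (x + k))"
      unfolding \<phi>(5) ln_v using card_ge_3 by (intro mult_left_mono_neg) auto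
    then show ?case using v \<phi>(2) by simp
  qed
  then have "\<forall>\<^sub>F y in nhds x. v y - \<phi> y \<ge> 0" unfolding eventually_nhds_shift[of _ x] .
  moreover have "v x - \<phi> x = 0" by (simp add: \<phi>(3) v_powr)
  ultimately have "eigvals (conformal_hessian \<phi> x) \<in> closure \<Gamma> \<and> f (eigvals (conformal_hessian \<phi> x)) \<ge> 1"
    using assms(1) \<phi>(1,2) unfolding viscosity_supersolution_def by blast
  then show "eigvals (conf_mat (w x) p ?Y) \<in> \<Gamma>" "f (eigvals (conf_mat (w x) p ?Y)) \<ge> 1"
    using in_Gamma unfolding \<phi>(4) by auto
qed

lemma test_from_below:
  assumes "viscosity_subsolution f \<Gamma> UNIV v" and X: "transpose X = X" and J: "jet2 W x p X" and Wx: "W x = w x"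
    and le: "\<forall>\<^sub>F y in nhds x. w y \<ge> W y" and e: "\<epsilon> > 0"
  shows "\<not> (eigvals (conf_mat (w x) p (X + (- \<epsilon>) *\<^sub>R mat 1)) \<in> \<Gamma> \<and> f (eigvals (conf_mat (w x) p (X + (- \<epsilon>) *\<^sub>R mat 1))) > 1)"
proof -
  let ?Y = "X + (- \<epsilon>) *\<^sub>R mat 1" let ?m = "(real CARD('n) - 2) / 2"
  have Y: "transpose ?Y = ?Y" by (simp add: sym_matrix_simps X)
  obtain \<phi> where \<phi>: "C2_on UNIV \<phi>" "\<And>y. \<phi> y > 0" "\<phi> x = w x powr - ?m" "conformal_hessian \<phi> x = conf_mat (w x) p ?Y"
    "\<And>k. ln (\<phi> (x + k)) = - ?m * (ln (w x) + (p \<bullet> k) / w x + (k \<bullet> ((?Y /\<^sub>R w x - rank1 p /\<^sub>R (w x)\<^sup>2) *v k)) / 2)"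
    using conformal_test_function[OF card_ge_3 Y w_pos[of x], where p = p and x = x] by metis
  have "\<epsilon> / (2 * w x) > 0" using e w_pos by simp
  from jet2D[OF jet2_ln[OF J] this]
  have "\<forall>\<^sub>F k in nhds 0. \<bar>ln (W (x + k)) - ln (w x) - (p /\<^sub>R w x) \<bullet> k
      - (k \<bullet> ((X /\<^sub>R w x - rank1 p /\<^sub>R (w x)\<^sup>2) *v k)) / 2\<bar> \<le> \<epsilon> / (2 * w x) * norm k ^ 2"
    unfolding Wx using w_pos by blast
  moreover have "\<forall>\<^sub>F k in nhds 0. W (x + k) \<le> w (x + k)" using le unfolding eventually_nhds_shift[of _ x] .
  \<comment> \<open>Here W is the smaller function and might be nonpositive far from x; its
    logarithm is compared near x, where W is close to w x.\<close>
  moreover have "\<forall>\<^sub>F k in nhds 0. W (x + k) > 0"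
  proof -
    obtain C where C: "C > 0" "\<forall>\<^sub>F k in nhds 0. \<bar>W (x + k) - W x\<bar> \<le> C * norm k"
      using jet2_increment_bound[OF J] by blast
    have "w x / (2 * C) > 0" using w_pos C by simp
    from eventually_norm_le[OF this] C(2) show ?thesis
    proof eventually_elim
      case (elim k)
      have "C * norm k \<le> w x / 2" using elim(1) C(1) by (simp add: field_simps)
      then show ?case using elim(2) w_pos[of x] Wx by linarith
    qed
  qed
  ultimately have "\<forall>\<^sub>F k in nhds 0. v (x + k) - \<phi> (x + k) \<le> 0"
  proof eventually_elim
    case (elim k)
    have q: "k \<bullet> ((?Y /\<^sub>R w x - rank1 p /\<^sub>R (w x)\<^sup>2) *v k)
        = k \<bullet> ((X /\<^sub>R w x - rank1 p /\<^sub>R (w x)\<^sup>2) *v k) - \<epsilon> / w x * norm k ^ 2"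
      by (simp add: quad_form_simps inner_simps scaleR_right_distrib power2_norm_eq_inner divide_inverse algebra_simps)
    have pk: "(p /\<^sub>R w x) \<bullet> k = (p \<bullet> k) / w x" by (simp add: divide_inverse mult.commute)
    have ew: "\<epsilon> / (2 * w x) * norm k ^ 2 = (\<epsilon> / w x * norm k ^ 2) / 2" by simp
    have "ln (w x) + (p \<bullet> k) / w x + (k \<bullet> ((?Y /\<^sub>R w x - rank1 p /\<^sub>R (w x)\<^sup>2) *v k)) / 2 \<le> ln (W (x + k))"
      using abs_remainder_le(2)[OF elim(1)[unfolded pk ew]] unfolding q .
    also have "\<dots> \<le> ln (w (x + k))" using elim(2,3) w_pos[of "x + k"] by (simp add: ln_le_cancel_iff)
    finally have "ln (v (x + k)) \<le> ln (\<phi> (x + k))"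
      unfolding \<phi>(5) ln_v using card_ge_3 by (intro mult_left_mono_neg) auto
    then show ?case using v \<phi>(2) by simp
  qed
  then have "\<forall>\<^sub>F y in nhds x. v y - \<phi> y \<le> 0" unfolding eventually_nhds_shift[of _ x] .
  moreover have "v x - \<phi> x = 0" by (simp add: \<phi>(3) v_powr)
  ultimately have "eigvals (conformal_hessian \<phi> x) \<notin> closure \<Gamma> \<or> f (eigvals (conformal_hessian \<phi> x)) \<le> 1"
    using assms(1) \<phi>(1,2) unfolding viscosity_subsolution_def by blast
  then show ?thesis using closure_subset unfolding \<phi>(4) by fastforce
qed

lemma shifted_tendsto:
  fixes E :: "real^'n"
  assumes "c > 0"
  shows "(\<lambda>k. \<chi> i. E $ i + s * (c * inverse (real (Suc k)))) \<longlonglongrightarrow> E"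
proof -
  have "(\<lambda>k. \<chi> i. E $ i + s * (c * inverse (real (Suc k)))) \<longlonglongrightarrow> (\<chi> i. E $ i + s * (c * 0))"
    by (intro tendsto_vec_lambda tendsto_intros LIMSEQ_inverse_real_of_nat)
  then show ?thesis by simp
qed

text \<open>Adding \<epsilon> I to X shifts the spectrum by exactly \<epsilon> w x, up to order. As
  \<epsilon> tends to 0, continuity of f on the closure and (S5) give the claim for X
  itself.\<close>

lemma w_supersolution_viscosity:
  assumes "viscosity_supersolution f \<Gamma> UNIV v"
  shows "w_supersolution f \<Gamma> UNIV w"
  unfolding tested_def
proof (intro ballI allI impI)
  fix x p X W
  assume X: "transpose X = X" and J: "jet2 W x p X" and Wx: "W x = w x" and le: "\<forall>\<^sub>F y in nhds x. w y \<le> W y"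
  let ?E = "eigvals (conf_mat (w x) p X)"
  let ?S = "\<lambda>k. \<chi> i. ?E $ i + 1 * (w x * inverse (real (Suc k)))"
  have S: "?S k \<in> \<Gamma> \<and> f (?S k) \<ge> 1" for k
  proof -
    obtain \<pi> where \<pi>: "bij \<pi>" "\<And>i. eigvals (conf_mat (w x) p (X + inverse (real (Suc k)) *\<^sub>R mat 1)) $ i
        = ?E $ \<pi> i + w x * inverse (real (Suc k))"
      using eigvals_conf_mat_shift[OF X] by metis
    have "inverse (real (Suc k)) > 0" by simp
    note t = test_from_above[OF assms X J Wx le this]
    show ?thesis using permuted'[OF \<pi>(1) _ t(1), of "?S k"] t(2) \<pi>(2) by simp
  qed
  have lim: "?S \<longlonglongrightarrow> ?E" by (rule shifted_tendsto[OF w_pos])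
  then have cl: "?E \<in> closure \<Gamma>" 
    unfolding closure_sequential by (intro exI[of _ ?S] conjI allI conjunct1[OF S])
  have "(\<lambda>k. f (?S k)) \<longlonglongrightarrow> f ?E"
    by (rule continuous_on_tendsto_compose[OF cont_f lim cl])
      (intro always_eventually allI subsetD[OF closure_subset] conjunct1[OF S])
  then have "f ?E \<ge> 1" by (rule LIMSEQ_le_const) (intro exI allI impI conjunct2[OF S])
  then show "?E \<in> \<Gamma> \<and> f ?E \<ge> 1" using in_Gamma[OF cl] by simp
qed

text \<open>Openness of \<Gamma> takes the place of (S5): if the limit were in \<Gamma> with f > 1,
  so would be the slightly shifted spectra, against \<open>test_from_below\<close>.\<close>

lemma w_subsolution_viscosity:
  assumes "viscosity_subsolution f \<Gamma> UNIV v"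
  shows "w_subsolution f \<Gamma> UNIV w"
  unfolding tested_def
proof (intro ballI allI impI notI)
  fix x p X W
  assume X: "transpose X = X" and J: "jet2 W x p X" and Wx: "W x = w x" and le: "\<forall>\<^sub>F y in nhds x. w y \<ge> W y"
  let ?E = "eigvals (conf_mat (w x) p X)"
  assume E: "?E \<in> \<Gamma> \<and> f ?E > 1"
  let ?S = "\<lambda>k. \<chi> i. ?E $ i + (- 1) * (w x * inverse (real (Suc k)))"
  have S: "\<not> (?S k \<in> \<Gamma> \<and> f (?S k) > 1)" for k
  proof -
    obtain \<pi> where \<pi>: "bij \<pi>" "\<And>i. eigvals (conf_mat (w x) p (X + (- inverse (real (Suc k))) *\<^sub>R mat 1)) $ i
        = ?E $ \<pi> i + w x * (- inverse (real (Suc k)))"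
      using eigvals_conf_mat_shift[OF X] by metis
    have "inverse (real (Suc k)) > 0" by simp
    note t = test_from_below[OF assms X J Wx le this]
    show ?thesis
    proof
      assume "?S k \<in> \<Gamma> \<and> f (?S k) > 1"
      then show False using permuted[OF \<pi>(1), of "eigvals (conf_mat (w x) p (X + (- inverse (real (Suc k))) *\<^sub>R mat 1))" "?S k"]
          t \<pi>(2) by simp
    qed
  qed
  have lim: "?S \<longlonglongrightarrow> ?E" by (rule shifted_tendsto[OF w_pos])
  have "isCont f ?E"
    using E open_Gamma continuous_on_subset[OF cont_f closure_subset] by (simp add: continuous_on_eq_continuous_at)
  then have "(\<lambda>k. f (?S k)) \<longlonglongrightarrow> f ?E" using lim by (rule isCont_tendsto_compose)
  then have "\<forall>\<^sub>F k in sequentially. f (?S k) > 1" using E by (intro order_tendstoD) auto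
  moreover have "\<forall>\<^sub>F k in sequentially. ?S k \<in> \<Gamma>"
    using topological_tendstoD[OF lim open_Gamma] E by blast
  ultimately have "\<forall>\<^sub>F k in sequentially. False" by eventually_elim (use S in blast)
  then show False by simp
qed

end
end

text \<open>The same transform turns a function touching \<open>kelvin \<mu> w\<close> at z into one
  touching \<open>w\<close> at the reflected point, because it is an involution and multiplies both
  sides by a nonnegative factor. The two spectra agree by \<open>conf_mat_kelvin\<close>.\<close>

lemma tested_kelvin:
  assumes "tested R Q UNIV w" and \<mu>: "\<mu> > 0" and R: "\<And>a b c. c \<ge> 0 \<Longrightarrow> R a b \<Longrightarrow> R (c * a) (c * b)"
  shows "tested R Q (- {0}) (kelvin \<mu> w)"
  unfolding tested_def
proof (intro ballI allI impI)
  fix z p X W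
  assume z: "z \<in> - {0}" and X: "transpose X = X" and J: "jet2 W z p X" and Wx: "W z = kelvin \<mu> w z"
    and le: "\<forall>\<^sub>F y in nhds z. R (kelvin \<mu> w y) (W y)"
  define y where "y = inv_pt \<mu> z"
  have y: "y \<noteq> 0" and yz: "inv_pt \<mu> y = z" using z \<mu> by (auto simp: y_def inv_pt_nz inv_pt_inv_pt)
  define a where "a = (W z - p \<bullet> z) / \<mu>\<^sup>2"
  define Y where "Y = (2 * a) *\<^sub>R mat 1 + (\<mu>\<^sup>2 / (norm y)\<^sup>2) *\<^sub>R (refl_mat y ** X ** refl_mat y)"
  have J': "jet2 (kelvin \<mu> W) y ((2 * a) *\<^sub>R y + p) Y"
    using jet2_kelvin[OF y \<mu>, of W p X] J by (simp add: yz a_def Y_def)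
  have sY: "transpose Y = Y"
    by (simp add: Y_def sym_matrix_simps matrix_transpose_mul X matrix_mul_assoc)
  have Wy: "kelvin \<mu> W y = w y"
    using kelvin_kelvin[of \<mu> y w] \<mu> y by (simp add: kelvin_def[of _ W] kelvin_def[of _ "kelvin _ _"] yz Wx)
  have "isCont (inv_pt \<mu>) y" using has_derivative_continuous[OF has_derivative_inv_pt[OF y]] by (simp add: continuous_at)
  then have "filterlim (inv_pt \<mu>) (nhds z) (nhds y)"
    unfolding isCont_def yz using tendsto_at_iff_tendsto_nhds[of "inv_pt \<mu>" y] yz by simp
  from eventually_compose_filterlim[OF le this]
  have 1: "\<forall>\<^sub>F x in nhds y. R (kelvin \<mu> w (inv_pt \<mu> x)) (W (inv_pt \<mu> x))" .
  have 2: "\<forall>\<^sub>F x in nhds y. x \<noteq> 0" using y by (metis t1_space_nhds)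
  have "\<forall>\<^sub>F x in nhds y. R (w x) (kelvin \<mu> W x)"
    using 1 2
  proof eventually_elim
    case (elim x)
    have "R (kelvin \<mu> (kelvin \<mu> w) x) (kelvin \<mu> W x)"
      unfolding kelvin_def[of _ "kelvin _ _"] kelvin_def[of _ W] by (rule R[OF _ elim(1)]) simp
    then show ?case using elim \<mu> by (simp add: kelvin_kelvin)
  qed
  then have "Q (eigvals (conf_mat (w y) ((2 * a) *\<^sub>R y + p) Y))"
    using assms(1) sY J' Wy unfolding tested_def by blast
  moreover have "conf_mat (w y) ((2 * a) *\<^sub>R y + p) Y
      = transpose (refl_mat y) ** conf_mat (W z) p X ** refl_mat y"
    using conf_mat_kelvin[OF y \<mu>, of W p X] unfolding Wy yz a_def[symmetric] Y_def[symmetric] .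
  ultimately show "Q (eigvals (conf_mat (kelvin \<mu> w z) p X))"
    using eigvals_orthogonal_conj[OF orthogonal_refl_mat[OF y]] by (simp add: Wx)
qed

lemma w_supersolution_kelvin:
  "w_supersolution f \<Gamma> UNIV w \<Longrightarrow> \<mu> > 0 \<Longrightarrow> w_supersolution f \<Gamma> (- {0}) (kelvin \<mu> w)"
  by (rule tested_kelvin) (auto intro: mult_left_mono)

lemma w_subsolution_kelvin:
  "w_subsolution f \<Gamma> UNIV w \<Longrightarrow> \<mu> > 0 \<Longrightarrow> w_subsolution f \<Gamma> (- {0}) (kelvin \<mu> w)"
  by (rule tested_kelvin) (auto intro: mult_left_mono)

subsection \<open>Differentiability of Lipschitz functions\<close>

text \<open>Vitali covering: disjoint intervals in an open set slightly larger than
  \<open>E\<close>, each stretched by at most p, cover \<open>E\<close> up to a null set, whose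
  image is null since F is Lipschitz. The right inverse G makes images of intervals full
  intervals.\<close>

lemma vitali_image_estimate:
  fixes F G :: "real \<Rightarrow> real"
  assumes mono: "strict_mono F" and FG: "\<And>y. F (G y) = y" and lip: "\<And>x y. \<bar>F x - F y\<bar> \<le> L * \<bar>x - y\<bar>"
    and E: "E \<in> lmeasurable" and FE: "F ` E \<in> sets lebesgue" and p: "p \<ge> 0"
    and cover: "\<And>x d. x \<in> E \<Longrightarrow> d > 0 \<Longrightarrow> \<exists>a r. 0 < r \<and> r < d \<and> x \<in> cball a r \<and> F (a + r) - F (a - r) \<le> p * (2 * r)"
  shows "emeasure lebesgue (F ` E) \<le> ennreal p * emeasure lebesgue E"
proof (rule ennreal_le_epsilon)
  fix e :: real assume "e > 0"
  \<comment> \<open>Divided by p + 1 instead of p, because p may be 0.\<close>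
  define e' where "e' = e / (p + 1)"
  have "e' > 0" "p * e' \<le> e" using \<open>e > 0\<close> p by (auto simp: e'_def field_simps)
  obtain U where U: "open U" "E \<subseteq> U" "U - E \<in> lmeasurable" "emeasure lebesgue (U - E) < ennreal e'"
    using sets_lebesgue_outer_open[OF fmeasurableD[OF E] \<open>e' > 0\<close>] by metis
  define K where "K = {(a, r). 0 < r \<and> cball a r \<subseteq> U \<and> F (a + r) - F (a - r) \<le> p * (2 * r)}"
  have fine: "\<exists>i. i \<in> K \<and> x \<in> cball (fst i) (snd i) \<and> snd i < d" if x: "x \<in> E" and d: "d > 0" for x d
  proof -
    obtain s where s: "s > 0" "cball x s \<subseteq> U" using U(1,2) x by (meson open_contains_cball subsetD)
    \<comment> \<open>The interval contains x without being centred there; a radius below s/2 keeps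
      it within distance s of x.\<close>
    obtain a r where ar: "0 < r" "r < min d (s / 2)" "x \<in> cball a r" "F (a + r) - F (a - r) \<le> p * (2 * r)"
      using cover[OF x, of "min d (s / 2)"] d s(1) by auto
    have "cball a r \<subseteq> cball x s"
    proof
      fix y assume "y \<in> cball a r"
      then show "y \<in> cball x s" using ar dist_triangle[of x y a] by (auto simp: dist_commute)
    qed
    then have "(a, r) \<in> K" using ar s by (auto simp: K_def)
    then show ?thesis using ar by (intro exI[of _ "(a, r)"]) auto
  qed
  have Kp: "0 < snd i" if "i \<in> K" for i using that by (auto simp: K_def)
  obtain C where C: "countable C" "C \<subseteq> K"
     "pairwise (\<lambda>i j. disjnt (cball (fst i) (snd i)) (cball (fst j) (snd j))) C"
     "negligible (E - (\<Union>i \<in> C. cball (fst i) (snd i)))"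
    by (rule Vitali_covering_theorem_cballs[of K snd E fst, OF Kp fine])
  define N where "N = E - (\<Union>i \<in> C. cball (fst i) (snd i))"
  define I where "I i = cball (fst i) (snd i :: real)" for i :: "real \<times> real"
  have negN: "negligible (F ` N)"
  proof (rule negligible_locally_Lipschitz_image)
    show "negligible N" using C(4) by (simp add: N_def)
    fix x assume "x \<in> N"
    show "\<exists>T B. open T \<and> x \<in> T \<and> (\<forall>y\<in>N \<inter> T. norm (F y - F x) \<le> B * norm (y - x))"
      using lip by (intro exI[of _ UNIV] exI[of _ L]) simp
  qed simp
  have FI: "F ` I i = {F (fst i - snd i)..F (fst i + snd i)}" if "snd i > 0" for i
  proof (intro equalityI subsetI)
    fix y assume "y \<in> F ` I i"
    then show "y \<in> {F (fst i - snd i)..F (fst i + snd i)}"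
      using mono by (auto simp: I_def cball_eq_atLeastAtMost strict_mono_less_eq)
  next
    fix y assume y: "y \<in> {F (fst i - snd i)..F (fst i + snd i)}"
    then have "F (fst i - snd i) \<le> F (G y)" "F (G y) \<le> F (fst i + snd i)" by (auto simp: FG)
    then have "G y \<in> I i" using mono by (auto simp: I_def cball_eq_atLeastAtMost strict_mono_less_eq)
    then show "y \<in> F ` I i" using FG by (metis imageI)
  qed
  have Kpos: "snd i > 0" if "i \<in> C" for i using C(2) that by (auto simp: K_def)
  have disj: "disjoint_family_on I C"
    using C(3) by (auto simp: disjoint_family_on_def pairwise_def disjnt_def I_def)
  have disjF: "disjoint_family_on (\<lambda>i. F ` I i) C"
    using disj strict_mono_imp_inj_on[OF mono] unfolding disjoint_family_on_def by (metis image_Int image_empty)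
  have mF: "F ` I i \<in> sets lebesgue" if "i \<in> C" for i using FI[OF Kpos[OF that]] by simp
  have mI: "I i \<in> sets lebesgue" if "i \<in> C" for i by (simp add: I_def)
  have le: "emeasure lebesgue (F ` I i) \<le> ennreal p * emeasure lebesgue (I i)" if "i \<in> C" for i
  proof -
    have "F (fst i - snd i) \<le> F (fst i + snd i)" using Kpos[OF that] mono by (simp add: strict_mono_less_eq)
    then have "emeasure lebesgue (F ` I i) = ennreal (F (fst i + snd i) - F (fst i - snd i))"
      using FI[OF Kpos[OF that]] by simp
    also have "\<dots> \<le> ennreal (p * (2 * snd i))" using C(2) that by (intro ennreal_leI) (auto simp: K_def)
    also have "\<dots> = ennreal p * emeasure lebesgue (I i)"
      using Kpos[OF that] p by (simp add: I_def cball_eq_atLeastAtMost ennreal_mult)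
    finally show ?thesis .
  qed
  have "F ` E \<subseteq> F ` N \<union> (\<Union>i\<in>C. F ` I i)" by (auto simp: N_def I_def)
  then have "emeasure lebesgue (F ` E) \<le> emeasure lebesgue (F ` N \<union> (\<Union>i\<in>C. F ` I i))"
    using mF C(1) negN by (intro emeasure_mono sets.Un sets.countable_UN') (auto simp: negligible_imp_sets)
  also have "\<dots> \<le> emeasure lebesgue (F ` N) + emeasure lebesgue (\<Union>i\<in>C. F ` I i)"
    using mF C(1) negN by (intro emeasure_subadditive sets.countable_UN') (auto simp: negligible_imp_sets)
  also have "emeasure lebesgue (F ` N) = 0"
    using negN negligible_iff_emeasure0[OF negligible_imp_sets[OF negN]] by simp
  also have "emeasure lebesgue (\<Union>i\<in>C. F ` I i) = (\<integral>\<^sup>+i. emeasure lebesgue (F ` I i) \<partial>count_space C)"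
    by (rule emeasure_UN_countable[OF mF C(1) disjF])
  also have "\<dots> \<le> (\<integral>\<^sup>+i. ennreal p * emeasure lebesgue (I i) \<partial>count_space C)"
    by (intro nn_integral_mono) (auto intro: le)
  also have "\<dots> = ennreal p * (\<integral>\<^sup>+i. emeasure lebesgue (I i) \<partial>count_space C)"
    by (rule nn_integral_cmult) auto
  also have "(\<integral>\<^sup>+i. emeasure lebesgue (I i) \<partial>count_space C) = emeasure lebesgue (\<Union>i\<in>C. I i)"
    by (rule emeasure_UN_countable[OF mI C(1) disj, symmetric])
  also have "ennreal p * emeasure lebesgue (\<Union>i\<in>C. I i) \<le> ennreal p * emeasure lebesgue U"
  proof (intro mult_left_mono emeasure_mono)
    show "(\<Union>i\<in>C. I i) \<subseteq> U"
    proof (rule UN_least)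
      fix i assume "i \<in> C"
      then have "i \<in> K" using C(2) by blast
      then show "I i \<subseteq> U" unfolding K_def I_def by (cases i) simp
    qed
  qed (use U(1) in auto)
  also have "emeasure lebesgue U \<le> emeasure lebesgue E + emeasure lebesgue (U - E)"
    using emeasure_subadditive[of E lebesgue "U - E"] E U by (simp add: Un_absorb1 fmeasurableD)
  also have "\<dots> \<le> emeasure lebesgue E + ennreal e'" using U(4) by (intro add_left_mono) auto
  also have "ennreal p * (emeasure lebesgue E + ennreal e') = ennreal p * emeasure lebesgue E + ennreal (p * e')"
    using p \<open>e' > 0\<close> by (simp add: distrib_left ennreal_mult)
  also have "\<dots> \<le> ennreal p * emeasure lebesgue E + ennreal e"
    using \<open>p * e' \<le> e\<close> by (intro add_left_mono ennreal_leI)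
  finally show "emeasure lebesgue (F ` E) \<le> ennreal p * emeasure lebesgue E + ennreal e"
    by (simp add: mult_left_mono)
qed

text \<open>The limit s is the supremum of the eventual lower bounds. A rational p above s is not
  one of them, so by \<open>no\<close> every rational q > p is an eventual upper bound.\<close>

lemma bounded_limit_exists_iff:
  fixes D :: "real \<Rightarrow> real"
  assumes lo: "\<And>h. h \<noteq> 0 \<Longrightarrow> \<bar>D h\<bar> \<le> M"
    and no: "\<And>p q. p \<in> \<rat> \<Longrightarrow> q \<in> \<rat> \<Longrightarrow> p < q \<Longrightarrow>
      (\<forall>\<^sub>F h in at 0. D h \<ge> p) \<or> (\<forall>\<^sub>F h in at 0. D h \<le> q)"
  shows "\<exists>l. (D \<longlongrightarrow> l) (at 0)"
proof -
  define A where "A = {p. \<forall>\<^sub>F h in at 0. D h \<ge> p}"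
  have ev: "\<forall>\<^sub>F h in at (0::real). h \<noteq> 0" by (simp add: eventually_at_filter)
  have ne: "- M \<in> A" unfolding A_def using ev lo by (auto elim!: eventually_mono simp: abs_le_iff minus_le_iff)
  have bdd: "p \<le> M" if "p \<in> A" for p
  proof -
    have "\<forall>\<^sub>F h in at (0::real). p \<le> M"
      using that[unfolded A_def, simplified] ev by eventually_elim (use lo in fastforce)
    then show ?thesis by simp
  qed
  define s where "s = Sup A"
  have bA: "bdd_above A" using bdd by (auto simp: bdd_above_def)
  show ?thesis
  proof (intro exI[of _ s] order_tendstoI)
    fix a assume "a < s"
    then obtain p where "p \<in> A" "a < p" using less_cSup_iff[of A a] ne bA unfolding s_def by auto
    then show "\<forall>\<^sub>F h in at 0. a < D h" unfolding A_def by (auto elim!: eventually_mono)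
  next
    fix a assume "s < a"
    obtain p where p: "p \<in> \<rat>" "s < p" "p < a" using Rats_dense_in_real[OF \<open>s < a\<close>] by auto
    obtain q where q: "q \<in> \<rat>" "p < q" "q < a" using Rats_dense_in_real[OF p(3)] by auto
    have "p \<notin> A" using p(2) bA cSup_upper[of p A] unfolding s_def by auto
    then have "\<forall>\<^sub>F h in at 0. D h \<le> q" using no[OF p(1) q(1,2)] by (auto simp: A_def)
    then show "\<forall>\<^sub>F h in at 0. D h < a" using q(3) by (auto elim!: eventually_mono)
  qed
qed

text \<open>Points at which difference quotients below \<open>p\<close> and above \<open>q\<close> both occur at arbitrarily small scales.\<close>

definition bad_slopes :: "('a::real_normed_vector \<Rightarrow> real) \<Rightarrow> 'a \<Rightarrow> real \<Rightarrow> real \<Rightarrow> 'a set" where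
  "bad_slopes F e p q = (\<Inter>k::nat. (\<Union>h\<in>{h. 0 < \<bar>h\<bar> \<and> \<bar>h\<bar> < 1 / (real k + 1)}. {x. (F (x + h *\<^sub>R e) - F x) / h < p})) \<inter>
     (\<Inter>k::nat. (\<Union>h\<in>{h. 0 < \<bar>h\<bar> \<and> \<bar>h\<bar> < 1 / (real k + 1)}. {x. (F (x + h *\<^sub>R e) - F x) / h > q}))"

lemma bad_slopes_small:
  assumes "x \<in> bad_slopes F e p q" "d > 0"
  shows "\<exists>h. 0 < \<bar>h\<bar> \<and> \<bar>h\<bar> < d \<and> (F (x + h *\<^sub>R e) - F x) / h < p"
    and "\<exists>h. 0 < \<bar>h\<bar> \<and> \<bar>h\<bar> < d \<and> (F (x + h *\<^sub>R e) - F x) / h > q"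
proof -
  obtain k :: nat where "1 / (real k + 1) < d"
    using reals_Archimedean[OF assms(2)] by (auto simp: inverse_eq_divide add.commute)
  then show "\<exists>h. 0 < \<bar>h\<bar> \<and> \<bar>h\<bar> < d \<and> (F (x + h *\<^sub>R e) - F x) / h < p"
    "\<exists>h. 0 < \<bar>h\<bar> \<and> \<bar>h\<bar> < d \<and> (F (x + h *\<^sub>R e) - F x) / h > q"
    using assms(1) unfolding bad_slopes_def by (fastforce dest: spec[of _ k])+
qed

text \<open>The unions over the uncountably many h are open because each member is; the set is thus
  a countable intersection of open sets.\<close>

lemma borel_bad_slopes:
  fixes F :: "'a::euclidean_space \<Rightarrow> real"
  assumes "continuous_on UNIV F"
  shows "bad_slopes F e p q \<in> sets borel"
proof -
  have "continuous_on UNIV (\<lambda>x. (F (x + h *\<^sub>R e) - F x) / h)" if "h \<noteq> 0" for h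
    using that by (intro continuous_intros continuous_on_compose2[OF assms]) auto
  then have "open {x. (F (x + h *\<^sub>R e) - F x) / h < p}" "open {x. (F (x + h *\<^sub>R e) - F x) / h > q}" if "h \<noteq> 0" for h
    using that by (auto intro!: open_Collect_less continuous_on_const)
  then show ?thesis unfolding bad_slopes_def
    by (intro sets.Int sets.countable_INT') (auto intro!: borel_open open_UN)
qed

lemma derivative_exists_or_bad:
  fixes F :: "'a::real_normed_vector \<Rightarrow> real"
  assumes lip: "\<And>x y. \<bar>F x - F y\<bar> \<le> L * norm (x - y)"
    and nb: "\<And>p q. p \<in> \<rat> \<Longrightarrow> q \<in> \<rat> \<Longrightarrow> p < q \<Longrightarrow> x \<notin> bad_slopes F e p q"
  shows "\<exists>l. ((\<lambda>h. (F (x + h *\<^sub>R e) - F x) / h) \<longlongrightarrow> l) (at 0)"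
proof (rule bounded_limit_exists_iff[where M = "L * norm e"])
  fix h :: real assume h: "h \<noteq> 0"
  have "\<bar>F (x + h *\<^sub>R e) - F x\<bar> \<le> L * norm e * \<bar>h\<bar>" using lip[of "x + h *\<^sub>R e" x] by (simp add: ac_simps)
  then show "\<bar>(F (x + h *\<^sub>R e) - F x) / h\<bar> \<le> L * norm e" using h by (simp add: abs_divide field_simps)
next
  fix p q :: real assume pq: "p \<in> \<rat>" "q \<in> \<rat>" "p < q"
  from nb[OF pq] obtain k :: nat where "(\<forall>h. 0 < \<bar>h\<bar> \<and> \<bar>h\<bar> < 1 / (real k + 1) \<longrightarrow> \<not> (F (x + h *\<^sub>R e) - F x) / h < p)
     \<or> (\<forall>h. 0 < \<bar>h\<bar> \<and> \<bar>h\<bar> < 1 / (real k + 1) \<longrightarrow> \<not> (F (x + h *\<^sub>R e) - F x) / h > q)"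
    unfolding bad_slopes_def by blast
  moreover have "1 / (real k + 1) > 0" by simp
  ultimately show "(\<forall>\<^sub>F h in at 0. p \<le> (F (x + h *\<^sub>R e) - F x) / h) \<or> (\<forall>\<^sub>F h in at 0. (F (x + h *\<^sub>R e) - F x) / h \<le> q)"
    unfolding eventually_at by (metis dist_0_norm dist_commute not_less real_norm_def zero_less_abs_iff)
qed

text \<open>Adding c x shifts every difference quotient by c; this reduces Lipschitz functions to
  increasing ones.\<close>

lemma bad_slopes_shear:
  fixes F :: "real \<Rightarrow> real"
  shows "bad_slopes (\<lambda>x. F x + c * x) 1 (p + c) (q + c) = bad_slopes F 1 p q"
proof -
  have "(F (x + h *\<^sub>R 1) + c * (x + h *\<^sub>R 1) - (F x + c * x)) / h = (F (x + h *\<^sub>R 1) - F x) / h + c" if "0 < \<bar>h\<bar>" for x h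
    using that by (simp add: field_simps)
  then show ?thesis unfolding bad_slopes_def by (auto cong: conj_cong)
qed

text \<open>On a bounded piece E of the bad set, short intervals of slope below p give |F(E)| \<le>
  p |E|, and those of slope above q, read through the inverse G, give |E| \<le> |F(E)| / q. Hence q
  |E| \<le> p |E| and |E| = 0. The lower slope bound 1 makes F invertible and leaves no bad points
  when p < 1.\<close>

lemma negligible_bad_slopes_increasing:
  fixes F :: "real \<Rightarrow> real"
  assumes lower: "\<And>x y. x \<le> y \<Longrightarrow> y - x \<le> F y - F x" and lip: "\<And>x y. \<bar>F x - F y\<bar> \<le> L * \<bar>x - y\<bar>"
    and pq: "p < q"
  shows "negligible (bad_slopes F 1 p q)"
proof -
  have sm: "strict_mono F"
  proof (rule strict_monoI)
    fix x y :: real assume "x < y" then show "F x < F y" using lower[of x y] by simp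
  qed
  have cF: "continuous_on UNIV F"
  proof (rule lipschitz_on_continuous_on[of "\<bar>L\<bar>"])
    show "\<bar>L\<bar>-lipschitz_on UNIV F"
      using order_trans[OF lip mult_right_mono[OF abs_ge_self abs_ge_zero]]
      by (intro lipschitz_onI) (auto simp: dist_real_def)
  qed
  have surj: "\<exists>x. F x = y" for y
  proof -
    let ?a = "- \<bar>y - F 0\<bar>" and ?b = "\<bar>y - F 0\<bar>"
    have "F ?a \<le> y" using lower[of ?a 0] by simp
    moreover have "y \<le> F ?b" using lower[of 0 ?b] by simp
    moreover have "continuous_on {?a..?b} F" using cF by (rule continuous_on_subset) simp
    ultimately show ?thesis using IVT'[of F ?a y ?b] by auto
  qed
  define G where "G = inv F"
  have FG: "F (G y) = y" for y using surj[of y] unfolding G_def by (metis f_inv_into_f rangeI)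
  have GF: "G (F x) = x" for x using sm by (simp add: G_def strict_mono_imp_inj_on)
  have lipG: "\<bar>G x - G y\<bar> \<le> 1 * \<bar>x - y\<bar>" for x y
    using lower[of "G x" "G y"] lower[of "G y" "G x"] by (simp add: FG) linarith
  have cG: "continuous_on UNIV G"
    using lipG by (intro lipschitz_on_continuous_on[of 1] lipschitz_onI) (auto simp: dist_real_def)
  have smG: "strict_mono G"
    using sm by (intro strict_monoI) (metis FG strict_mono_less)
  define B where "B = bad_slopes F 1 p q"
  have "negligible (B \<inter> ball 0 (real m))" for m :: nat
  proof (cases "p \<ge> 1")
    case False
    have "B = {}"
    proof (rule ccontr)
      assume "B \<noteq> {}"
      then obtain x where "x \<in> bad_slopes F 1 p q" unfolding B_def by blast
      from bad_slopes_small(1)[OF this zero_less_one]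
      obtain h where h: "0 < \<bar>h\<bar>" "(F (x + h *\<^sub>R 1) - F x) / h < p" by blast
      have "(F (x + h) - F x) / h \<ge> 1"
      proof (cases "h > 0")
        case True then show ?thesis using lower[of x "x + h"] by (simp add: field_simps)
      next
        case False then show ?thesis using lower[of "x + h" x] h(1) by (simp add: field_simps)
      qed
      then show False using h False by simp
    qed
    then show ?thesis by simp
  next
    case True
    let ?E = "B \<inter> ball 0 (real m)"
    have Eb: "?E \<in> sets borel" using borel_bad_slopes[OF cF] by (auto simp: B_def)
    have E: "?E \<in> lmeasurable"
      by (rule fmeasurableI2[of "ball 0 (real m)"]) (use Eb in auto)
    have "F ` ?E = G -` ?E" using FG GF by (auto intro!: image_eqI)
    moreover have "G -` ?E \<in> sets borel"
      using measurable_sets[OF borel_measurable_continuous_onI[OF cG] Eb] by simp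
    ultimately have FE: "F ` ?E \<in> sets borel" by simp
    have 1: "emeasure lebesgue (F ` ?E) \<le> ennreal p * emeasure lebesgue ?E"
    proof (rule vitali_image_estimate[OF sm FG lip E])
      fix x d :: real assume x: "x \<in> ?E" and "d > 0"
      then obtain h where h: "0 < \<bar>h\<bar>" "\<bar>h\<bar> < d" "(F (x + h) - F x) / h < p"
        using bad_slopes_small(1)[of x F 1 p q d] unfolding B_def by auto
      \<comment> \<open>The interval between x and x + h, in terms of its centre and radius.\<close>
      have "F (x + h / 2 + \<bar>h\<bar> / 2) - F (x + h / 2 - \<bar>h\<bar> / 2) \<le> p * (2 * (\<bar>h\<bar> / 2))"
      proof (cases "h > 0")
        case True
        then have e: "x + h / 2 + \<bar>h\<bar> / 2 = x + h" "x + h / 2 - \<bar>h\<bar> / 2 = x" by auto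
        show ?thesis unfolding e using h(3) True by (simp add: field_simps)
      next
        case False
        then have e: "x + h / 2 + \<bar>h\<bar> / 2 = x" "x + h / 2 - \<bar>h\<bar> / 2 = x + h" by auto
        show ?thesis unfolding e using h(1,3) False by (simp add: field_simps)
      qed
      then show "\<exists>a r. 0 < r \<and> r < d \<and> x \<in> cball a r \<and> F (a + r) - F (a - r) \<le> p * (2 * r)"
        using h by (intro exI[of _ "x + h / 2"] exI[of _ "\<bar>h\<bar> / 2"]) (auto simp: dist_real_def)
    qed (use FE True in auto)
    have fin: "emeasure lebesgue ?E < top"
      unfolding less_top[symmetric] by (rule fmeasurableD2[OF E])
    have "emeasure lebesgue (F ` ?E) < top"
      by (rule le_less_trans[OF 1]) (use fin in \<open>simp only: ennreal_mult_less_top ennreal_less_top simp_thms\<close>)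
    then have FEm: "F ` ?E \<in> lmeasurable" using FE by (intro fmeasurableI) (auto simp: top.not_eq_extremum)
    have GFE: "G ` (F ` ?E) = ?E" using GF by (auto simp: image_image)
    have 2: "emeasure lebesgue (G ` (F ` ?E)) \<le> ennreal (1 / q) * emeasure lebesgue (F ` ?E)"
    proof (rule vitali_image_estimate[OF smG GF lipG FEm])
      fix y d :: real assume "y \<in> F ` ?E" and d: "d > 0"
      then obtain x where x: "x \<in> ?E" "y = F x" by auto
      \<comment> \<open>A step shorter than this becomes shorter than d under F, as the covering of
        the image requires.\<close>
      have "d / (\<bar>L\<bar> + 1) > 0" using d by simp
      then obtain h where h: "0 < \<bar>h\<bar>" "\<bar>h\<bar> < d / (\<bar>L\<bar> + 1)" "(F (x + h) - F x) / h > q"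
        using bad_slopes_small(2)[of x F 1 p q "d / (\<bar>L\<bar> + 1)"] x(1) unfolding B_def by auto
      define l where "l = F (x + h) - F x"
      have "\<bar>l\<bar> \<le> L * \<bar>h\<bar>" using lip[of "x + h" x] by (simp add: l_def)
      also have "\<dots> \<le> (\<bar>L\<bar> + 1) * \<bar>h\<bar>" by (intro mult_right_mono) auto
      also have "\<dots> < d" using h(2) by (simp add: field_simps)
      finally have ld: "\<bar>l\<bar> < d" .
      have ql: "q * \<bar>h\<bar> \<le> \<bar>l\<bar> \<and> (l > 0 \<longleftrightarrow> h > 0)"
      proof (cases "h > 0")
        case True
        then have "l > q * h" using h(3) by (simp add: l_def field_simps)
        moreover have "q * h > 0" using True \<open>p \<ge> 1\<close> pq by simp
        ultimately show ?thesis using True by simp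
      next
        case False
        then have "l < q * h" using h(1,3) by (simp add: l_def field_simps)
        moreover have "q * h < 0" using False h(1) \<open>p \<ge> 1\<close> pq by (simp add: mult_less_0_iff)
        ultimately show ?thesis using False by simp
      qed
      have qp: "q > 0" using True pq by simp
      have l0: "\<bar>l\<bar> > 0" using ql h(1) qp by (metis abs_ge_zero mult_pos_pos less_le_trans)
      have "G (y + l / 2 + \<bar>l\<bar> / 2) - G (y + l / 2 - \<bar>l\<bar> / 2) = \<bar>h\<bar>"
      proof (cases "l > 0")
        case True then show ?thesis using ql GF[of "x + h"] GF[of x] by (simp add: l_def x)
      next
        case False
        then have e: "y + l / 2 + \<bar>l\<bar> / 2 = y" "y + l / 2 - \<bar>l\<bar> / 2 = y + l" by auto
        have "G y = x" "G (y + l) = x + h" using GF by (simp_all add: x(2) l_def)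
        then show ?thesis unfolding e using False ql h(1) by auto
      qed
      also have "\<dots> \<le> 1 / q * (2 * (\<bar>l\<bar> / 2))" using ql qp by (simp add: field_simps)
      finally show "\<exists>a r. 0 < r \<and> r < d \<and> y \<in> cball a r \<and> G (a + r) - G (a - r) \<le> 1 / q * (2 * r)"
        using ld l0 by (intro exI[of _ "y + l / 2"] exI[of _ "\<bar>l\<bar> / 2"]) (auto simp: dist_real_def)
    qed (use Eb GFE True pq in auto)
    define a b where "a = measure lebesgue ?E" and "b = measure lebesgue (F ` ?E)"
    have ab: "emeasure lebesgue ?E = ennreal a" "emeasure lebesgue (F ` ?E) = ennreal b" "a \<ge> 0" "b \<ge> 0"
      unfolding a_def b_def by (rule emeasure_eq_measure2[OF E], rule emeasure_eq_measure2[OF FEm], rule measure_nonneg, rule measure_nonneg)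
    have "b \<le> p * a" using 1[unfolded ab(1,2)] ab(3,4) True by (simp add: ennreal_mult[symmetric])
    moreover have "a \<le> b / q" using 2[unfolded GFE ab(1,2)] ab(3,4) True pq by (simp add: ennreal_mult[symmetric])
    ultimately have "q * a \<le> p * a" using True pq by (simp add: field_simps)
    then have "a = 0" using pq ab(3) by (metis less_eq_real_def mult_right_le_imp_le not_less)
    then have "emeasure lebesgue ?E = 0" unfolding ab(1) by simp
    then show ?thesis using negligible_iff_emeasure0[OF fmeasurableD[OF E]] by blast
  qed
  then have "negligible (\<Union>m. B \<inter> ball 0 (real m))" by (intro negligible_countable_Union[of "range _", simplified]) auto
  moreover have "(\<Union>m. B \<inter> ball 0 (real m)) = B"
    using reals_Archimedean2 by (auto simp: dist_real_def)
  ultimately show ?thesis by (simp add: B_def)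
qed

lemma negligible_bad_slopes:
  fixes F :: "real \<Rightarrow> real"
  assumes lip: "\<And>x y. \<bar>F x - F y\<bar> \<le> L * \<bar>x - y\<bar>" and pq: "p < q"
  shows "negligible (bad_slopes F 1 p q)"
proof -
  \<comment> \<open>With this c all slopes of F x + c x are at least 1.\<close>
  define c where "c = L + 1"
  have "negligible (bad_slopes (\<lambda>x. F x + c * x) 1 (p + c) (q + c))"
  proof (rule negligible_bad_slopes_increasing)
    fix x y :: real assume "x \<le> y"
    then show "y - x \<le> F y + c * y - (F x + c * x)"
      using lip[of y x] by (simp add: c_def algebra_simps abs_le_iff)
  next
    fix x y :: real
    have "\<bar>F x + c * x - (F y + c * y)\<bar> \<le> \<bar>F x - F y\<bar> + \<bar>c\<bar> * \<bar>x - y\<bar>"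
    proof -
      have "F x + c * x - (F y + c * y) = (F x - F y) + c * (x - y)" by (simp add: algebra_simps)
      then show ?thesis using abs_triangle_ineq[of "F x - F y" "c * (x - y)"] by (simp add: abs_mult)
    qed
    also have "\<dots> \<le> (L + \<bar>c\<bar>) * \<bar>x - y\<bar>" using lip[of x y] by (simp add: algebra_simps)
    finally show "\<bar>F x + c * x - (F y + c * y)\<bar> \<le> (L + \<bar>c\<bar>) * \<bar>x - y\<bar>" .
  qed (use pq in simp)
  then show ?thesis by (simp only: bad_slopes_shear)
qed

text \<open>Fubini for the line parameter t and the base point: integrating over t first gives 0,
  integrating over the point first gives the measure of \<open>N\<close> for every t, by translation
  invariance. So that measure times infinity is 0. No coordinates adapted to \<open>e\<close>
  enter.\<close>

lemma null_if_null_on_lines: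
  fixes N :: "'a::euclidean_space set"
  assumes N: "N \<in> sets borel" and lines: "\<And>x. {t. x + t *\<^sub>R e \<in> N} \<in> null_sets lborel"
  shows "N \<in> null_sets lborel"
proof -
  define S where "S = {p. snd p + fst p *\<^sub>R e \<in> N}"
  have cont: "continuous_on UNIV (\<lambda>p::real \<times> 'a. snd p + fst p *\<^sub>R e)" by (intro continuous_intros)
  have "S = (\<lambda>p. snd p + fst p *\<^sub>R e) -` N \<inter> space borel" by (auto simp: S_def)
  then have "S \<in> sets borel" using measurable_sets[OF borel_measurable_continuous_onI[OF cont] N] by simp
  moreover have "sets (lborel \<Otimes>\<^sub>M lborel :: (real \<times> 'a) measure) = sets (borel \<Otimes>\<^sub>M borel)"
    by (intro sets_pair_measure_cong sets_lborel)
  ultimately have S: "S \<in> sets (lborel \<Otimes>\<^sub>M lborel)" by (simp only: borel_prod)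
  have "emeasure (lborel \<Otimes>\<^sub>M lborel) S = (\<integral>\<^sup>+x. emeasure lborel ((\<lambda>t. (t, x)) -` S) \<partial>lborel)"
    by (rule lborel_pair.emeasure_pair_measure_alt2[OF S])
  also have "\<dots> = (\<integral>\<^sup>+x. 0 \<partial>(lborel :: 'a measure))"
    using lines by (intro nn_integral_cong) (auto simp: S_def vimage_def)
  finally have z: "emeasure (lborel \<Otimes>\<^sub>M lborel) S = 0" by simp
  have "emeasure (lborel \<Otimes>\<^sub>M lborel) S = (\<integral>\<^sup>+t. emeasure lborel (Pair t -` S) \<partial>lborel)"
    by (rule lborel.emeasure_pair_measure_alt[OF S])
  also have "\<dots> = (\<integral>\<^sup>+t. emeasure lborel N \<partial>(lborel :: real measure))"
  proof (intro nn_integral_cong)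
    fix t :: real
    have "emeasure lborel N = emeasure (distr lborel borel ((+) (t *\<^sub>R e))) N" by (simp add: lborel_distr_plus)
    also have "\<dots> = emeasure lborel ((+) (t *\<^sub>R e) -` N \<inter> space lborel)" using N by (intro emeasure_distr) auto
    also have "(+) (t *\<^sub>R e) -` N \<inter> space lborel = Pair t -` S" by (auto simp: S_def add.commute)
    finally show "emeasure lborel (Pair t -` S) = emeasure lborel N" by simp
  qed
  also have "\<dots> = emeasure lborel N * \<infinity>" by simp
  finally have "emeasure lborel N * \<infinity> = 0" using z by simp
  then have "emeasure lborel N = 0" by simp
  then show ?thesis using N by auto
qed

lemma lipschitz_abs_continuous_on:
  fixes F :: "'a::real_normed_vector \<Rightarrow> real"
  assumes "\<And>x y. \<bar>F x - F y\<bar> \<le> L * norm (x - y)"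
  shows "continuous_on UNIV F"
proof (rule lipschitz_on_continuous_on[of "\<bar>L\<bar>"])
  show "\<bar>L\<bar>-lipschitz_on UNIV F"
    using order_trans[OF assms mult_right_mono[OF abs_ge_self norm_ge_zero]]
    by (intro lipschitz_onI) (auto simp: dist_norm)
qed

lemma AE_directional_derivative:
  fixes F :: "'a::euclidean_space \<Rightarrow> real"
  assumes lip: "\<And>x y. \<bar>F x - F y\<bar> \<le> L * norm (x - y)"
  shows "AE x in lborel. \<exists>l. ((\<lambda>h. (F (x + h *\<^sub>R e) - F x) / h) \<longlongrightarrow> l) (at 0)"
proof -
  note cont = lipschitz_abs_continuous_on[OF lip]
  have "AE x in lborel. \<forall>p\<in>\<rat>. \<forall>q\<in>\<rat>. p < q \<longrightarrow> x \<notin> bad_slopes F e p q"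
  proof (intro AE_ball_countable[THEN iffD2] countable_rat ballI)
    fix p q :: real
    show "AE x in lborel. p < q \<longrightarrow> x \<notin> bad_slopes F e p q"
    proof (cases "p < q")
      case True
      have "bad_slopes F e p q \<in> null_sets lborel"
      proof (rule null_if_null_on_lines[OF borel_bad_slopes[OF cont]])
        fix x
        have eq: "{t. x + t *\<^sub>R e \<in> bad_slopes F e p q} = bad_slopes (\<lambda>t. F (x + t *\<^sub>R e)) 1 p q"
          by (auto simp: bad_slopes_def algebra_simps)
        have lip1: "\<bar>F (x + s *\<^sub>R e) - F (x + t *\<^sub>R e)\<bar> \<le> (L * norm e) * \<bar>s - t\<bar>" for s t
          using lip[of "x + s *\<^sub>R e" "x + t *\<^sub>R e"] by (simp add: scaleR_diff_left[symmetric] ac_simps)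
        then have "negligible (bad_slopes (\<lambda>t. F (x + t *\<^sub>R e)) 1 p q)"
          by (rule negligible_bad_slopes) (rule True)
        moreover have "bad_slopes (\<lambda>t. F (x + t *\<^sub>R e)) 1 p q \<in> sets borel"
          by (intro borel_bad_slopes lipschitz_abs_continuous_on[of _ "L * norm e"]) (use lip1 in simp)
        ultimately show "{t. x + t *\<^sub>R e \<in> bad_slopes F e p q} \<in> null_sets lborel"
          unfolding eq by (simp add: negligible_iff_null_sets null_sets_completion_iff)
      qed
      then show ?thesis by (auto intro: AE_not_in)
    qed auto
  qed
  then show ?thesis
    by eventually_elim (rule derivative_exists_or_bad[OF lip], blast)
qed

lemma lborel_integral_translation:
  fixes g :: "'a::euclidean_space \<Rightarrow> real"
  assumes g: "g \<in> borel_measurable borel"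
  shows "(\<integral>x. g (x + c) \<partial>lborel) = (\<integral>x. g x \<partial>lborel)"
proof -
  have "(\<integral>x. g x \<partial>lborel) = (\<integral>x. g x \<partial>(distr lborel borel ((+) c)))" by (simp add: lborel_distr_plus)
  also have "\<dots> = (\<integral>x. g (c + x) \<partial>lborel)" by (rule integral_distr) (use g in auto)
  finally show ?thesis by (simp add: add.commute)
qed

lemma AE_not_in_frontier_box: "AE x in lborel. x \<notin> frontier (box a b :: 'a::euclidean_space set)"
proof -
  have "frontier (box a b) \<subseteq> cbox a b - box a b"
    unfolding frontier_def using closure_minimal[OF box_subset_cbox closed_cbox, of a b]
    by (auto simp: interior_open[OF open_box])
  then have "negligible (frontier (box a b))" by (rule negligible_subset[OF negligible_frontier_interval])
  then have "frontier (box a b) \<in> null_sets lborel"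
    by (simp add: negligible_iff_null_sets null_sets_completion_iff)
  then show ?thesis by (rule AE_not_in)
qed

section \<open>Directional derivatives depend linearly on the direction almost everywhere\<close>

definition dir_quot :: "('a::real_normed_vector \<Rightarrow> real) \<Rightarrow> 'a \<Rightarrow> nat \<Rightarrow> 'a \<Rightarrow> real" where
  "dir_quot F e k x = (F (x + inverse (real (Suc k)) *\<^sub>R e) - F x) / inverse (real (Suc k))"

text \<open>A limit along one sequence, hence Borel measurable. It is the directional derivative
  wherever that exists, which is almost everywhere; its other values are immaterial.\<close>

definition dir_deriv :: "('a::real_normed_vector \<Rightarrow> real) \<Rightarrow> 'a \<Rightarrow> 'a \<Rightarrow> real" where
  "dir_deriv F e x = lim (\<lambda>k. dir_quot F e k x)"

lemma dir_quot_tendsto: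
  assumes "((\<lambda>h. (F (x + h *\<^sub>R e) - F x) / h) \<longlongrightarrow> l) (at 0)"
  shows "(\<lambda>k. dir_quot F e k x) \<longlonglongrightarrow> l"
proof -
  have "filterlim (\<lambda>k. inverse (real (Suc k))) (at 0) sequentially"
    using LIMSEQ_inverse_real_of_nat by (auto simp: filterlim_at simp del: of_nat_Suc)
  from filterlim_compose[OF assms this] show ?thesis by (simp add: dir_quot_def)
qed

lemma dir_deriv_eq:
  assumes "((\<lambda>h. (F (x + h *\<^sub>R e) - F x) / h) \<longlongrightarrow> l) (at 0)"
  shows "dir_deriv F e x = l"
  unfolding dir_deriv_def by (rule limI[OF dir_quot_tendsto[OF assms]])

context
  fixes F :: "'a::euclidean_space \<Rightarrow> real" and L :: real
  assumes lip: "\<And>x y. \<bar>F x - F y\<bar> \<le> L * norm (x - y)"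
begin

lemma AE_dir_deriv:
  "AE x in lborel. ((\<lambda>h. (F (x + h *\<^sub>R e) - F x) / h) \<longlongrightarrow> dir_deriv F e x) (at 0)"
  using AE_directional_derivative[OF lip, of e] by eventually_elim (use dir_deriv_eq in metis)

lemma borel_dir_quot [measurable]: "dir_quot F e k \<in> borel_measurable borel"
  unfolding dir_quot_def[abs_def]
  by (intro borel_measurable_continuous_onI continuous_intros
      continuous_on_compose2[OF lipschitz_abs_continuous_on[OF lip]]) auto

lemma borel_dir_deriv [measurable]: "dir_deriv F e \<in> borel_measurable borel"
  unfolding dir_deriv_def[abs_def] by (rule borel_measurable_lim_metric) (rule borel_dir_quot)

lemma dir_quot_bound: "\<bar>dir_quot F e k x\<bar> \<le> L * norm e"
proof -
  let ?t = "inverse (real (Suc k))"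
  have t: "?t > 0" by simp
  have "\<bar>F (x + ?t *\<^sub>R e) - F x\<bar> \<le> (L * norm e) * ?t"
    using lip[of "x + ?t *\<^sub>R e" x] t by (simp add: ac_simps)
  then show ?thesis using t unfolding dir_quot_def abs_divide
    by (simp add: divide_le_eq del: of_nat_Suc)
qed

lemma dir_deriv_bound:
  assumes "((\<lambda>h. (F (x + h *\<^sub>R e) - F x) / h) \<longlongrightarrow> dir_deriv F e x) (at 0)"
  shows "\<bar>dir_deriv F e x\<bar> \<le> L * norm e"
  by (rule tendsto_upperbound[OF tendsto_rabs[OF dir_quot_tendsto[OF assms]]])
    (auto simp: dir_quot_bound)

lemma integral_box_dir_quot:
  "(\<lambda>k. \<integral>x. indicator (box a b) x * dir_quot F e k x \<partial>lborel)
    \<longlonglongrightarrow> (\<integral>x. indicator (box a b) x * dir_deriv F e x \<partial>lborel)"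
proof (rule integral_dominated_convergence[where w = "\<lambda>x. indicator (box a b) x * (L * norm e)"])
  show "integrable lborel (\<lambda>x. indicator (box a b) x * (L * norm e))"
    by (intro integrable_mult_left integrable_real_indicator) (auto simp: emeasure_lborel_box_eq)
  show "AE x in lborel. (\<lambda>k. indicator (box a b) x * dir_quot F e k x) \<longlonglongrightarrow> indicator (box a b) x * dir_deriv F e x"
    using AE_dir_deriv[of e] by eventually_elim (intro tendsto_mult_left dir_quot_tendsto)
qed (auto simp: indicator_def dir_quot_bound)

text \<open>A change of variable moves the shift from the difference quotient to the box, and the
  shifted indicators converge off the frontier of the box, a null set.\<close>

lemma integral_box_shifted_dir_quot:
  "(\<lambda>k. \<integral>x. indicator (box a b) x * dir_quot F e k (x + inverse (real (Suc k)) *\<^sub>R e') \<partial>lborel)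
    \<longlonglongrightarrow> (\<integral>x. indicator (box a b) x * dir_deriv F e x \<partial>lborel)"
proof -
  let ?t = "\<lambda>k. inverse (real (Suc k))"
  obtain M where M: "M > 0" "\<And>x. x \<in> box a b \<Longrightarrow> norm x \<le> M"
    using bounded_box[of a b] by (auto simp: bounded_pos)
  \<comment> \<open>Contains all the shifted boxes, as the shifts have norm at most |e'|; it
    supports the dominating function.\<close>
  define R where "R = cball (0::'a) (M + norm e')"
  have "(\<integral>x. indicator (box a b) x * dir_quot F e k (x + ?t k *\<^sub>R e') \<partial>lborel)
      = (\<integral>x. indicator (box a b) (x - ?t k *\<^sub>R e') * dir_quot F e k x \<partial>lborel)" for k
  proof -
    have "(\<integral>x. indicator (box a b) x * dir_quot F e k (x + ?t k *\<^sub>R e') \<partial>lborel)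
      = (\<integral>x. (\<lambda>x. indicator (box a b) (x - ?t k *\<^sub>R e') * dir_quot F e k x) (x + ?t k *\<^sub>R e') \<partial>lborel)" by simp
    also have "\<dots> = (\<integral>x. indicator (box a b) (x - ?t k *\<^sub>R e') * dir_quot F e k x \<partial>lborel)"
      by (rule lborel_integral_translation) measurable
    finally show ?thesis .
  qed
  moreover have "(\<lambda>k. \<integral>x. indicator (box a b) (x - ?t k *\<^sub>R e') * dir_quot F e k x \<partial>lborel)
    \<longlonglongrightarrow> (\<integral>x. indicator (box a b) x * dir_deriv F e x \<partial>lborel)"
  proof (rule integral_dominated_convergence[where w = "\<lambda>x. indicator R x * (L * norm e)"])
    show "integrable lborel (\<lambda>x. indicator R x * (L * norm e))"
      by (intro integrable_mult_left integrable_real_indicator) (use emeasure_bounded_finite[OF bounded_cball, of "0::'a" "M + norm e'"] in \<open>auto simp: R_def\<close>)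
    have fr: "AE x in lborel. x \<notin> frontier (box a b)"
      by (rule AE_not_in_frontier_box)
    show "AE x in lborel. (\<lambda>k. indicator (box a b) (x - ?t k *\<^sub>R e') * dir_quot F e k x) \<longlonglongrightarrow> indicator (box a b) x * dir_deriv F e x"
      using AE_dir_deriv[of e] fr
    proof eventually_elim
      case (elim x)
      have "(\<lambda>k. x - ?t k *\<^sub>R e') \<longlonglongrightarrow> x - 0 *\<^sub>R e'" by (intro tendsto_intros LIMSEQ_inverse_real_of_nat)
      moreover have "isCont (indicator (box a b) :: 'a \<Rightarrow> real) x"
        using elim(2) by (simp add: isCont_indicator)
      ultimately have "(\<lambda>k. indicator (box a b) (x - ?t k *\<^sub>R e') :: real) \<longlonglongrightarrow> indicator (box a b) x"
        by (intro isCont_tendsto_compose[of _ "indicator (box a b) :: 'a \<Rightarrow> real"]) simp_all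
      then show ?case using dir_quot_tendsto[OF elim(1)] by (rule tendsto_mult)
    qed
    fix k
    show "AE x in lborel. norm (indicator (box a b) (x - ?t k *\<^sub>R e') * dir_quot F e k x) \<le> indicator R x * (L * norm e)"
    proof (rule AE_I2)
      fix x
      have "x \<in> R" if "x - ?t k *\<^sub>R e' \<in> box a b"
      proof -
        have "norm x \<le> norm (x - ?t k *\<^sub>R e') + norm (?t k *\<^sub>R e')"
          using norm_triangle_sub[of x "?t k *\<^sub>R e'"] by (simp add: add.commute)
        also have "norm (?t k *\<^sub>R e') \<le> 1 * norm e'"
          unfolding norm_scaleR by (intro mult_right_mono) (auto simp: inverse_le_1_iff)
        finally show ?thesis using M(2)[OF that] by (simp add: R_def)
      qed
      then show "norm (indicator (box a b) (x - ?t k *\<^sub>R e') * dir_quot F e k x) \<le> indicator R x * (L * norm e)"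
        using dir_quot_bound[of e k x] order_trans[OF abs_ge_zero dir_quot_bound[of e k x]] by (auto simp: indicator_def)
    qed
  qed measurable
  ultimately show ?thesis by simp
qed

lemma integrable_box_dir_quot: "integrable lborel (\<lambda>x. indicator (box a b) x * dir_quot F e k (x + c))"
proof (rule Bochner_Integration.integrable_bound[where f = "\<lambda>x. indicator (box a b) x * (L * norm e)"])
  show "integrable lborel (\<lambda>x. indicator (box a b) x * (L * norm e))"
    by (intro integrable_mult_left integrable_real_indicator) (auto simp: emeasure_lborel_box_eq)
  show "AE x in lborel. norm (indicator (box a b) x * dir_quot F e k (x + c)) \<le> norm (indicator (box a b) x * (L * norm e))"
    using dir_quot_bound[of e k] by (auto simp: indicator_def intro: order_trans[OF _ abs_ge_self])
qed measurable

text \<open>The quotient for e + e' is exactly the quotient for e plus the quotient for e' at a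
  point shifted along e. Under the integral over a box, the shift disappears in the limit.\<close>

lemma integral_box_dir_deriv_add:
  "(\<integral>x. indicator (box a b) x * dir_deriv F (e + e') x \<partial>lborel)
    = (\<integral>x. indicator (box a b) x * dir_deriv F e' x \<partial>lborel) + (\<integral>x. indicator (box a b) x * dir_deriv F e x \<partial>lborel)"
proof -
  have "dir_quot F (e + e') k x = dir_quot F e' k (x + inverse (real (Suc k)) *\<^sub>R e) + dir_quot F e k x" for k x
    by (simp add: dir_quot_def scaleR_right_distrib add.assoc[symmetric] diff_divide_distrib)
  then have "(\<integral>x. indicator (box a b) x * dir_quot F (e + e') k x \<partial>lborel)
      = (\<integral>x. indicator (box a b) x * dir_quot F e' k (x + inverse (real (Suc k)) *\<^sub>R e) \<partial>lborel)
        + (\<integral>x. indicator (box a b) x * dir_quot F e k x \<partial>lborel)" for k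
    using Bochner_Integration.integral_add[OF integrable_box_dir_quot[of a b e' k "inverse (real (Suc k)) *\<^sub>R e"]
        integrable_box_dir_quot[of a b e k 0]]
    by (simp add: distrib_left)
  then have "(\<lambda>k. \<integral>x. indicator (box a b) x * dir_quot F (e + e') k x \<partial>lborel)
    \<longlonglongrightarrow> (\<integral>x. indicator (box a b) x * dir_deriv F e' x \<partial>lborel) + (\<integral>x. indicator (box a b) x * dir_deriv F e x \<partial>lborel)"
    using tendsto_add[OF integral_box_shifted_dir_quot[of a b e' e] integral_box_dir_quot[of a b e]] by simp
  then show ?thesis using integral_box_dir_quot[of a b "e + e'"] LIMSEQ_unique by blast
qed

end

text \<open>For large c the function 1 + G/c is a nonnegative density that gives every box its
  volume. It therefore defines Lebesgue measure, and densities are unique almost everywhere.\<close>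

lemma AE_zero_if_box_integrals_zero:
  fixes G :: "'a::euclidean_space \<Rightarrow> real"
  assumes G: "G \<in> borel_measurable borel" and bd: "AE x in lborel. \<bar>G x\<bar> \<le> C"
    and int: "\<And>a b. (\<integral>x. indicator (box a b) x * G x \<partial>lborel) = 0"
  shows "AE x in lborel. G x = 0"
proof -
  define c where "c = \<bar>C\<bar> + 1"
  have c: "c > 0" by (simp add: c_def)
  define H where "H x = 1 + G x / c" for x
  have Hm[measurable]: "H \<in> borel_measurable borel" unfolding H_def using G by measurable
  have pos: "AE x in lborel. H x \<ge> 0"
    using bd by eventually_elim (auto simp: H_def c_def field_simps abs_le_iff)
  have intG: "integrable lborel (\<lambda>x. indicator (box a b) x * G x)" for a b
  proof (rule Bochner_Integration.integrable_bound[where f = "\<lambda>x. indicator (box a b) x * C"])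
    show "integrable lborel (\<lambda>x. indicator (box a b) x * C)"
      by (intro integrable_mult_left integrable_real_indicator) (auto simp: emeasure_lborel_box_eq)
    show "AE x in lborel. norm (indicator (box a b) x * G x) \<le> norm (indicator (box a b) x * C)"
      using bd by eventually_elim (auto simp: indicator_def)
    show "(\<lambda>x. indicator (box a b) x * G x) \<in> borel_measurable lborel" using G by measurable
  qed
  have int1: "integrable lborel (\<lambda>x. indicator (box a b) x :: real)" for a b :: 'a
    by (intro integrable_real_indicator) (auto simp: emeasure_lborel_box_eq)
  have "lborel = density lborel (\<lambda>x. ennreal (H x))"
  proof (rule lborel_eqI)
    fix l u :: 'a assume lu: "\<And>b. b \<in> Basis \<Longrightarrow> l \<bullet> b \<le> u \<bullet> b"
    have eq: "indicator (box l u) x * H x = indicator (box l u) x + indicator (box l u) x * G x / c" for x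
      by (simp add: H_def algebra_simps)
    have "emeasure (density lborel (\<lambda>x. ennreal (H x))) (box l u) = (\<integral>\<^sup>+x. ennreal (H x) * indicator (box l u) x \<partial>lborel)"
      by (rule emeasure_density) auto
    also have "\<dots> = (\<integral>\<^sup>+x. ennreal (indicator (box l u) x * H x) \<partial>lborel)"
      by (intro nn_integral_cong) (auto simp: indicator_def)
    also have "\<dots> = ennreal (\<integral>x. indicator (box l u) x * H x \<partial>lborel)"
    proof (rule nn_integral_eq_integral)
      show "integrable lborel (\<lambda>x. indicator (box l u) x * H x)"
        unfolding eq by (intro Bochner_Integration.integrable_add int1 integrable_divide_zero intG)
      show "AE x in lborel. 0 \<le> indicator (box l u) x * H x" using pos by eventually_elim simp
    qed
    also have "(\<integral>x. indicator (box l u) x * H x \<partial>lborel) = (\<integral>x. indicator (box l u) x \<partial>lborel) + (\<integral>x. indicator (box l u) x * G x \<partial>lborel) / c"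
      unfolding eq by (subst Bochner_Integration.integral_add[OF int1 integrable_divide_zero[OF intG]]) simp
    also have "\<dots> = measure lborel (box l u)" by (simp add: int)
    also have "\<dots> = (\<Prod>b\<in>Basis. (u - l) \<bullet> b)" using lu by (simp add: measure_lborel_box_eq)
    finally show "emeasure (density lborel (\<lambda>x. ennreal (H x))) (box l u) = (\<Prod>b\<in>Basis. (u - l) \<bullet> b)" .
  qed simp
  then have "density lborel (\<lambda>x. 1) = density lborel (\<lambda>x. ennreal (H x))" by (simp add: density_1)
  from sigma_finite_measure.density_unique[OF sigma_finite_lborel _ _ this] have "AE x in lborel. 1 = ennreal (H x)" by simp
  then show ?thesis using pos
    by eventually_elim (use c in \<open>auto simp: H_def ennreal_1[symmetric] ennreal_inj simp del: ennreal_1\<close>)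
qed

context
  fixes F :: "'a::euclidean_space \<Rightarrow> real" and L :: real
  assumes lip: "\<And>x y. \<bar>F x - F y\<bar> \<le> L * norm (x - y)"
begin

lemma integrable_box_dir_deriv: "integrable lborel (\<lambda>x. indicator (box a b) x * dir_deriv F e x)"
proof (rule Bochner_Integration.integrable_bound[where f = "\<lambda>x. indicator (box a b) x * (L * norm e)"])
  show "integrable lborel (\<lambda>x. indicator (box a b) x * (L * norm e))"
    by (intro integrable_mult_left integrable_real_indicator) (auto simp: emeasure_lborel_box_eq)
  show "AE x in lborel. norm (indicator (box a b) x * dir_deriv F e x) \<le> norm (indicator (box a b) x * (L * norm e))"
    using AE_dir_deriv[OF lip, of e]
    by eventually_elim (use dir_deriv_bound[OF lip] in \<open>auto simp: indicator_def intro: order_trans[OF _ abs_ge_self]\<close>)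
qed (use borel_dir_deriv[OF lip] in measurable)

lemma AE_dir_deriv_add: "AE x in lborel. dir_deriv F (e + e') x = dir_deriv F e' x + dir_deriv F e x"
proof -
  have "AE x in lborel. dir_deriv F (e + e') x - (dir_deriv F e' x + dir_deriv F e x) = 0"
  proof (rule AE_zero_if_box_integrals_zero)
    show "(\<lambda>x. dir_deriv F (e + e') x - (dir_deriv F e' x + dir_deriv F e x)) \<in> borel_measurable borel"
      using borel_dir_deriv[OF lip] by measurable
    show "AE x in lborel. \<bar>dir_deriv F (e + e') x - (dir_deriv F e' x + dir_deriv F e x)\<bar>
        \<le> L * norm (e + e') + (L * norm e' + L * norm e)"
      using AE_dir_deriv[OF lip, of e] AE_dir_deriv[OF lip, of e'] AE_dir_deriv[OF lip, of "e + e'"]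
    proof eventually_elim
      case (elim x)
      from dir_deriv_bound[OF lip elim(1)] dir_deriv_bound[OF lip elim(2)] dir_deriv_bound[OF lip elim(3)]
      show ?case by linarith
    qed
    fix a b
    have "(\<integral>x. indicator (box a b) x * (dir_deriv F (e + e') x - (dir_deriv F e' x + dir_deriv F e x)) \<partial>lborel)
      = (\<integral>x. indicator (box a b) x * dir_deriv F (e + e') x - (indicator (box a b) x * dir_deriv F e' x
          + indicator (box a b) x * dir_deriv F e x) \<partial>lborel)"
      by (simp add: algebra_simps)
    also have "\<dots> = 0"
      using integral_box_dir_deriv_add[OF lip, of a b e e']
      by (simp add: Bochner_Integration.integral_diff Bochner_Integration.integral_add integrable_box_dir_deriv)
    finally show "(\<integral>x. indicator (box a b) x * (dir_deriv F (e + e') x - (dir_deriv F e' x + dir_deriv F e x)) \<partial>lborel) = 0" .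
  qed
  then show ?thesis by simp
qed

lemma AE_dir_deriv_scale: "AE x in lborel. dir_deriv F (c *\<^sub>R e) x = c * dir_deriv F e x"
  using AE_dir_deriv[OF lip, of e]
proof eventually_elim
  case (elim x)
  show ?case
  proof (rule dir_deriv_eq)
    show "((\<lambda>h. (F (x + h *\<^sub>R c *\<^sub>R e) - F x) / h) \<longlongrightarrow> c * dir_deriv F e x) (at 0)"
    proof (cases "c = 0")
      case False
      have "((\<lambda>h. h * c) \<longlongrightarrow> 0 * c) (at 0)" by (intro tendsto_intros)
      then have "filterlim (\<lambda>h. h * c) (at 0) (at 0)"
        using False by (auto simp: filterlim_at eventually_at_filter)
      from tendsto_mult_left[OF filterlim_compose[OF elim this], of c] show ?thesis using False by simp
    qed simp
  qed
qed

lemma AE_dir_deriv_linear: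
  "AE x in lborel. dir_deriv F e x = (\<Sum>b\<in>Basis. dir_deriv F b x *\<^sub>R b) \<bullet> e"
proof -
  have fin: "AE x in lborel. dir_deriv F (\<Sum>b\<in>S. (e \<bullet> b) *\<^sub>R b) x = (\<Sum>b\<in>S. (e \<bullet> b) * dir_deriv F b x)"
    if "finite S" for S :: "'a set"
    using that
  proof (induction S rule: finite_induct)
    case empty
    show ?case using AE_dir_deriv_scale[of 0 0] by simp
  next
    case (insert b S)
    from insert(3) AE_dir_deriv_scale[of "e \<bullet> b" b]
      AE_dir_deriv_add[of "\<Sum>b\<in>S. (e \<bullet> b) *\<^sub>R b" "(e \<bullet> b) *\<^sub>R b"]
    show ?case by eventually_elim (use insert(1,2) in \<open>simp add: add.commute\<close>)
  qed
  have eq: "(\<Sum>b\<in>Basis. dir_deriv F b x *\<^sub>R b) \<bullet> e = (\<Sum>b\<in>Basis. (e \<bullet> b) * dir_deriv F b x)" for x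
    unfolding inner_sum_left by (intro sum.cong) (simp_all add: inner_commute mult.commute)
  from fin[OF finite_Basis] show ?thesis by (simp only: euclidean_representation eq)
qed

text \<open>The Lipschitz bound makes convergence uniform in the direction: finitely many directions
  of \<open>D\<close> form an \<eta>-net of the unit sphere, and moving to the nearest one costs at
  most (|L| + |g|) \<eta> per unit length.\<close>

lemma differentiable_if_dense_directions:
  assumes dense: "\<And>X. open X \<Longrightarrow> X \<noteq> {} \<Longrightarrow> \<exists>d\<in>D. d \<in> X"
    and lim: "\<And>e. e \<in> D \<Longrightarrow> ((\<lambda>h. (F (x + h *\<^sub>R e) - F x) / h) \<longlongrightarrow> g \<bullet> e) (at 0)"
  shows "(F has_derivative (\<lambda>h. g \<bullet> h)) (at x)"
  unfolding has_derivative_at_alt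
proof (intro conjI allI impI)
  fix \<epsilon> :: real assume "\<epsilon> > 0"
  define \<eta> where "\<eta> = \<epsilon> / (2 * (\<bar>L\<bar> + norm g + 1))"
  have K: "\<bar>L\<bar> + norm g + 1 > 0" by (simp add: add_nonneg_pos)
  then have \<eta>: "\<eta> > 0" "(\<bar>L\<bar> + norm g) * \<eta> \<le> \<epsilon> / 2" using \<open>\<epsilon> > 0\<close> by (auto simp: \<eta>_def field_simps)
  have "sphere 0 1 \<subseteq> (\<Union>e\<in>D. ball e \<eta>)"
  proof
    fix u :: 'a
    obtain d where "d \<in> D" "d \<in> ball u \<eta>" using dense[of "ball u \<eta>"] \<eta> by auto
    then show "u \<in> (\<Union>e\<in>D. ball e \<eta>)" by (auto simp: dist_commute)
  qed
  then obtain D' where D': "D' \<subseteq> D" "finite D'" "sphere 0 1 \<subseteq> (\<Union>e\<in>D'. ball e \<eta>)"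
    using compactE_image[OF compact_sphere, of D "\<lambda>e. ball e \<eta>" 0 1] by auto
  have "\<exists>d>0. \<forall>t. t \<noteq> 0 \<and> \<bar>t\<bar> < d \<longrightarrow> \<bar>(F (x + t *\<^sub>R e) - F x) / t - g \<bullet> e\<bar> < \<epsilon> / 2" if "e \<in> D'" for e
    using tendstoD[OF lim, of e "\<epsilon> / 2"] that D'(1) \<open>\<epsilon> > 0\<close>
    by (auto simp: eventually_at dist_real_def)
  then obtain \<delta> where \<delta>: "\<And>e. e \<in> D' \<Longrightarrow> \<delta> e > 0"
    "\<And>e t. e \<in> D' \<Longrightarrow> t \<noteq> 0 \<Longrightarrow> \<bar>t\<bar> < \<delta> e \<Longrightarrow> \<bar>(F (x + t *\<^sub>R e) - F x) / t - g \<bullet> e\<bar> < \<epsilon> / 2" by metis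
  define d where "d = Min (insert 1 (\<delta> ` D'))"
  have d: "d > 0" "\<And>e. e \<in> D' \<Longrightarrow> d \<le> \<delta> e" using D'(2) \<delta>(1) by (auto simp: d_def)
  show "\<exists>d>0. \<forall>y. norm (y - x) < d \<longrightarrow> norm (F y - F x - g \<bullet> (y - x)) \<le> \<epsilon> * norm (y - x)"
  proof (intro exI[of _ d] conjI allI impI d(1))
    fix y assume y: "norm (y - x) < d"
    show "norm (F y - F x - g \<bullet> (y - x)) \<le> \<epsilon> * norm (y - x)"
    proof (cases "y = x")
      case False
      define t where "t = norm (y - x)"
      define u where "u = (y - x) /\<^sub>R t"
      have t: "t > 0" "y = x + t *\<^sub>R u" "norm u = 1" using False by (auto simp: t_def u_def)
      obtain e where e: "e \<in> D'" "norm (u - e) < \<eta>" using D'(3) t(3) by (force simp: dist_norm norm_minus_commute)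
      have "\<bar>(F (x + t *\<^sub>R e) - F x) / t - g \<bullet> e\<bar> < \<epsilon> / 2"
        using \<delta>(2)[OF e(1), of t] d(2)[OF e(1)] t(1) y by (simp add: t_def)
      moreover have "(F (x + t *\<^sub>R e) - F x) / t - g \<bullet> e = (F (x + t *\<^sub>R e) - F x - t * (g \<bullet> e)) / t"
        using t(1) by (simp add: field_simps)
      ultimately have 1: "\<bar>F (x + t *\<^sub>R e) - F x - t * (g \<bullet> e)\<bar> \<le> \<epsilon> / 2 * t"
        using t(1) by (simp add: abs_divide field_simps)
      have "\<bar>F y - F (x + t *\<^sub>R e)\<bar> \<le> L * norm (t *\<^sub>R (u - e))"
        using lip[of y "x + t *\<^sub>R e"] by (simp add: t(2) scaleR_diff_right)
      also have "\<dots> \<le> \<bar>L\<bar> * (t * norm (u - e))" using t(1) by (simp add: mult_right_mono)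
      finally have 2: "\<bar>F y - F (x + t *\<^sub>R e)\<bar> \<le> \<bar>L\<bar> * (t * norm (u - e))" .
      have "\<bar>t * (g \<bullet> e) - g \<bullet> (y - x)\<bar> = t * \<bar>g \<bullet> (u - e)\<bar>"
        using t(1,2) by (simp add: inner_diff_right abs_mult[symmetric] abs_minus_commute right_diff_distrib
            abs_of_pos[symmetric] del: abs_of_pos) (metis abs_minus_commute abs_mult abs_of_pos right_diff_distrib')
      also have "\<dots> \<le> t * (norm g * norm (u - e))" using t(1) by (intro mult_left_mono Cauchy_Schwarz_ineq2) auto
      finally have 3: "\<bar>t * (g \<bullet> e) - g \<bullet> (y - x)\<bar> \<le> t * (norm g * norm (u - e))" .
      have "(\<bar>L\<bar> + norm g) * norm (u - e) \<le> (\<bar>L\<bar> + norm g) * \<eta>"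
        using e(2) by (intro mult_left_mono) auto
      then have "t * ((\<bar>L\<bar> + norm g) * norm (u - e)) \<le> t * (\<epsilon> / 2)" using t(1) \<eta>(2) by (intro mult_left_mono) auto
      moreover have "t * ((\<bar>L\<bar> + norm g) * norm (u - e)) = \<bar>L\<bar> * (t * norm (u - e)) + t * (norm g * norm (u - e))"
        by (simp add: algebra_simps)
      moreover have "F y - F x - g \<bullet> (y - x) = (F y - F (x + t *\<^sub>R e)) + (F (x + t *\<^sub>R e) - F x - t * (g \<bullet> e))
          + (t * (g \<bullet> e) - g \<bullet> (y - x))" by simp
      moreover have "\<bar>A + B + C\<bar> \<le> \<bar>A\<bar> + \<bar>B\<bar> + \<bar>C\<bar>" for A B C :: real by linarith
      moreover have "t * (\<epsilon> / 2) = \<epsilon> / 2 * t" "\<epsilon> / 2 * t + \<epsilon> / 2 * t = \<epsilon> * t" by simp_all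
      ultimately have "\<bar>F y - F x - g \<bullet> (y - x)\<bar> \<le> \<epsilon> * t"
        using 1 2 3 by (smt (verit))
      then show ?thesis by (simp add: t_def)
    qed simp
  qed
qed (rule bounded_linear_inner_right)

theorem rademacher: "AE x in lborel. F differentiable (at x)"
proof -
  obtain D :: "'a set" where D: "countable D" "\<And>X. open X \<Longrightarrow> X \<noteq> {} \<Longrightarrow> \<exists>d\<in>D. d \<in> X"
    by (rule countable_dense_setE) blast
  have "AE x in lborel. \<forall>e\<in>D. ((\<lambda>h. (F (x + h *\<^sub>R e) - F x) / h) \<longlongrightarrow> dir_deriv F e x) (at 0)
      \<and> dir_deriv F e x = (\<Sum>b\<in>Basis. dir_deriv F b x *\<^sub>R b) \<bullet> e"
    using AE_dir_deriv[OF lip] AE_dir_deriv_linear by (intro AE_ball_countable[THEN iffD2] D(1) ballI AE_conjI)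
  then show ?thesis
  proof eventually_elim
    case (elim x)
    have "(F has_derivative (\<lambda>h. (\<Sum>b\<in>Basis. dir_deriv F b x *\<^sub>R b) \<bullet> h)) (at x)"
    proof (rule differentiable_if_dense_directions[OF D(2)])
      fix e assume "e \<in> D"
      then show "((\<lambda>h. (F (x + h *\<^sub>R e) - F x) / h) \<longlongrightarrow> (\<Sum>b\<in>Basis. dir_deriv F b x *\<^sub>R b) \<bullet> e) (at 0)"
        using elim by metis
    qed
    then show ?case unfolding differentiable_def by blast
  qed
qed

end

lemma negligible_nondifferentiable_locally_lipschitz:
  fixes G :: "'a::euclidean_space \<Rightarrow> 'b::euclidean_space"
  assumes lip: "\<And>R. \<exists>L. L-lipschitz_on (cball 0 R) G"
  shows "negligible {x. \<not> G differentiable (at x)}"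
proof -
  have "negligible {x \<in> ball 0 (real m). \<not> (\<lambda>x. G x \<bullet> b) differentiable (at x)}" if b: "b \<in> Basis" for m b
  proof (cases "m = 0")
    case False
    let ?K = "cball (0::'a) (real m)"
    \<comment> \<open>Composition with the projection onto the ball extends the component to a
      globally Lipschitz function and leaves it unchanged in the ball.\<close>
    define F where "F x = G (closest_point ?K x) \<bullet> b" for x
    have K: "convex ?K" "closed ?K" "?K \<noteq> {}" by auto
    obtain L where L: "L-lipschitz_on ?K G" using lip by blast
    have "\<bar>F x - F y\<bar> \<le> L * norm (x - y)" for x y
    proof -
      have "\<bar>F x - F y\<bar> = \<bar>(G (closest_point ?K x) - G (closest_point ?K y)) \<bullet> b\<bar>" by (simp add: F_def inner_diff_left)
      also have "\<dots> \<le> norm (G (closest_point ?K x) - G (closest_point ?K y))" by (rule Basis_le_norm[OF b])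
      also have "\<dots> \<le> L * dist (closest_point ?K x) (closest_point ?K y)"
        using lipschitz_onD[OF L closest_point_in_set[OF K(2,3)] closest_point_in_set[OF K(2,3)]] by (simp add: dist_norm)
      also have "\<dots> \<le> L * dist x y"
        by (intro mult_left_mono closest_point_lipschitz K lipschitz_on_nonneg[OF L])
      finally show ?thesis by (simp add: dist_norm)
    qed
    from rademacher[OF this] obtain N where "{x. \<not> F differentiable (at x)} \<subseteq> N" "N \<in> null_sets lborel"
      unfolding eventually_ae_filter by auto
    then have "negligible {x. \<not> F differentiable (at x)}"
      by (meson negligible_iff_null_sets negligible_subset null_sets_completionI)
    moreover have "(\<lambda>x. G x \<bullet> b) differentiable (at x)" if "x \<in> ball 0 (real m)" "F differentiable (at x)" for x
    proof -
      from that(2) obtain F' where "(F has_derivative F') (at x)" unfolding differentiable_def by blast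
      from has_derivative_transform_within_open[OF this open_ball that(1), of "\<lambda>x. G x \<bullet> b"]
      have "((\<lambda>x. G x \<bullet> b) has_derivative F') (at x)" by (simp add: F_def closest_point_self)
      then show ?thesis unfolding differentiable_def by blast
    qed
    then have "{x \<in> ball 0 (real m). \<not> (\<lambda>x. G x \<bullet> b) differentiable (at x)} \<subseteq> {x. \<not> F differentiable (at x)}"
      by blast
    ultimately show ?thesis by (rule negligible_subset)
  qed simp
  then have "negligible (\<Union>m::nat. \<Union>b\<in>Basis. {x \<in> ball 0 (real m). \<not> (\<lambda>x. G x \<bullet> b) differentiable (at x)})"
    by (intro negligible_countable_Union[of "range _", simplified] negligible_Union) auto
  moreover have "{x. \<not> G differentiable (at x)} \<subseteq> (\<Union>m::nat. \<Union>b\<in>Basis. {x \<in> ball 0 (real m). \<not> (\<lambda>x. G x \<bullet> b) differentiable (at x)})"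
  proof
    fix x assume "x \<in> {x. \<not> G differentiable (at x)}"
    then obtain b where "b \<in> Basis" "\<not> (\<lambda>x. G x \<bullet> b) differentiable (at x)"
      using differentiable_componentwise_within[of G x UNIV] by auto
    moreover obtain m :: nat where "norm x < real m" using reals_Archimedean2 by blast
    ultimately show "x \<in> (\<Union>m::nat. \<Union>b\<in>Basis. {x \<in> ball 0 (real m). \<not> (\<lambda>x. G x \<bullet> b) differentiable (at x)})"
      by auto
  qed
  ultimately show ?thesis by (rule negligible_subset)
qed

subsection \<open>Contact points\<close>

text \<open>Lipschitz with respect to the base point x. If this holds at every point of a null set,
  its image is null; and it passes through products and compositions without tracking
  domains.\<close>

definition calm :: "('a::real_normed_vector \<Rightarrow> 'b::real_normed_vector) \<Rightarrow> 'a \<Rightarrow> bool" where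
  "calm G x \<longleftrightarrow> (\<exists>B. \<exists>d>0. \<forall>y. norm (y - x) < d \<longrightarrow> norm (G y - G x) \<le> B * norm (y - x))"

lemma calmI: "d > 0 \<Longrightarrow> (\<And>y. norm (y - x) < d \<Longrightarrow> norm (G y - G x) \<le> B * norm (y - x)) \<Longrightarrow> calm G x"
  unfolding calm_def by blast

lemma calmE:
  assumes "calm G x"
  obtains B d where "B \<ge> 0" "d > 0" "\<And>y. norm (y - x) < d \<Longrightarrow> norm (G y - G x) \<le> B * norm (y - x)"
proof -
  obtain B d where B: "d > 0" "\<And>y. norm (y - x) < d \<Longrightarrow> norm (G y - G x) \<le> B * norm (y - x)"
    using assms unfolding calm_def by blast
  show ?thesis
  proof (rule that[of "\<bar>B\<bar>", OF _ B(1)])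
    fix y assume "norm (y - x) < d"
    from B(2)[OF this] show "norm (G y - G x) \<le> \<bar>B\<bar> * norm (y - x)"
      by (rule order_trans) (intro mult_right_mono; simp)
  qed simp
qed

lemma calm_has_derivative:
  assumes "(G has_derivative G') (at x)"
  shows "calm G x"
proof -
  obtain d where d: "d > 0" "\<And>y. norm (y - x) < d \<Longrightarrow> norm (G y - G x - G' (y - x)) \<le> 1 * norm (y - x)"
    using assms unfolding has_derivative_at_alt by (meson zero_less_one)
  obtain K where K: "\<And>h. norm (G' h) \<le> norm h * K"
    using bounded_linear.bounded[OF has_derivative_bounded_linear[OF assms]] by blast
  show ?thesis
  proof (rule calmI[OF d(1), of _ _ "1 + K"])
    fix y assume "norm (y - x) < d"
    from d(2)[OF this] K[of "y - x"] norm_triangle_ineq[of "G y - G x - G' (y - x)" "G' (y - x)"]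
    show "norm (G y - G x) \<le> (1 + K) * norm (y - x)" by (simp add: algebra_simps)
  qed
qed

lemma calm_add:
  assumes "calm G x" "calm H x"
  shows "calm (\<lambda>y. G y + H y) x"
proof -
  obtain B d where B: "B \<ge> 0" "d > 0" "\<And>y. norm (y - x) < d \<Longrightarrow> norm (G y - G x) \<le> B * norm (y - x)"
    using calmE[OF assms(1)] by metis
  obtain B' d' where B': "B' \<ge> 0" "d' > 0" "\<And>y. norm (y - x) < d' \<Longrightarrow> norm (H y - H x) \<le> B' * norm (y - x)"
    using calmE[OF assms(2)] by metis
  show ?thesis
  proof (rule calmI[of "min d d'" _ _ "B + B'"])
    fix y assume "norm (y - x) < min d d'"
    then show "norm (G y + H y - (G x + H x)) \<le> (B + B') * norm (y - x)"
      using B(3)[of y] B'(3)[of y] norm_triangle_ineq[of "G y - G x" "H y - H x"] by (simp add: algebra_simps)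
  qed (use B B' in simp)
qed

lemma calm_bounded_linear:
  assumes "bounded_linear T" "calm G x"
  shows "calm (\<lambda>y. T (G y)) x"
proof -
  interpret bounded_linear T by fact
  obtain B d where B: "B \<ge> 0" "d > 0" "\<And>y. norm (y - x) < d \<Longrightarrow> norm (G y - G x) \<le> B * norm (y - x)"
    using calmE[OF assms(2)] by metis
  obtain K where K: "K \<ge> 0" "\<And>h. norm (T h) \<le> norm h * K" using nonneg_bounded by blast
  show ?thesis
  proof (rule calmI[OF B(2), of _ _ "B * K"])
    fix y assume "norm (y - x) < d"
    have "norm (T (G y) - T (G x)) \<le> norm (G y - G x) * K" using K(2)[of "G y - G x"] by (simp add: diff)
    also have "\<dots> \<le> (B * norm (y - x)) * K" using B(3)[OF \<open>norm (y - x) < d\<close>] K(1) by (rule mult_right_mono)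
    finally show "norm (T (G y) - T (G x)) \<le> B * K * norm (y - x)" by (simp add: ac_simps)
  qed
qed

lemma calm_diff: "calm G x \<Longrightarrow> calm H x \<Longrightarrow> calm (\<lambda>y. G y - H y) x"
  using calm_add[of G x "\<lambda>y. - H y"] calm_bounded_linear[OF bounded_linear_minus[OF bounded_linear_ident], of H x] by simp

lemma calm_bilinear:
  assumes "bounded_bilinear pr" "calm c x" "calm G x"
  shows "calm (\<lambda>y. pr (c y) (G y)) x"
proof -
  interpret bounded_bilinear pr by fact
  obtain M where M: "M \<ge> 0" "\<And>u v. norm (pr u v) \<le> norm u * norm v * M" using nonneg_bounded by blast
  obtain B d where B: "B \<ge> 0" "d > 0" "\<And>y. norm (y - x) < d \<Longrightarrow> norm (c y - c x) \<le> B * norm (y - x)"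
    using calmE[OF assms(2)] by metis
  obtain B' d' where B': "B' \<ge> 0" "d' > 0" "\<And>y. norm (y - x) < d' \<Longrightarrow> norm (G y - G x) \<le> B' * norm (y - x)"
    using calmE[OF assms(3)] by metis
  show ?thesis
  proof (rule calmI[of "min 1 (min d d')" _ _ "((norm (c x) + B) * B' + B * norm (G x)) * M"])
    fix y assume y: "norm (y - x) < min 1 (min d d')"
    have "norm (c y) \<le> norm (c x) + B * norm (y - x)"
      using B(3)[of y] y norm_triangle_sub[of "c y" "c x"] by simp
    also have "\<dots> \<le> norm (c x) + B * 1" using B(1) y by (intro add_left_mono mult_left_mono) auto
    finally have c: "norm (c y) \<le> norm (c x) + B" by simp
    have "pr (c y) (G y) - pr (c x) (G x) = pr (c y) (G y - G x) + pr (c y - c x) (G x)"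
      by (simp add: diff_left diff_right)
    then have "norm (pr (c y) (G y) - pr (c x) (G x)) \<le> norm (pr (c y) (G y - G x)) + norm (pr (c y - c x) (G x))"
      by (metis norm_triangle_ineq)
    also have "\<dots> \<le> norm (c y) * norm (G y - G x) * M + norm (c y - c x) * norm (G x) * M"
      by (intro add_mono M)
    also have "\<dots> \<le> (norm (c x) + B) * (B' * norm (y - x)) * M + (B * norm (y - x)) * norm (G x) * M"
      using c B(3)[of y] B'(3)[of y] y B(1) M(1) by (intro add_mono mult_mono mult_right_mono) auto
    finally show "norm (pr (c y) (G y) - pr (c x) (G x)) \<le> ((norm (c x) + B) * B' + B * norm (G x)) * M * norm (y - x)"
      by (simp add: algebra_simps)
  qed (use B B' in simp)
qed

lemmas calm_scaleR = calm_bilinear[OF bounded_bilinear_scaleR]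
  and calm_inner = calm_bilinear[OF bounded_bilinear_inner]

lemma calm_compose:
  assumes "calm H x" "calm G (H x)"
  shows "calm (\<lambda>y. G (H y)) x"
proof -
  obtain B d where B: "B \<ge> 0" "d > 0" "\<And>y. norm (y - x) < d \<Longrightarrow> norm (H y - H x) \<le> B * norm (y - x)"
    using calmE[OF assms(1)] by metis
  obtain B' d' where B': "B' \<ge> 0" "d' > 0" "\<And>y. norm (y - H x) < d' \<Longrightarrow> norm (G y - G (H x)) \<le> B' * norm (y - H x)"
    using calmE[OF assms(2)] by metis
  show ?thesis
  proof (rule calmI[of "min d (d' / (B + 1))" _ _ "B' * B"])
    fix y assume y: "norm (y - x) < min d (d' / (B + 1))"
    have 1: "norm (H y - H x) \<le> B * norm (y - x)" using B(3) y by simp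
    also have "\<dots> \<le> (B + 1) * norm (y - x)" by (intro mult_right_mono) auto
    also have "\<dots> < d'" using y B(1) by (simp add: field_simps)
    finally have "norm (G (H y) - G (H x)) \<le> B' * norm (H y - H x)" by (rule B'(3))
    also have "\<dots> \<le> B' * (B * norm (y - x))" using 1 B'(1) by (rule mult_left_mono)
    finally show "norm (G (H y) - G (H x)) \<le> B' * B * norm (y - x)" by (simp add: ac_simps)
  qed (use B B' in simp)
qed

lemma calm_lipschitz:
  assumes "L-lipschitz_on S G" "open T" "T \<subseteq> S" "x \<in> T"
  shows "calm G x"
proof -
  obtain d where d: "d > 0" "ball x d \<subseteq> T" using assms(2,4) by (meson openE)
  show ?thesis
  proof (rule calmI[OF d(1), of _ _ L])
    fix y assume "norm (y - x) < d"
    then have "y \<in> S" "x \<in> S" using d assms(3,4) by (auto simp: dist_norm norm_minus_commute)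
    then show "norm (G y - G x) \<le> L * norm (y - x)" using lipschitz_onD[OF assms(1)] by (simp add: dist_norm)
  qed
qed

text \<open>Every small slope \<open>q\<close> is attained by \<open>Dg\<close> at a minimum point of \<open>g - q \<bullet> x\<close>. As \<open>Dg\<close> maps
  null sets to null sets, these minimum points cannot all lie in a null set.\<close>

lemma contact_point_off_null_set:
  fixes g :: "'a::euclidean_space \<Rightarrow> real" and Dg :: "'a \<Rightarrow> 'a"
  assumes K: "compact K" and der: "\<And>x. x \<in> K \<Longrightarrow> (g has_derivative (\<lambda>h. Dg x \<bullet> h)) (at x)"
    and calm: "\<And>x. x \<in> K \<Longrightarrow> calm Dg x" and N: "negligible N" and d: "\<delta> > 0"
    and bdry: "\<And>x. x \<in> K \<Longrightarrow> x \<notin> interior K \<Longrightarrow> g x \<ge> 0" and neg: "x0 \<in> K" "g x0 < 0"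
  obtains q y where "norm q < \<delta>" "y \<in> interior K" "y \<notin> N" "g y < 0" "Dg y = q"
    "\<And>x. x \<in> K \<Longrightarrow> g x \<ge> g y + q \<bullet> (x - y)"
proof -
  obtain R where R: "R > 0" "\<And>x. x \<in> K \<Longrightarrow> norm x \<le> R"
    using compact_imp_bounded[OF K] by (auto simp: bounded_pos)
  \<comment> \<open>The second bound keeps the tilt q . (y - x0) below - g x0 in size. So a
    minimiser of the tilted function still has g < 0 and cannot lie on the boundary, where g \<ge>
    0.\<close>
  define d' where "d' = min \<delta> (- g x0 / (2 * R))"
  have d': "d' > 0" "d' \<le> \<delta>" "2 * R * d' \<le> - g x0"
    using d neg R(1) by (auto simp: d'_def field_simps min_def)
  have contg: "continuous_on K g"
    using der has_derivative_continuous continuous_at_imp_continuous_on by blast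
  have "\<exists>y. y \<in> interior K \<and> g y < 0 \<and> Dg y = q \<and> (\<forall>x\<in>K. g x \<ge> g y + q \<bullet> (x - y))" if q: "q \<in> ball 0 d'" for q
  proof -
    have "continuous_on K (\<lambda>x. g x - q \<bullet> x)" by (intro continuous_intros contg)
    then obtain y where y: "y \<in> K" "\<And>x. x \<in> K \<Longrightarrow> g y - q \<bullet> y \<le> g x - q \<bullet> x"
      using continuous_attains_inf[OF K] neg by blast
    have "\<bar>q \<bullet> (y - x0)\<bar> \<le> norm q * norm (y - x0)" by (rule Cauchy_Schwarz_ineq2)
    also have "\<dots> \<le> norm q * (2 * R)"
      using R(2)[OF y(1)] R(2)[OF neg(1)] norm_triangle_ineq4[of y x0] by (intro mult_left_mono) auto
    also have "\<dots> < d' * (2 * R)" using q R(1) by (intro mult_strict_right_mono) auto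
    finally have "\<bar>q \<bullet> (y - x0)\<bar> < - g x0" using d'(3) by (simp add: ac_simps)
    then have gy: "g y < 0" using y(2)[OF neg(1)] by (simp add: inner_diff_right abs_less_iff)
    then have yi: "y \<in> interior K" using bdry[OF y(1)] by force
    have "((\<lambda>x. g x - q \<bullet> x) has_derivative (\<lambda>h. Dg y \<bullet> h - q \<bullet> h)) (at y)"
      by (intro derivative_intros der y(1))
    from differential_zero_maxmin[OF yi open_interior this]
    have "(\<lambda>h. Dg y \<bullet> h - q \<bullet> h) = (\<lambda>v. 0)" using y(2) interior_subset by blast
    then have "(Dg y - q) \<bullet> (Dg y - q) = 0" by (metis inner_diff_left)
    then have "Dg y = q" by simp
    then show ?thesis using yi gy y(2) by (intro exI[of _ y]) (simp add: inner_diff_right algebra_simps)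
  qed
  then obtain Y where Y: "\<And>q. q \<in> ball 0 d' \<Longrightarrow> Y q \<in> interior K \<and> g (Y q) < 0 \<and> Dg (Y q) = q
      \<and> (\<forall>x\<in>K. g x \<ge> g (Y q) + q \<bullet> (x - Y q))" by metis
  have "\<exists>q\<in>ball 0 d'. Y q \<notin> N"
  proof (rule ccontr)
    assume all: "\<not> (\<exists>q\<in>ball 0 d'. Y q \<notin> N)"
    have "ball 0 d' \<subseteq> Dg ` (K \<inter> N)"
    proof
      fix q :: 'a assume q: "q \<in> ball 0 d'"
      then have "Y q \<in> K \<inter> N" using Y[OF q] all interior_subset by blast
      then show "q \<in> Dg ` (K \<inter> N)" using Y[OF q] by (metis image_eqI)
    qed
    moreover have "negligible (Dg ` (K \<inter> N))"
    proof (rule negligible_locally_Lipschitz_image)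
      show "negligible (K \<inter> N)" using N by (rule negligible_subset) auto
      fix x assume "x \<in> K \<inter> N"
      then obtain B e where "e > 0" "\<And>y. norm (y - x) < e \<Longrightarrow> norm (Dg y - Dg x) \<le> B * norm (y - x)"
        using calmE[OF calm] by (metis IntD1)
      then show "\<exists>T B. open T \<and> x \<in> T \<and> (\<forall>y\<in>(K \<inter> N) \<inter> T. norm (Dg y - Dg x) \<le> B * norm (y - x))"
        by (intro exI[of _ "ball x e"] exI[of _ B]) (auto simp: dist_norm norm_minus_commute)
    qed simp
    ultimately have "negligible (ball (0::'a) d')" by (rule negligible_subset[rotated])
    then show False using d'(1) open_not_negligible[OF open_ball, of "0::'a" d'] by auto
  qed
  then obtain q where q: "q \<in> ball 0 d'" "Y q \<notin> N" by blast
  show ?thesis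
    by (rule that[of q "Y q"]) (use Y[OF q(1)] q d'(2) in auto)
qed

text \<open>The mean value inequality along segments, applied to \<psi>, integrates the first-order
  expansion of Dw at x. The Lipschitz constant of Dw bounds its derivative and hence the quadratic
  form.\<close>

lemma jet2_of_grad_derivative:
  fixes w :: "real^'n \<Rightarrow> real"
  assumes der: "\<And>y. (w has_derivative (\<lambda>h. Dw y \<bullet> h)) (at y)" and diff: "Dw differentiable (at x)"
    and lip: "L-lipschitz_on (ball x d) Dw" "d > 0"
  obtains X where "transpose X = X" "jet2 w x (Dw x) X" "\<And>k. \<bar>k \<bullet> (X *v k)\<bar> \<le> L * (k \<bullet> k)"
proof -
  obtain H where H: "(Dw has_derivative H) (at x)" using diff unfolding differentiable_def by blast
  define M where "M = matrix H"
  have Hlin: "linear H" using has_derivative_bounded_linear[OF H] bounded_linear.linear by blast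
  have HM: "H k = M *v k" for k unfolding M_def by (simp add: matrix_works[OF linear_matrix_vector_mul_eq[THEN iffD2, OF Hlin]])
  \<comment> \<open>Symmetry of the derivative of Dw is not known at a single point; the quadratic
    form sees the symmetric part.\<close>
  define X where "X = (1/2) *\<^sub>R (M + transpose M)"
  have tX: "transpose X = X" by (simp add: X_def sym_matrix_simps add.commute)
  have X: "k \<bullet> (X *v k) = k \<bullet> H k" for k
  proof -
    have "k \<bullet> (transpose M *v k) = k \<bullet> (M *v k)"
      by (metis dot_lmul_matrix inner_commute transpose_matrix_vector)
    then show ?thesis by (simp add: X_def HM quad_form_simps inner_add_right)
  qed
  have "jet2 w x (Dw x) X"
    unfolding jet2_def smallo_nhds_iff
  proof (intro allI impI)
    fix e :: real assume "e > 0"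
    then obtain d1 where d1: "d1 > 0" "\<And>y. norm (y - x) < d1 \<Longrightarrow> norm (Dw y - Dw x - H (y - x)) \<le> e * norm (y - x)"
      using H unfolding has_derivative_at_alt by blast
    have "\<bar>w (x + k) - w x - Dw x \<bullet> k - k \<bullet> (X *v k) / 2\<bar> \<le> e * norm k ^ 2" if k: "norm k < d1" for k
    proof -
      define \<psi> where "\<psi> t = w (x + t *\<^sub>R k) - t * (Dw x \<bullet> k) - t\<^sup>2 / 2 * (k \<bullet> H k)" for t
      have d: "(\<psi> has_derivative (\<lambda>s. s * ((Dw (x + t *\<^sub>R k) - Dw x - H (t *\<^sub>R k)) \<bullet> k))) (at t within {0..1})" for t
      proof (rule has_derivative_at_withinI)
        have "((\<lambda>t. w (x + t *\<^sub>R k)) has_derivative (\<lambda>s. Dw (x + t *\<^sub>R k) \<bullet> (s *\<^sub>R k))) (at t)"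
          by (rule has_derivative_compose[of "\<lambda>t. x + t *\<^sub>R k" _ _ _ w, OF _ der]) (auto intro!: derivative_eq_intros)
        then show "(\<psi> has_derivative (\<lambda>s. s * ((Dw (x + t *\<^sub>R k) - Dw x - H (t *\<^sub>R k)) \<bullet> k))) (at t)"
          unfolding \<psi>_def
          by (auto intro!: derivative_eq_intros simp: fun_eq_iff linear_cmul[OF Hlin] inner_commute algebra_simps)
      qed
      have "norm (\<psi> 1 - \<psi> 0) \<le> (e * norm k ^ 2) * norm ((1::real) - 0)"
      proof (rule differentiable_bound[OF _ d])
        fix t :: real assume t: "t \<in> {0..1}"
        show "onorm (\<lambda>s. s * ((Dw (x + t *\<^sub>R k) - Dw x - H (t *\<^sub>R k)) \<bullet> k)) \<le> e * norm k ^ 2"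
        proof (rule onorm_le)
          fix s :: real
          have nt: "norm (t *\<^sub>R k) \<le> norm k" using t by (simp add: mult_left_le_one_le)
          then have "norm (Dw (x + t *\<^sub>R k) - Dw x - H (t *\<^sub>R k)) \<le> e * norm (t *\<^sub>R k)"
            using d1(2)[of "x + t *\<^sub>R k"] k by simp
          also have "\<dots> \<le> e * norm k" using nt \<open>e > 0\<close> by (intro mult_left_mono) auto
          finally have "norm (Dw (x + t *\<^sub>R k) - Dw x - H (t *\<^sub>R k)) * norm k \<le> e * norm k * norm k"
            by (rule mult_right_mono) simp
          then have "\<bar>(Dw (x + t *\<^sub>R k) - Dw x - H (t *\<^sub>R k)) \<bullet> k\<bar> \<le> e * norm k ^ 2"
            using Cauchy_Schwarz_ineq2[of "Dw (x + t *\<^sub>R k) - Dw x - H (t *\<^sub>R k)" k]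
            by (simp add: power2_eq_square mult.assoc)
          then show "norm (s * ((Dw (x + t *\<^sub>R k) - Dw x - H (t *\<^sub>R k)) \<bullet> k)) \<le> e * norm k ^ 2 * norm s"
            by (simp add: abs_mult mult.commute[of _ "\<bar>s\<bar>"] mult_left_mono)
        qed
      qed auto
      then show ?thesis by (simp add: \<psi>_def X)
    qed
    then show "\<forall>\<^sub>F k in nhds 0. \<bar>w (x + k) - w x - Dw x \<bullet> k - k \<bullet> (X *v k) / 2\<bar> \<le> e * norm k ^ 2"
      unfolding eventually_nhds_metric using d1(1) by (intro exI[of _ d1]) auto
  qed
  moreover have "\<bar>k \<bullet> (X *v k)\<bar> \<le> L * (k \<bullet> k)" for k
  proof -
    have "norm (H k) \<le> L * norm k"
    proof (rule field_le_epsilon)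
      fix e :: real assume "e > 0"
      define e' where "e' = e / (norm k + 1)"
      have k1: "norm k + 1 > 0" by (simp add: add_nonneg_pos)
      have e': "e' > 0" "e' * norm k \<le> e" using \<open>e > 0\<close> k1 by (auto simp: e'_def field_simps)
      obtain d1 where d1: "d1 > 0" "\<And>y. norm (y - x) < d1 \<Longrightarrow> norm (Dw y - Dw x - H (y - x)) \<le> e' * norm (y - x)"
        using H e'(1) unfolding has_derivative_at_alt by blast
      \<comment> \<open>Small enough for x + t k to lie in the Lipschitz ball and in the range of
        the derivative estimate.\<close>
      define t where "t = min d d1 / (norm k + 1)"
      have t: "t > 0" using lip(2) d1(1) k1 by (simp add: t_def)
      have tk: "t * norm k < min d d1"
      proof -
        have "t * norm k < t * (norm k + 1)" using t by simp
        also have "\<dots> = min d d1" using k1 by (simp add: t_def)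
        finally show ?thesis .
      qed
      have "norm (Dw (x + t *\<^sub>R k) - Dw x - H (t *\<^sub>R k)) \<le> e' * (t * norm k)"
        using d1(2)[of "x + t *\<^sub>R k"] tk t by simp
      moreover have "norm (Dw (x + t *\<^sub>R k) - Dw x) \<le> L * (t * norm k)"
        using lipschitz_onD[OF lip(1), of "x + t *\<^sub>R k" x] tk t lip(2) by (simp add: dist_norm)
      moreover have "norm (H (t *\<^sub>R k)) \<le> norm (Dw (x + t *\<^sub>R k) - Dw x) + norm (Dw (x + t *\<^sub>R k) - Dw x - H (t *\<^sub>R k))"
        using norm_triangle_ineq4[of "Dw (x + t *\<^sub>R k) - Dw x" "Dw (x + t *\<^sub>R k) - Dw x - H (t *\<^sub>R k)"] by simp
      moreover have "norm (H (t *\<^sub>R k)) = t * norm (H k)" using t by (simp add: linear_cmul[OF Hlin])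
      ultimately have "t * norm (H k) \<le> t * (L * norm k + e' * norm k)" by (simp add: algebra_simps)
      then show "norm (H k) \<le> L * norm k + e" using t e'(2) by simp
    qed
    have "\<bar>k \<bullet> H k\<bar> \<le> norm k * norm (H k)" by (rule Cauchy_Schwarz_ineq2)
    also have "\<dots> \<le> norm k * (L * norm k)" using \<open>norm (H k) \<le> L * norm k\<close> by (intro mult_left_mono) auto
    finally show ?thesis by (simp add: X dot_square_norm power2_eq_square ac_simps)
  qed
  ultimately show ?thesis using that tX by blast
qed

subsection \<open>Hopf lemma\<close>

lemma jet2_gaussian:
  fixes z :: "real^'n"
  shows "jet2 (\<lambda>x. exp (- a * (norm (x - z))\<^sup>2) - c) y
     ((- 2 * a * exp (- a * (norm (y - z))\<^sup>2)) *\<^sub>R (y - z))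
     (exp (- a * (norm (y - z))\<^sup>2) *\<^sub>R ((4 * a\<^sup>2) *\<^sub>R rank1 (y - z) - (2 * a) *\<^sub>R mat 1))"
proof -
  let ?t = "(norm (y - z))\<^sup>2" let ?e = "exp (- a * ?t)"
  have "taylor2 (\<lambda>t. exp (- a * t) - c) ?t (- a * ?e) (a\<^sup>2 * ?e)"
    by (rule taylor2_DERIV[of UNIV]) (auto intro!: derivative_eq_intros simp: power2_eq_square)
  from jet2_compose[OF jet2_norm_sq this]
  have "jet2 (\<lambda>x. exp (- a * (norm (x - z))\<^sup>2) - c) y ((- a * ?e) *\<^sub>R 2 *\<^sub>R (y - z))
      ((- a * ?e) *\<^sub>R 2 *\<^sub>R mat 1 + (a\<^sup>2 * ?e) *\<^sub>R rank1 (2 *\<^sub>R (y - z)))" .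
  moreover have "(a\<^sup>2 * ?e) *\<^sub>R rank1 (2 *\<^sub>R (y - z)) = (?e * (4 * a\<^sup>2)) *\<^sub>R rank1 (y - z)"
    by (simp add: rank1_def vec_eq_iff algebra_simps)
  ultimately show ?thesis by (simp add: scaleR_diff_right mult_ac)
qed

lemma gaussian_has_derivative:
  fixes z :: "'a::real_inner"
  shows "((\<lambda>x. exp (- a * (norm (x - z))\<^sup>2) - c) has_derivative
    (\<lambda>h. ((- 2 * a * exp (- a * (norm (y - z))\<^sup>2)) *\<^sub>R (y - z)) \<bullet> h)) (at y)"
  unfolding power2_norm_eq_inner
  by (auto intro!: derivative_eq_intros simp: fun_eq_iff inner_commute)

lemma gaussian_gradient_calm:
  fixes z :: "'a::real_inner"
  shows "calm (\<lambda>y. (- 2 * a * exp (- a * (norm (y - z))\<^sup>2)) *\<^sub>R (y - z)) y"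
proof -
  have "((\<lambda>y. (- 2 * a * exp (- a * (norm (y - z))\<^sup>2)) *\<^sub>R (y - z)) has_derivative
    (\<lambda>h. (- 2 * a * (exp (- a * (norm (y - z))\<^sup>2) * (- a * (2 * (h \<bullet> (y - z)))))) *\<^sub>R (y - z)
      + (- 2 * a * exp (- a * (norm (y - z))\<^sup>2)) *\<^sub>R h)) (at y)"
    unfolding power2_norm_eq_inner
    by (auto intro!: derivative_eq_intros simp: fun_eq_iff inner_commute)
  then show ?thesis by (rule calm_has_derivative)
qed

text \<open>The data kept from the problem for \<open>v\<close>. They are stable under translation,
  so that everything proved for spheres about the origin holds for all centres.\<close>

locale conformal_solution = conformal_equation f \<Gamma>
  for f :: "real^'n \<Rightarrow> real" and \<Gamma> :: "(real^'n) set" +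
  fixes w :: "real^'n \<Rightarrow> real" and Dw :: "real^'n \<Rightarrow> real^'n"
  assumes w_pos: "\<And>x. w x > 0"
    and w_super: "w_supersolution f \<Gamma> UNIV w" and w_sub: "w_subsolution f \<Gamma> UNIV w"
    and w_deriv: "\<And>x. (w has_derivative (\<lambda>h. Dw x \<bullet> h)) (at x)"
    and Dw_lip: "\<And>R. \<exists>L. L-lipschitz_on (cball 0 R) Dw"
begin

lemma cont_w: "continuous_on S w"
  using w_deriv has_derivative_continuous continuous_at_imp_continuous_on by blast

lemma calm_Dw: "calm Dw x"
proof -
  obtain L where "L-lipschitz_on (cball 0 (norm x + 1)) Dw" using Dw_lip by blast
  then show ?thesis by (rule calm_lipschitz[OF _ open_ball[of 0 "norm x + 1"]]) auto
qed

lemma cont_Dw: "continuous_on S Dw"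
proof -
  have "isCont Dw x" for x
  proof -
    obtain L where "L-lipschitz_on (cball 0 (norm x + 1)) Dw" using Dw_lip by blast
    then have "continuous_on (cball 0 (norm x + 1)) Dw" by (rule lipschitz_on_continuous_on)
    then show ?thesis by (rule continuous_on_interior) (auto simp: interior_cball)
  qed
  then show ?thesis by (simp add: continuous_at_imp_continuous_on)
qed

text \<open>The barrier \<open>exp (- a \<bar>x - z\<bar>\<^sup>2)\<close> has Hessian of order \<open>a\<^sup>2\<close> in the radial direction, against errors of
  order \<open>a\<close>; for large \<open>a\<close> this is what \<open>strict_ellipticity\<close> requires.\<close>

lemma hopf_comparison:
  fixes w2 :: "real^'n \<Rightarrow> real"
  defines "K \<equiv> \<lambda>z r. cball z r - ball z (r / 2)"
  assumes r: "r > 0" and sub: "w_subsolution f \<Gamma> (K z r) w2"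
    and der: "\<And>x. x \<in> K z r \<Longrightarrow> (w2 has_derivative (\<lambda>h. D2 x \<bullet> h)) (at x)"
    and calm2: "\<And>x. x \<in> K z r \<Longrightarrow> calm D2 x"
    and le: "\<And>x. x \<in> K z r \<Longrightarrow> w x \<le> w2 x"
    and less: "\<And>x. x \<in> sphere z (r / 2) \<Longrightarrow> w x < w2 x"
  obtains a c where "a > 0" "c > 0"
    "\<And>x. x \<in> K z r \<Longrightarrow> w2 x - w x \<ge> c * (exp (- a * (norm (x - z))\<^sup>2) - exp (- a * r\<^sup>2))"
proof -
  let ?K = "K z r"
  have cK: "compact ?K" unfolding K_def by (simp add: compact_diff)
  have Kd: "x \<in> ?K \<longleftrightarrow> norm (x - z) \<le> r \<and> r / 2 \<le> norm (x - z)" for x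
    by (auto simp: K_def dist_norm norm_minus_commute not_less)
  have ne: "?K \<noteq> {}"
  proof -
    obtain u :: "real^'n" where "norm u = r" using vector_choose_size[of r] r by auto
    then have "z + u \<in> ?K" using r by (simp add: Kd)
    then show ?thesis by blast
  qed
  have Kint: "x \<in> interior ?K" if "norm (x - z) < r" "r / 2 < norm (x - z)" for x
  proof -
    have "open (ball z r - cball z (r / 2))" by (intro open_Diff) auto
    moreover have "x \<in> ball z r - cball z (r / 2)" using that by (auto simp: dist_norm norm_minus_commute)
    moreover have "ball z r - cball z (r / 2) \<subseteq> ?K" by (auto simp: K_def)
    ultimately show ?thesis by (meson interiorI)
  qed
  obtain xm where xm: "xm \<in> ?K" "\<And>x. x \<in> ?K \<Longrightarrow> w xm \<le> w x"
    using continuous_attains_inf[OF cK ne cont_w] by blast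
  obtain xM where xM: "xM \<in> ?K" "\<And>x. x \<in> ?K \<Longrightarrow> w x \<le> w xM"
    using continuous_attains_sup[OF cK ne cont_w] by blast
  define wm wM where "wm = w xm" and "wM = w xM"
  have wm: "wm > 0" "\<And>x. x \<in> ?K \<Longrightarrow> wm \<le> w x" "\<And>x. x \<in> ?K \<Longrightarrow> w x \<le> wM" "wM > 0"
    using xm xM w_pos by (auto simp: wm_def wM_def)
  have "bounded (Dw ` ?K)" using compact_continuous_image[OF cont_Dw cK] by (rule compact_imp_bounded)
  then obtain P where P: "P > 0" "\<And>x. x \<in> ?K \<Longrightarrow> norm (Dw x) \<le> P" by (auto simp: bounded_pos)
  obtain R where R: "R > 0" "\<And>x. x \<in> ?K \<Longrightarrow> norm x \<le> R" using compact_imp_bounded[OF cK] by (auto simp: bounded_pos)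
  obtain L where L: "L-lipschitz_on (cball 0 (R + 1)) Dw" using Dw_lip by blast
  then have L0: "L \<ge> 0" by (rule lipschitz_on_nonneg)
  \<comment> \<open>Bounds the form w X - |p|^2 / 2, and thus the spectrum of \<open>A\<close>, on
    the whole annulus.\<close>
  define C0 where "C0 = wM * L + P\<^sup>2 / 2"
  obtain \<kappa> where \<kappa>: "\<kappa> > 0"
    "\<And>A B N e. \<lbrakk>transpose A = A; transpose B = B; \<And>i. \<bar>eigvals A $ i\<bar> \<le> C0; eigvals A \<in> closure \<Gamma>;
       f (eigvals A) \<ge> 1; 0 < N; N \<le> 1; norm e = 1;
       \<And>x. x \<bullet> (A *v x) + N * (e \<bullet> x)\<^sup>2 - \<kappa> * N * (x \<bullet> x) \<le> x \<bullet> (B *v x)\<rbrakk>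
      \<Longrightarrow> eigvals B \<in> \<Gamma> \<and> f (eigvals B) > 1"
    using strict_ellipticity[of C0] by blast
  \<comment> \<open>The errors will be at most \<open>C1\<close> times a E, with E the value of c
    times the Gaussian at the contact point. The terms come from \<tau> X, from the part -2a of the
    barrier Hessian, and from the linear and the quadratic change of |p|^2 / 2.\<close>
  define C1 where "C1 = L + 2 * (wM + 1) + P * (2 * r + 1) + (2 * r + 1)\<^sup>2 / 2"
  have C1: "C1 > 0" using L0 wm(4) P(1) r by (auto simp: C1_def intro!: add_pos_nonneg add_nonneg_pos)
  \<comment> \<open>The gain is of order a^2 E and the errors of order a E; as |x - z| \<ge> r/2 in
    the annulus, this a makes the errors at most \<kappa> times the gain.\<close>
  define a where "a = max 1 (C1 / (\<kappa> * wm * r\<^sup>2))"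
  have a: "a \<ge> 1" "C1 \<le> \<kappa> * wm * a * r\<^sup>2"
  proof -
    show "a \<ge> 1" by (simp add: a_def)
    have "C1 / (\<kappa> * wm * r\<^sup>2) \<le> a" by (simp add: a_def)
    moreover have "\<kappa> * wm * r\<^sup>2 > 0" using \<kappa>(1) wm(1) r by simp
    ultimately show "C1 \<le> \<kappa> * wm * a * r\<^sup>2" by (simp add: divide_le_eq mult_ac)
  qed
  define \<zeta> where "\<zeta> x = exp (- a * (norm (x - z))\<^sup>2) - exp (- a * r\<^sup>2)" for x
  define D\<zeta> where "D\<zeta> y = (- 2 * a * exp (- a * (norm (y - z))\<^sup>2)) *\<^sub>R (y - z)" for y
  have ex1: "exp (- a * (norm (x - z))\<^sup>2) \<le> 1" for x using a by simp
  obtain xs where xs: "xs \<in> sphere z (r / 2)" "\<And>x. x \<in> sphere z (r / 2) \<Longrightarrow> w2 xs - w xs \<le> w2 x - w x"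
  proof -
    have sub: "sphere z (r / 2) \<subseteq> ?K" using r by (auto simp: K_def)
    have "continuous_on ?K w2"
      using der has_derivative_continuous continuous_at_imp_continuous_on by blast
    then have "continuous_on (sphere z (r / 2)) (\<lambda>x. w2 x - w x)"
      by (intro continuous_intros cont_w continuous_on_subset[OF _ sub])
    moreover have "sphere z (r / 2) \<noteq> {}"
    proof -
      obtain u :: "real^'n" where "norm u = r / 2" using vector_choose_size[of "r / 2"] r by auto
      then have "z + u \<in> sphere z (r / 2)" by (simp add: dist_norm)
      then show ?thesis by blast
    qed
    ultimately show ?thesis using continuous_attains_inf[OF compact_sphere] that by blast
  qed
  define h0 where "h0 = w2 xs - w xs"
  have h0: "h0 > 0" using less[OF xs(1)] by (simp add: h0_def)
  \<comment> \<open>In this order: the barrier stays below the gap on the inner sphere, a E \<le> 1,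
    the gain N' is at most 1 as \<open>strict_ellipticity\<close> demands, and w2 \<le> wM + 1 at
    the contact point.\<close>
  define c where "c = Min {h0, 1 / a, 1 / (4 * wM * a\<^sup>2 * r\<^sup>2), 1}"
  have c: "c > 0" "c \<le> h0" "c \<le> 1 / a" "c \<le> 1 / (4 * wM * a\<^sup>2 * r\<^sup>2)" "c \<le> 1"
    using h0 a wm(4) r by (auto simp: c_def)
  define g where "g x = w2 x - w x - c * \<zeta> x" for x
  define Dg where "Dg x = D2 x - Dw x - c *\<^sub>R D\<zeta> x" for x
  have "g x \<ge> 0" if xK: "x \<in> ?K" for x
  proof (rule ccontr)
    assume "\<not> g x \<ge> 0"
    define N where "N = {x. \<not> Dw differentiable (at x)}"
    have N: "negligible N" unfolding N_def by (rule negligible_nondifferentiable_locally_lipschitz[OF Dw_lip])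
    \<comment> \<open>The least value of E on the annulus; a slope q below a E0 is no larger than
      the order a E of the barrier gradient.\<close>
    define E0 where "E0 = c * exp (- a * r\<^sup>2)"
    have E0: "E0 > 0" using c by (simp add: E0_def)
    obtain q y where qy: "norm q < a * E0" "y \<in> interior ?K" "y \<notin> N" "g y < 0" "Dg y = q"
       "\<And>x. x \<in> ?K \<Longrightarrow> g x \<ge> g y + q \<bullet> (x - y)"
    proof (rule contact_point_off_null_set[OF cK _ _ N, of g Dg "a * E0" x])
      fix x assume x: "x \<in> ?K"
      show "(g has_derivative (\<lambda>h. Dg x \<bullet> h)) (at x)"
      proof -
        have "(\<zeta> has_derivative (\<lambda>h. D\<zeta> x \<bullet> h)) (at x)"
          unfolding \<zeta>_def[abs_def] D\<zeta>_def by (rule gaussian_has_derivative)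
        then have "(g has_derivative (\<lambda>h. D2 x \<bullet> h - Dw x \<bullet> h - c * (D\<zeta> x \<bullet> h))) (at x)"
          unfolding g_def[abs_def] by (intro has_derivative_diff der[OF x] w_deriv has_derivative_mult_right)
        then show ?thesis by (simp add: Dg_def inner_diff_left)
      qed
      show "calm Dg x" unfolding Dg_def D\<zeta>_def
        by (intro calm_diff calm2 x calm_Dw calm_bounded_linear[OF bounded_linear_scaleR_right] gaussian_gradient_calm)
    next
      fix x assume x: "x \<in> ?K" "x \<notin> interior ?K"
      then have "norm (x - z) = r \<or> norm (x - z) = r / 2" using Kint[of x] Kd[of x] by linarith
      then show "g x \<ge> 0"
      proof
        assume "norm (x - z) = r"
        then have "\<zeta> x = 0" by (simp add: \<zeta>_def)
        then show ?thesis using le[OF x(1)] by (simp add: g_def)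
      next
        assume "norm (x - z) = r / 2"
        then have "h0 \<le> w2 x - w x" using xs(2)[of x] by (simp add: h0_def dist_norm norm_minus_commute)
        moreover have "\<zeta> x \<le> 1" using ex1[of x] exp_gt_zero[of "- a * r\<^sup>2"] unfolding \<zeta>_def by linarith
        then have "c * \<zeta> x \<le> c * 1" using c(1) by (intro mult_left_mono) auto
        ultimately show ?thesis using c(2) by (simp add: g_def)
      qed
    qed (use xK \<open>\<not> g x \<ge> 0\<close> a(1) E0 in auto)
    have yK: "y \<in> ?K" using qy(2) interior_subset by blast
    define s where "s = y - z"
    define ns where "ns = norm s"
    have ns: "r / 2 \<le> ns" "ns \<le> r" "ns > 0" using yK r by (auto simp: Kd s_def ns_def)
    define E where "E = c * exp (- a * ns\<^sup>2)"
    have "exp (- a * r\<^sup>2) \<le> exp (- a * ns\<^sup>2)" using ns a(1) by (simp add: power_mono)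
    then have E: "E > 0" "E0 \<le> E" "E \<le> c" using c(1) a(1) by (auto simp: E_def E0_def)
    define \<tau> where "\<tau> = w2 y - w y"
    have \<tau>: "0 \<le> \<tau>" "\<tau> \<le> E"
    proof -
      show "0 \<le> \<tau>" using le[OF yK] by (simp add: \<tau>_def)
      have "\<tau> \<le> c * \<zeta> y" using qy(4) by (simp add: g_def \<tau>_def)
      also have "\<dots> \<le> E" using c(1) by (simp add: \<zeta>_def E_def s_def ns_def)
      finally show "\<tau> \<le> E" .
    qed
    define p where "p = Dw y"
    define \<pi> where "\<pi> = c *\<^sub>R D\<zeta> y + q"
    have yball: "ball y 1 \<subseteq> cball 0 (R + 1)"
    proof
      fix x assume "x \<in> ball y 1"
      then show "x \<in> cball 0 (R + 1)" using R(2)[OF yK] norm_triangle_sub[of x y] by (simp add: dist_norm norm_minus_commute)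
    qed
    obtain X where X: "transpose X = X" "jet2 w y p X" "\<And>k. \<bar>k \<bullet> (X *v k)\<bar> \<le> L * (k \<bullet> k)"
      using jet2_of_grad_derivative[OF w_deriv _ lipschitz_on_subset[OF L yball] zero_less_one] qy(3)
      unfolding N_def p_def by blast
    define Z where "Z = E *\<^sub>R ((4 * a\<^sup>2) *\<^sub>R rank1 s - (2 * a) *\<^sub>R mat 1)"
    define A where "A = conf_mat (w y) p X"
    define B where "B = conf_mat (w2 y) (p + \<pi>) (X + Z)"
    have sA: "transpose A = A" by (simp add: A_def conf_mat_def sym_matrix_simps X)
    have sB: "transpose B = B" by (simp add: B_def Z_def conf_mat_def sym_matrix_simps X)
    have qA: "x \<bullet> (A *v x) = w y * (x \<bullet> (X *v x)) - (norm p)\<^sup>2 / 2 * (x \<bullet> x)" for x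
      by (simp add: A_def conf_mat_def quad_form_simps inner_simps)
    have Pp: "norm p \<le> P" using P(2)[OF yK] by (simp add: p_def)
    have EA: "\<bar>eigvals A $ i\<bar> \<le> C0" for i
    proof (rule eigvals_bound[OF sA])
      fix x
      have "\<bar>x \<bullet> (A *v x)\<bar> \<le> \<bar>w y * (x \<bullet> (X *v x))\<bar> + \<bar>(norm p)\<^sup>2 / 2 * (x \<bullet> x)\<bar>"
        unfolding qA by (rule abs_triangle_ineq4)
      also have "\<dots> = w y * \<bar>x \<bullet> (X *v x)\<bar> + (norm p)\<^sup>2 / 2 * (x \<bullet> x)"
        using w_pos[of y] by (simp add: abs_mult)
      also have "\<dots> \<le> wM * (L * (x \<bullet> x)) + P\<^sup>2 / 2 * (x \<bullet> x)"
        using wm(3)[OF yK] wm(4) X(3)[of x] Pp w_pos[of y]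
        by (intro add_mono mult_mono mult_right_mono divide_right_mono power_mono) auto
      finally show "\<bar>x \<bullet> (A *v x)\<bar> \<le> C0 * (x \<bullet> x)" by (simp add: C0_def algebra_simps)
    qed
    \<comment> \<open>Since y is not in N, \<open>w\<close> has a 2-jet there and serves as its own
      test function.\<close>
    have "eigvals A \<in> \<Gamma> \<and> f (eigvals A) \<ge> 1"
      using w_super[unfolded tested_def, rule_format, OF UNIV_I X(1,2) refl] by (simp add: A_def)
    then have A1: "eigvals A \<in> closure \<Gamma>" "f (eigvals A) \<ge> 1" using closure_subset by auto
    \<comment> \<open>Coefficient of the radial rank-one part of the barrier Hessian, multiplied by
      w y: the gain handed to \<open>strict_ellipticity\<close>.\<close>
    define N' where "N' = w y * E * (4 * a\<^sup>2) * ns\<^sup>2"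
    have N'0: "N' > 0" using w_pos E(1) a(1) ns(3) by (simp add: N'_def)
    have N'1: "N' \<le> 1"
    proof -
      have "N' \<le> wM * c * (4 * a\<^sup>2) * r\<^sup>2"
        unfolding N'_def using wm(3)[OF yK] wm(4) E c(1) ns w_pos[of y]
        by (intro mult_mono power_mono mult_right_mono) auto
      also have "\<dots> = c * (4 * wM * a\<^sup>2 * r\<^sup>2)" by simp
      also have "\<dots> \<le> 1 / (4 * wM * a\<^sup>2 * r\<^sup>2) * (4 * wM * a\<^sup>2 * r\<^sup>2)"
        using c(4) wm(4) by (intro mult_right_mono) auto
      also have "\<dots> = 1" using wm(4) a(1) r by simp
      finally show ?thesis .
    qed
    have aE: "a * E \<le> 1" using E(3) c(3) a(1) by (simp add: field_simps) (metis mult.commute mult_left_mono order_trans zero_le_one)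
    have \<pi>: "norm \<pi> \<le> a * E * (2 * r + 1)"
    proof -
      have "norm (c *\<^sub>R D\<zeta> y) = 2 * a * E * ns"
        using c(1) a(1) by (simp add: D\<zeta>_def E_def s_def ns_def)
      also have "\<dots> \<le> 2 * a * E * r" using ns a(1) E(1) by (intro mult_left_mono) auto
      finally have "norm (c *\<^sub>R D\<zeta> y) \<le> 2 * a * E * r" .
      moreover have "norm q \<le> a * E"
        using qy(1) mult_left_mono[OF E(2), of a] a(1) by linarith
      ultimately show ?thesis unfolding \<pi>_def using norm_triangle_ineq[of "c *\<^sub>R D\<zeta> y" q] by (simp add: algebra_simps)
    qed
    have err: "\<tau> * L + (w y + \<tau>) * (2 * a * E) + norm p * norm \<pi> + (norm \<pi>)\<^sup>2 / 2 \<le> \<kappa> * N'"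
    proof -
      have "\<tau> * L \<le> (a * E) * L"
      proof (rule mult_right_mono[OF _ L0])
        show "\<tau> \<le> a * E" using \<tau>(2) mult_right_mono[OF a(1), of E] E(1) by linarith
      qed
      moreover have "(w y + \<tau>) * (2 * a * E) \<le> (wM + 1) * (2 * a * E)"
        using wm(3)[OF yK] \<tau> E c(5) a(1) by (intro mult_right_mono) auto
      moreover have "norm p * norm \<pi> \<le> P * (a * E * (2 * r + 1))"
        using Pp \<pi> P(1) by (intro mult_mono) auto
      moreover have "(norm \<pi>)\<^sup>2 / 2 \<le> (a * E) * ((2 * r + 1)\<^sup>2 / 2)"
      proof -
        have "(norm \<pi>)\<^sup>2 \<le> (a * E * (2 * r + 1))\<^sup>2" using \<pi> by (intro power_mono) auto
        also have "\<dots> = (a * E) * ((a * E) * (2 * r + 1)\<^sup>2)" by (simp add: power2_eq_square)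
        also have "\<dots> \<le> (a * E) * (1 * (2 * r + 1)\<^sup>2)"
          using aE a(1) E(1) by (intro mult_left_mono mult_right_mono) auto
        finally show ?thesis by simp
      qed
      ultimately have "\<tau> * L + (w y + \<tau>) * (2 * a * E) + norm p * norm \<pi> + (norm \<pi>)\<^sup>2 / 2 \<le> (a * E) * C1"
        unfolding C1_def by (simp add: algebra_simps)
      also have "\<dots> \<le> (a * E) * (\<kappa> * wm * a * r\<^sup>2)" using a E(1) by (intro mult_left_mono) auto
      also have "\<dots> = \<kappa> * (wm * E * (4 * a\<^sup>2) * (r / 2)\<^sup>2)" by (simp add: power2_eq_square)
      also have "\<dots> \<le> \<kappa> * N'"
        unfolding N'_def using wm(1) wm(2)[OF yK] E(1) ns r \<kappa>(1) w_pos[of y]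
        by (intro mult_left_mono mult_mono power_mono mult_right_mono) auto
      finally show ?thesis .
    qed
    define e where "e = s /\<^sub>R ns"
    have e: "norm e = 1" using ns(3) by (simp add: e_def ns_def)
    have es: "(s \<bullet> x)\<^sup>2 = ns\<^sup>2 * (e \<bullet> x)\<^sup>2" for x
    proof -
      have "s = ns *\<^sub>R e" using ns(3) by (simp add: e_def)
      then have "s \<bullet> x = ns * (e \<bullet> x)" by simp
      then show ?thesis by (simp add: power_mult_distrib)
    qed
    have lower: "x \<bullet> (A *v x) + N' * (e \<bullet> x)\<^sup>2 - \<kappa> * N' * (x \<bullet> x) \<le> x \<bullet> (B *v x)" for x
    proof -
      let ?xx = "x \<bullet> x" and ?xX = "x \<bullet> (X *v x)"
      have xx: "?xx \<ge> 0" by simp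
      have "x \<bullet> (B *v x) = (w y + \<tau>) * (?xX + E * (4 * a\<^sup>2 * (s \<bullet> x)\<^sup>2 - 2 * a * ?xx)) - (norm (p + \<pi>))\<^sup>2 / 2 * ?xx"
        by (simp add: B_def \<tau>_def Z_def conf_mat_def quad_form_simps inner_simps power2_eq_square inner_commute)
      also have "\<dots> = (w y * ?xX - (norm p)\<^sup>2 / 2 * ?xx) + (w y * E * (4 * a\<^sup>2) * (s \<bullet> x)\<^sup>2) + \<tau> * E * (4 * a\<^sup>2) * (s \<bullet> x)\<^sup>2
           + \<tau> * ?xX - (w y + \<tau>) * (2 * a * E) * ?xx - ((norm (p + \<pi>))\<^sup>2 - (norm p)\<^sup>2) / 2 * ?xx"
        by (simp add: algebra_simps diff_divide_distrib)
      finally have eq: "x \<bullet> (B *v x) = x \<bullet> (A *v x) + N' * (e \<bullet> x)\<^sup>2 + \<tau> * E * (4 * a\<^sup>2) * (s \<bullet> x)\<^sup>2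
           + \<tau> * ?xX - (w y + \<tau>) * (2 * a * E) * ?xx - ((norm (p + \<pi>))\<^sup>2 - (norm p)\<^sup>2) / 2 * ?xx"
        unfolding qA N'_def es by (simp add: mult.assoc)
      have t1: "0 \<le> \<tau> * E * (4 * a\<^sup>2) * (s \<bullet> x)\<^sup>2" using \<tau> E(1) by simp
      have t2: "- (\<tau> * L * ?xx) \<le> \<tau> * ?xX"
      proof -
        have "- (L * ?xx) \<le> ?xX" using X(3)[of x] by linarith
        from mult_left_mono[OF this \<tau>(1)] show ?thesis by (simp add: mult.assoc)
      qed
      have "(norm (p + \<pi>))\<^sup>2 \<le> (norm p + norm \<pi>)\<^sup>2" by (intro power_mono norm_triangle_ineq) auto
      then have "((norm (p + \<pi>))\<^sup>2 - (norm p)\<^sup>2) / 2 \<le> norm p * norm \<pi> + (norm \<pi>)\<^sup>2 / 2"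
        by (simp add: power2_eq_square algebra_simps)
      from mult_right_mono[OF this xx] have t3:
        "((norm (p + \<pi>))\<^sup>2 - (norm p)\<^sup>2) / 2 * ?xx \<le> (norm p * norm \<pi> + (norm \<pi>)\<^sup>2 / 2) * ?xx" .
      have t4: "(\<tau> * L + (w y + \<tau>) * (2 * a * E) + norm p * norm \<pi> + (norm \<pi>)\<^sup>2 / 2) * ?xx \<le> \<kappa> * N' * ?xx"
        by (rule mult_right_mono[OF err xx])
      have "(\<tau> * L + (w y + \<tau>) * (2 * a * E) + norm p * norm \<pi> + (norm \<pi>)\<^sup>2 / 2) * ?xx
        = \<tau> * L * ?xx + (w y + \<tau>) * (2 * a * E) * ?xx + (norm p * norm \<pi> + (norm \<pi>)\<^sup>2 / 2) * ?xx"
        by (simp only: distrib_right add.assoc)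
      then show ?thesis using t1 t2 t3 t4 unfolding eq by linarith
    qed
    have B1: "eigvals B \<in> \<Gamma> \<and> f (eigvals B) > 1"
      by (rule \<kappa>(2)[OF sA sB EA A1 N'0 N'1 e lower])
    \<comment> \<open>\<open>w\<close> plus barrier plus affine function touches w2 from below at y,
      because y is a contact point of g with slope q.\<close>
    define W where "W x = (w x + c * \<zeta> x) + (g y + q \<bullet> (x - y))" for x
    have Wy: "W y = w2 y" by (simp add: W_def g_def)
    have "transpose (0 :: real^'n^'n) = 0" by (simp add: transpose_def vec_eq_iff)
    from jet2_affine_quadratic[OF this, of "g y" q y y]
    have "jet2 (\<lambda>x. g y + q \<bullet> (x - y)) y q 0" by simp
    moreover have "jet2 (\<lambda>x. c * \<zeta> x) y (c *\<^sub>R D\<zeta> y) Z"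
      using jet2_cmult[OF jet2_gaussian[of a z "exp (- a * r\<^sup>2)" y], of c]
      by (simp add: \<zeta>_def[abs_def] D\<zeta>_def Z_def E_def s_def ns_def)
    ultimately have "jet2 W y (p + c *\<^sub>R D\<zeta> y + q) (X + Z + 0)"
      unfolding W_def by (intro jet2_add X(2))
    then have JW: "jet2 W y (p + \<pi>) (X + Z)" by (simp add: \<pi>_def add.assoc)
    have "\<forall>\<^sub>F x in nhds y. x \<in> interior ?K" using qy(2) by (rule eventually_nhds_in_open[OF open_interior])
    then have "\<forall>\<^sub>F x in nhds y. w2 x \<ge> W x"
    proof eventually_elim
      case (elim x)
      then have "g x \<ge> g y + q \<bullet> (x - y)" using qy(6) interior_subset by blast
      then show ?case by (simp add: W_def g_def)
    qed
    moreover have "transpose (X + Z) = X + Z" by (simp add: Z_def sym_matrix_simps X)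
    ultimately have "\<not> (eigvals B \<in> \<Gamma> \<and> f (eigvals B) > 1)"
      using sub yK JW Wy unfolding tested_def B_def by blast
    then show False using B1 by blast
  qed
  then show ?thesis using that[of a c] a(1) c(1) by (simp add: g_def \<zeta>_def)
qed

end

subsection \<open>Moving spheres\<close>

text \<open>Dw x . x - w x has the sign of the derivative of w(t u)/t in t at x = t u.\<close>

lemma radial_nonincreasing:
  fixes w :: "'a::real_inner \<Rightarrow> real"
  assumes der: "\<And>x. (w has_derivative (\<lambda>h. Dw x \<bullet> h)) (at x)"
    and mono: "\<And>x. s1 \<le> norm x \<Longrightarrow> norm x \<le> s2 \<Longrightarrow> Dw x \<bullet> x \<le> w x"
    and t: "0 < t" "s1 \<le> t" "t \<le> s" "s \<le> s2" and u: "norm u = 1"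
  shows "w (s *\<^sub>R u) / s \<le> w (t *\<^sub>R u) / t"
proof (rule DERIV_nonpos_imp_nonincreasing[OF t(3)])
  fix x assume x: "t \<le> x" "x \<le> s"
  then have x0: "x > 0" using t by simp
  have "((\<lambda>t. w (t *\<^sub>R u)) has_derivative (\<lambda>h. Dw (x *\<^sub>R u) \<bullet> (h *\<^sub>R u))) (at x)"
    by (rule has_derivative_compose[of "\<lambda>t. t *\<^sub>R u" _ _ _ w, OF _ der]) (auto intro!: derivative_eq_intros)
  then have "((\<lambda>t. w (t *\<^sub>R u)) has_real_derivative (Dw (x *\<^sub>R u) \<bullet> u)) (at x)"
    by (simp add: has_field_derivative_def mult.commute[of _ "Dw (x *\<^sub>R u) \<bullet> u"])
  then have "((\<lambda>t. w (t *\<^sub>R u) / t) has_real_derivative ((Dw (x *\<^sub>R u) \<bullet> u * x - w (x *\<^sub>R u) * 1) / (x * x))) (at x)"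
    using x0 by (intro DERIV_divide DERIV_ident) auto
  moreover have "Dw (x *\<^sub>R u) \<bullet> u * x - w (x *\<^sub>R u) * 1 \<le> 0"
    using mono[of "x *\<^sub>R u"] x x0 t u by (simp add: mult.commute)
  then have "(Dw (x *\<^sub>R u) \<bullet> u * x - w (x *\<^sub>R u) * 1) / (x * x) \<le> 0"
    using x0 by (intro divide_nonpos_pos) auto
  ultimately show "\<exists>y. ((\<lambda>t. w (t *\<^sub>R u) / t) has_real_derivative y) (at x) \<and> y \<le> 0" by blast
qed

text \<open>On a ray, comparing \<open>w\<close> with its reflection means comparing w(t u)/t at t =
  |y| and at the reflected radius \<mu>^2 / |y|.\<close>

lemma kelvin_radial:
  assumes "y \<noteq> 0" "\<mu> > 0"
  shows "kelvin \<mu> w y = norm y * (w ((\<mu>\<^sup>2 / norm y) *\<^sub>R (y /\<^sub>R norm y)) / (\<mu>\<^sup>2 / norm y))"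
proof -
  have "inv_pt \<mu> y = (\<mu>\<^sup>2 / norm y) *\<^sub>R (y /\<^sub>R norm y)"
    by (simp add: inv_pt_def power2_eq_square divide_inverse mult_ac)
  then show ?thesis using assms by (simp add: kelvin_def power2_eq_square)
qed

lemma nonneg_right_imp_derivative_nonneg:
  fixes F :: "real \<Rightarrow> real"
  assumes "(F has_real_derivative d) (at 0)" "F 0 = 0" "\<And>t. 0 < t \<Longrightarrow> t < e \<Longrightarrow> F t \<ge> 0" "e > 0"
  shows "d \<ge> 0"
proof (rule ccontr)
  assume "\<not> d \<ge> 0"
  then obtain d' where d': "d' > 0" "\<And>h. 0 < h \<Longrightarrow> h < d' \<Longrightarrow> F (0 + h) < F 0"
    using has_real_derivative_neg_dec_right[of F d 0 UNIV] assms(1) by auto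
  define h where "h = min d' e / 2"
  have "0 < h" "h < d'" "h < e" using d' assms(4) by (auto simp: h_def)
  then show False using d'(2)[of h] assms(2) assms(3)[of h] by simp
qed

context conformal_solution
begin

text \<open>Gradient of \<open>kelvin \<mu> w\<close>, written in operations that preserve
  \<open>calm\<close>.\<close>

definition Dkel :: "real \<Rightarrow> real^'n \<Rightarrow> real^'n" where
  "Dkel \<mu> y = (2 * w (inv_pt \<mu> y) / \<mu>\<^sup>2) *\<^sub>R y + (Dw (inv_pt \<mu> y) - (2 * (y \<bullet> Dw (inv_pt \<mu> y)) / (y \<bullet> y)) *\<^sub>R y)"

lemma kelvin_has_derivative:
  assumes y: "y \<noteq> 0" and mu: "\<mu> > 0"
  shows "(kelvin \<mu> w has_derivative (\<lambda>h. Dkel \<mu> y \<bullet> h)) (at y)"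
proof -
  let ?D = "Dw (inv_pt \<mu> y)"
  have "((\<lambda>y. w (inv_pt \<mu> y)) has_derivative (\<lambda>h. ?D \<bullet> ((\<mu>\<^sup>2 / (norm y)\<^sup>2) *\<^sub>R (refl_mat y *v h)))) (at y)"
    by (rule has_derivative_compose[OF has_derivative_inv_pt[OF y] w_deriv])
  moreover have "((\<lambda>y. (y \<bullet> y) / \<mu>\<^sup>2) has_derivative (\<lambda>h. 2 * (y \<bullet> h) / \<mu>\<^sup>2)) (at y)"
    by (rule bounded_linear.has_derivative[OF bounded_linear_divide])
      (auto intro!: derivative_eq_intros simp: fun_eq_iff inner_commute)
  ultimately have "((\<lambda>y. (y \<bullet> y) / \<mu>\<^sup>2 * w (inv_pt \<mu> y)) has_derivative
      (\<lambda>h. (y \<bullet> y) / \<mu>\<^sup>2 * (?D \<bullet> ((\<mu>\<^sup>2 / (norm y)\<^sup>2) *\<^sub>R (refl_mat y *v h))) + 2 * (y \<bullet> h) / \<mu>\<^sup>2 * w (inv_pt \<mu> y))) (at y)"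
    by (rule has_derivative_mult[rotated])
  moreover have "(\<lambda>h. (y \<bullet> y) / \<mu>\<^sup>2 * (?D \<bullet> ((\<mu>\<^sup>2 / (norm y)\<^sup>2) *\<^sub>R (refl_mat y *v h))) + 2 * (y \<bullet> h) / \<mu>\<^sup>2 * w (inv_pt \<mu> y))
      = (\<lambda>h. Dkel \<mu> y \<bullet> h)"
  proof
    fix h
    have "(y \<bullet> y) / \<mu>\<^sup>2 * (\<mu>\<^sup>2 / (norm y)\<^sup>2) = 1" using y mu by (simp add: power2_norm_eq_inner)
    then have "(y \<bullet> y) / \<mu>\<^sup>2 * (?D \<bullet> ((\<mu>\<^sup>2 / (norm y)\<^sup>2) *\<^sub>R (refl_mat y *v h))) = ?D \<bullet> (refl_mat y *v h)"
      by (simp only: inner_scaleR_right mult.assoc[symmetric] mult_1)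
    moreover have "?D \<bullet> (refl_mat y *v h) = ?D \<bullet> h - 2 * (y \<bullet> h) / (y \<bullet> y) * (?D \<bullet> y)"
      by (simp add: refl_mat_mult inner_diff_right power2_norm_eq_inner)
    moreover have "Dkel \<mu> y \<bullet> h = 2 * w (inv_pt \<mu> y) / \<mu>\<^sup>2 * (y \<bullet> h) + (?D \<bullet> h - 2 * (y \<bullet> ?D) / (y \<bullet> y) * (y \<bullet> h))"
      by (simp add: Dkel_def inner_add_left inner_diff_left)
    moreover have "y \<bullet> ?D = ?D \<bullet> y" by (rule inner_commute)
    ultimately show "(y \<bullet> y) / \<mu>\<^sup>2 * (?D \<bullet> ((\<mu>\<^sup>2 / (norm y)\<^sup>2) *\<^sub>R (refl_mat y *v h))) + 2 * (y \<bullet> h) / \<mu>\<^sup>2 * w (inv_pt \<mu> y)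
        = Dkel \<mu> y \<bullet> h"
      by (simp only:) (simp add: mult.commute mult.left_commute)
  qed
  moreover have "kelvin \<mu> w = (\<lambda>y. (y \<bullet> y) / \<mu>\<^sup>2 * w (inv_pt \<mu> y))"
    by (simp add: kelvin_def fun_eq_iff power2_norm_eq_inner)
  ultimately show ?thesis by simp
qed

lemma calm_Dkel:
  assumes y: "y \<noteq> 0"
  shows "calm (Dkel \<mu>) y"
proof -
  have I: "calm (inv_pt \<mu>) y" by (rule calm_has_derivative[OF has_derivative_inv_pt[OF y]])
  have id: "calm (\<lambda>y. y) y" by (rule calm_has_derivative[OF has_derivative_ident])
  have wI: "calm (\<lambda>y. w (inv_pt \<mu> y)) y" by (rule calm_compose[OF I calm_has_derivative[OF w_deriv]])
  have DI: "calm (\<lambda>y. Dw (inv_pt \<mu> y)) y" by (rule calm_compose[OF I calm_Dw])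
  have c1: "calm (\<lambda>y. (2 / \<mu>\<^sup>2) * w (inv_pt \<mu> y)) y"
    by (rule calm_bounded_linear[OF bounded_linear_mult_right wI])
  have "((\<lambda>y. 2 / (y \<bullet> y)) has_derivative (\<lambda>h. - 2 * (2 * (y \<bullet> h)) / ((y \<bullet> y) * (y \<bullet> y)))) (at y)"
    using y by (auto intro!: derivative_eq_intros simp: fun_eq_iff inner_commute)
  then have c2: "calm (\<lambda>y. 2 / (y \<bullet> y)) y" by (rule calm_has_derivative)
  have "calm (\<lambda>y. ((2 / \<mu>\<^sup>2) * w (inv_pt \<mu> y)) *\<^sub>R y
      + (Dw (inv_pt \<mu> y) - ((2 / (y \<bullet> y)) * (y \<bullet> Dw (inv_pt \<mu> y))) *\<^sub>R y)) y"
    by (intro calm_add calm_diff calm_scaleR c1 id DI calm_bilinear[OF bounded_bilinear_mult c2] calm_inner)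
  then show ?thesis by (simp add: Dkel_def[abs_def])
qed

definition below_kelvin :: "real \<Rightarrow> bool" where
  "below_kelvin \<mu> \<longleftrightarrow> (\<forall>y. norm y \<ge> \<mu> \<longrightarrow> w y \<le> kelvin \<mu> w y)"

text \<open>In the annulus around z the gap dominates a multiple of the Gaussian barrier, which
  vanishes at y0 and has positive slope from there towards z.\<close>

lemma kelvin_hopf:
  assumes mu: "\<mu> > 0" and P: "below_kelvin \<mu>" and r: "r > 0"
    and out: "\<And>x. x \<in> cball z r \<Longrightarrow> norm x \<ge> \<mu>" and pos: "\<And>x. x \<in> ball z r \<Longrightarrow> w x < kelvin \<mu> w x"
    and y0: "y0 \<in> sphere z r" "kelvin \<mu> w y0 = w y0"
  shows "(Dkel \<mu> y0 - Dw y0) \<bullet> (z - y0) > 0"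
proof -
  let ?K = "cball z r - ball z (r / 2)"
  have nz: "x \<noteq> 0" if "x \<in> cball z r" for x using out[OF that] mu by auto
  obtain a c where ac: "a > 0" "c > 0"
    "\<And>x. x \<in> ?K \<Longrightarrow> kelvin \<mu> w x - w x \<ge> c * (exp (- a * (norm (x - z))\<^sup>2) - exp (- a * r\<^sup>2))"
  proof (rule hopf_comparison[OF r, where ?w2.0 = "kelvin \<mu> w" and ?D2.0 = "Dkel \<mu>" and z = z])
    show "w_subsolution f \<Gamma> ?K (kelvin \<mu> w)"
      using w_subsolution_kelvin[OF w_sub mu] nz unfolding tested_def by auto
    show "w x < kelvin \<mu> w x" if "x \<in> sphere z (r / 2)" for x using that r by (intro pos) auto
    show "w x \<le> kelvin \<mu> w x" if "x \<in> ?K" for x using that P out by (auto simp: below_kelvin_def)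
  qed (use nz mu in \<open>auto intro!: kelvin_has_derivative calm_Dkel\<close>)
  define pt where "pt t = y0 + t *\<^sub>R (z - y0)" for t
  define F where "F t = kelvin \<mu> w (pt t) - w (pt t) - c * (exp (- a * ((1 - t)\<^sup>2 * r\<^sup>2)) - exp (- a * r\<^sup>2))" for t
  have y00: "y0 \<noteq> 0" using nz[of y0] y0 by auto
  have ptd: "(pt has_derivative (\<lambda>s. s *\<^sub>R (z - y0))) (at 0)"
    unfolding pt_def by (auto intro!: derivative_eq_intros)
  have "((\<lambda>t. kelvin \<mu> w (pt t)) has_derivative (\<lambda>s. Dkel \<mu> y0 \<bullet> (s *\<^sub>R (z - y0)))) (at 0)"
    by (rule has_derivative_compose[OF ptd]) (use kelvin_has_derivative[OF y00 mu] in \<open>simp add: pt_def\<close>)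
  then have d1: "((\<lambda>t. kelvin \<mu> w (pt t)) has_real_derivative (Dkel \<mu> y0 \<bullet> (z - y0))) (at 0)"
    by (simp add: has_field_derivative_def mult.commute[of _ "Dkel \<mu> y0 \<bullet> (z - y0)"])
  have "((\<lambda>t. w (pt t)) has_derivative (\<lambda>s. Dw y0 \<bullet> (s *\<^sub>R (z - y0)))) (at 0)"
    by (rule has_derivative_compose[OF ptd]) (use w_deriv[of y0] in \<open>simp add: pt_def\<close>)
  then have d2: "((\<lambda>t. w (pt t)) has_real_derivative (Dw y0 \<bullet> (z - y0))) (at 0)"
    by (simp add: has_field_derivative_def mult.commute[of _ "Dw y0 \<bullet> (z - y0)"])
  have d3: "((\<lambda>t. c * (exp (- a * ((1 - t)\<^sup>2 * r\<^sup>2)) - exp (- a * r\<^sup>2))) has_real_derivative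
      (c * (2 * a * r\<^sup>2 * exp (- a * r\<^sup>2)))) (at 0)"
    by (auto intro!: derivative_eq_intros)
  have "(F has_real_derivative (Dkel \<mu> y0 \<bullet> (z - y0) - Dw y0 \<bullet> (z - y0) - c * (2 * a * r\<^sup>2 * exp (- a * r\<^sup>2)))) (at 0)"
    unfolding F_def by (intro DERIV_diff d1 d2 d3)
  moreover have "F 0 = 0" by (simp add: F_def pt_def y0)
  \<comment> \<open>t < 1/2 keeps the point on the segment from y0 to z in the annulus of
    \<open>hopf_comparison\<close>.\<close>
  moreover have "F t \<ge> 0" if t: "0 < t" "t < 1/2" for t
  proof -
    have "pt t - z = (1 - t) *\<^sub>R (y0 - z)" by (simp add: pt_def algebra_simps)
    then have n: "norm (pt t - z) = (1 - t) * r" using t y0(1) by (simp add: dist_norm norm_minus_commute)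
    have "(1 - t) * r \<le> 1 * r" "1 / 2 * r \<le> (1 - t) * r" using t r by (intro mult_right_mono; simp)+
    then have "pt t \<in> ?K" using n by (auto simp: dist_norm norm_minus_commute)
    from ac(3)[OF this] show ?thesis unfolding n by (simp add: F_def power_mult_distrib)
  qed
  ultimately have "Dkel \<mu> y0 \<bullet> (z - y0) - Dw y0 \<bullet> (z - y0) - c * (2 * a * r\<^sup>2 * exp (- a * r\<^sup>2)) \<ge> 0"
    by (rule nonneg_right_imp_derivative_nonneg[where e = "1/2"]) simp_all
  moreover have "c * (2 * a * r\<^sup>2 * exp (- a * r\<^sup>2)) > 0" using ac r by simp
  ultimately show ?thesis unfolding inner_diff_left by linarith
qed

lemma kelvin_continuous_on: "\<mu> > 0 \<Longrightarrow> 0 \<notin> S \<Longrightarrow> continuous_on S (kelvin \<mu> w)"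
  by (metis continuous_at_imp_continuous_on has_derivative_continuous kelvin_has_derivative)

text \<open>The exterior is connected and the gap is positive on an open set. Its zero set is open
  too: a point u of positive gap near a zero would have a nearest zero y0, where the Hopf lemma
  gives a nonzero derivative although y0 is an interior minimum of the gap.\<close>

lemma strong_comparison:
  assumes mu: "\<mu> > 0" and P: "below_kelvin \<mu>" and ex: "norm y1 > \<mu>" "w y1 < kelvin \<mu> w y1" and y: "norm y > \<mu>"
  shows "w y < kelvin \<mu> w y"
proof -
  define D where "D = - cball (0::real^'n) \<mu>"
  have D: "x \<in> D \<longleftrightarrow> norm x > \<mu>" for x by (auto simp: D_def)
  have Dnz: "0 \<notin> D" using mu by (simp add: D)
  have "connected D"
    unfolding D_def by (rule connected_complement_bounded_convex) (use card_ge_3 in auto)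
  define h where "h x = kelvin \<mu> w x - w x" for x
  have ch: "continuous_on S h" if "0 \<notin> S" for S
    unfolding h_def by (intro continuous_intros kelvin_continuous_on mu that cont_w)
  have h0: "h x \<ge> 0" if "norm x \<ge> \<mu>" for x using P that by (simp add: below_kelvin_def h_def)
  define U where "U = {x \<in> D. 0 < h x}"
  define V where "V = {x \<in> D. h x = 0}"
  \<comment> \<open>Zeros on the sphere are included to make the set closed; \<open>inD\<close>
    shows that the nearest zero is not one of them.\<close>
  define Z where "Z = {x. norm x \<ge> \<mu> \<and> h x = 0}"
  have opD: "open D" by (simp add: D_def open_Compl)
  have opU: "open U"
  proof -
    have "open (D \<inter> h -` {0<..})" by (rule continuous_open_preimage[OF ch[OF Dnz] opD open_greaterThan])
    moreover have "D \<inter> h -` {0<..} = U" by (auto simp: U_def)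
    ultimately show ?thesis by simp
  qed
  have clZ: "closed Z"
  proof -
    have "closed {x::real^'n. norm x \<ge> \<mu>}" by (intro closed_Collect_le continuous_intros)
    moreover have "continuous_on {x::real^'n. norm x \<ge> \<mu>} h" by (rule ch) (use mu in auto)
    ultimately have "closed ({x::real^'n. norm x \<ge> \<mu>} \<inter> h -` {0})"
      by (intro continuous_closed_preimage) auto
    moreover have "{x::real^'n. norm x \<ge> \<mu>} \<inter> h -` {0} = Z" by (auto simp: Z_def)
    ultimately show ?thesis by simp
  qed
  \<comment> \<open>Half the distance from zb to the sphere: the ball around u that reaches up to
    the nearest zero then stays in the exterior.\<close>
  have far: "u \<notin> U" if zb: "zb \<in> V" and u: "dist u zb < (norm zb - \<mu>) / 2" for zb u
  proof
    assume "u \<in> U"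
    have "zb \<in> Z" using zb by (auto simp: V_def Z_def D)
    then obtain y0 where y0: "y0 \<in> Z" "\<And>x. x \<in> Z \<Longrightarrow> dist u y0 \<le> dist u x"
      using distance_attains_inf[OF clZ, of u] by auto
    define r where "r = dist u y0"
    have "u \<noteq> y0" using \<open>u \<in> U\<close> y0(1) by (auto simp: U_def Z_def)
    then have r0: "r > 0" by (simp add: r_def)
    have rle: "r < (norm zb - \<mu>) / 2" using y0(2)[OF \<open>zb \<in> Z\<close>] u by (simp add: r_def)
    have inD: "x \<in> D" if "x \<in> cball u r" for x
    proof -
      have "norm zb \<le> norm x + dist x u + dist u zb"
        using norm_triangle_sub[of zb x] dist_triangle[of zb x u] by (simp add: dist_norm norm_minus_commute)
      then show ?thesis using that rle u by (simp add: D dist_commute)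
    qed
    have "(Dkel \<mu> y0 - Dw y0) \<bullet> (u - y0) > 0"
    proof (rule kelvin_hopf[OF mu P r0])
      show "norm x \<ge> \<mu>" if "x \<in> cball u r" for x using inD[OF that] by (simp add: D)
      show "w x < kelvin \<mu> w x" if x: "x \<in> ball u r" for x
      proof -
        have "x \<notin> Z" using y0(2)[of x] x by (auto simp: r_def)
        moreover have "norm x \<ge> \<mu>" using inD[of x] x by (simp add: D)
        ultimately have "h x \<noteq> 0" "h x \<ge> 0" using h0 by (auto simp: Z_def)
        then show ?thesis by (simp add: h_def)
      qed
      show "y0 \<in> sphere u r" by (simp add: r_def)
      show "kelvin \<mu> w y0 = w y0" using y0(1) by (simp add: Z_def h_def)
    qed
    moreover have "y0 \<in> D" using inD[of y0] by (simp add: r_def)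
    then have "y0 \<noteq> 0" using Dnz by auto
    have "(h has_derivative (\<lambda>v. Dkel \<mu> y0 \<bullet> v - Dw y0 \<bullet> v)) (at y0)"
      unfolding h_def[abs_def] by (intro has_derivative_diff kelvin_has_derivative mu w_deriv \<open>y0 \<noteq> 0\<close>)
    from differential_zero_maxmin[OF \<open>y0 \<in> D\<close> opD this]
    have "(\<lambda>v. Dkel \<mu> y0 \<bullet> v - Dw y0 \<bullet> v) = (\<lambda>v. 0)"
      using h0 y0(1) by (auto simp: D Z_def)
    then have "Dkel \<mu> y0 \<bullet> (u - y0) - Dw y0 \<bullet> (u - y0) = 0" by metis
    ultimately show False by (simp add: inner_diff_left)
  qed
  have opV: "open V"
    unfolding open_dist
  proof
    fix zb assume zb: "zb \<in> V"
    show "\<exists>e>0. \<forall>u. dist u zb < e \<longrightarrow> u \<in> V"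
    proof (intro exI[of _ "(norm zb - \<mu>) / 2"] conjI allI impI)
      show "(norm zb - \<mu>) / 2 > 0" using zb by (simp add: V_def D)
      fix u assume u: "dist u zb < (norm zb - \<mu>) / 2"
      have "norm zb \<le> norm u + dist u zb" using norm_triangle_sub[of zb u] by (simp add: dist_norm norm_minus_commute)
      then have "u \<in> D" using u zb by (simp add: D V_def)
      then show "u \<in> V" using far[OF zb u] h0[of u] by (auto simp: U_def V_def D)
    qed
  qed
  have "D \<subseteq> U \<union> V"
  proof
    fix x assume "x \<in> D"
    moreover have "h x \<ge> 0" using h0[of x] \<open>x \<in> D\<close> by (simp add: D)
    ultimately show "x \<in> U \<union> V" by (auto simp: U_def V_def)
  qed
  moreover have "U \<inter> V \<inter> D = {}" by (auto simp: U_def V_def)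
  moreover have "U \<inter> D \<noteq> {}" using ex by (auto simp: U_def D h_def)
  ultimately have "V \<inter> D = {}" using connectedD[OF \<open>connected D\<close> opU opV] by blast
  then have "h y \<noteq> 0" using y by (auto simp: V_def D)
  then show ?thesis using y h0[of y] by (simp add: h_def)
qed

text \<open>If |y| and its reflected radius both lie where w(t u)/t is nonincreasing,
  \<open>kelvin_radial\<close> gives the comparison on that ray.\<close>

lemma below_kelvin_near_sphere:
  assumes mu: "\<mu> > 0" and mono: "\<And>x. s1 \<le> norm x \<Longrightarrow> norm x \<le> s2 \<Longrightarrow> Dw x \<bullet> x \<le> w x"
    and y: "norm y \<ge> \<mu>" "norm y \<le> s2" "s1 \<le> \<mu>\<^sup>2 / norm y"
  shows "w y \<le> kelvin \<mu> w y"
proof -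
  have y0: "norm y > 0" "y \<noteq> 0" using y mu by auto
  let ?u = "y /\<^sub>R norm y"
  have "\<mu>\<^sup>2 \<le> norm y * norm y" using y mu by (simp add: power2_eq_square mult_mono)
  then have "\<mu>\<^sup>2 / norm y \<le> norm y" using y0 by (simp add: divide_le_eq)
  then have "w (norm y *\<^sub>R ?u) / norm y \<le> w ((\<mu>\<^sup>2 / norm y) *\<^sub>R ?u) / (\<mu>\<^sup>2 / norm y)"
    using y y0 mu by (intro radial_nonincreasing[OF w_deriv mono]) auto
  then have "w y / norm y \<le> w ((\<mu>\<^sup>2 / norm y) *\<^sub>R ?u) / (\<mu>\<^sup>2 / norm y)" using y0 by simp
  then have "norm y * (w y / norm y) \<le> norm y * (w ((\<mu>\<^sup>2 / norm y) *\<^sub>R ?u) / (\<mu>\<^sup>2 / norm y))"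
    using y0 by (intro mult_left_mono) auto
  then show ?thesis using kelvin_radial[OF y0(2) mu] y0 by simp
qed

end

section \<open>Continuity method in the radius\<close>

context conformal_solution
begin

text \<open>Near the centre w(t u)/t is nonincreasing, since \<open>w\<close> is bounded below and
  its gradient above. Farther out \<open>w\<close> is at most C |y|^2, while its reflection is at
  least m |y|^2 / \<mu>^2.\<close>

lemma below_kelvin_start:
  assumes b: "b > 0" "\<And>y. norm y \<ge> R \<Longrightarrow> w y \<le> b * (norm y)\<^sup>2"
  obtains \<mu>0 where "\<mu>0 > 0" "\<And>\<mu>. 0 < \<mu> \<Longrightarrow> \<mu> \<le> \<mu>0 \<Longrightarrow> below_kelvin \<mu>"
proof -
  have "bounded (Dw ` cball 0 1)" by (intro compact_imp_bounded compact_continuous_image cont_Dw compact_cball)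
  then obtain P where P: "P > 0" "\<And>x. x \<in> cball 0 1 \<Longrightarrow> norm (Dw x) \<le> P" by (auto simp: bounded_pos)
  obtain xm where xm: "\<And>x. x \<in> cball 0 1 \<Longrightarrow> w xm \<le> w x"
    using continuous_attains_inf[OF compact_cball _ cont_w, of 0 1] by force
  define m where "m = w xm"
  have m: "m > 0" using w_pos by (simp add: m_def)
  \<comment> \<open>Ensures |Dw x| |x| \<le> m \<le> w x for |x| \<le> r0.\<close>
  define r0 where "r0 = min 1 (m / P)"
  have r0: "r0 > 0" "r0 \<le> 1" "P * r0 \<le> m" using m P(1) by (auto simp: r0_def min_def field_simps)
  have mono: "Dw x \<bullet> x \<le> w x" if "norm x \<le> r0" for x
  proof -
    have "Dw x \<bullet> x \<le> norm (Dw x) * norm x" by (rule norm_cauchy_schwarz)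
    also have "\<dots> \<le> P * r0" using that r0 P by (intro mult_mono) auto
    also have "\<dots> \<le> w x" using r0 xm[of x] that by (simp add: m_def)
    finally show ?thesis .
  qed
  obtain xM where xM: "\<And>x. x \<in> cball 0 \<bar>R\<bar> \<Longrightarrow> w x \<le> w xM"
    using continuous_attains_sup[OF compact_cball _ cont_w, of 0 "\<bar>R\<bar>"] by force
  \<comment> \<open>One constant for all |y| \<ge> r0: the growth bound beyond R, and the maximum of
    \<open>w\<close> divided by r0^2 before.\<close>
  define C where "C = max b (w xM / r0\<^sup>2)"
  have C: "C > 0" using b by (simp add: C_def)
  have bd: "w y \<le> C * (norm y)\<^sup>2" if "norm y \<ge> r0" for y :: "real^'n"
  proof (cases "norm y \<ge> R")
    case True
    have "b * (norm y)\<^sup>2 \<le> C * (norm y)\<^sup>2" by (intro mult_right_mono) (auto simp: C_def)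
    then show ?thesis using b(2)[OF True] by simp
  next
    case False
    then have "w y \<le> w xM" by (intro xM) auto
    also have "\<dots> = w xM / r0\<^sup>2 * r0\<^sup>2" using r0 by simp
    also have "\<dots> \<le> C * (norm y)\<^sup>2" using that r0 C by (intro mult_mono power_mono) (auto simp: C_def)
    finally show ?thesis .
  qed
  define \<mu>0 where "\<mu>0 = min r0 (sqrt (m / C))"
  have \<mu>0: "\<mu>0 > 0" "\<mu>0 \<le> r0" using r0 m C by (auto simp: \<mu>0_def)
  have mu2: "C * \<mu>\<^sup>2 \<le> m" if "0 < \<mu>" "\<mu> \<le> \<mu>0" for \<mu>
  proof -
    have "\<mu>\<^sup>2 \<le> (sqrt (m / C))\<^sup>2" using that by (intro power_mono) (auto simp: \<mu>0_def)
    also have "\<dots> = m / C" using m C by simp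
    finally show ?thesis using C by (simp add: field_simps)
  qed
  show ?thesis
  proof (rule that[OF \<mu>0(1)])
    fix \<mu> assume mu: "0 < \<mu>" "\<mu> \<le> \<mu>0"
    show "below_kelvin \<mu>" unfolding below_kelvin_def
    proof (intro allI impI)
      fix y :: "real^'n" assume y: "norm y \<ge> \<mu>"
      show "w y \<le> kelvin \<mu> w y"
      proof (cases "norm y \<le> r0")
        case True
        show ?thesis by (rule below_kelvin_near_sphere[OF mu(1) mono y True, of 0]) auto
      next
        case False
        have "\<mu>\<^sup>2 / norm y \<le> 1"
        proof -
          have "\<mu>\<^sup>2 \<le> r0 * r0" using mu \<mu>0 unfolding power2_eq_square by (intro mult_mono) auto
          also have "\<dots> \<le> 1 * norm y" using False r0 by (intro mult_mono) auto
          finally show ?thesis using False r0 by (simp add: divide_le_eq)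
        qed
        then have "inv_pt \<mu> y \<in> cball 0 1" by (simp add: norm_inv_pt)
        then have "m \<le> w (inv_pt \<mu> y)" unfolding m_def by (rule xm)
        then have "(norm y)\<^sup>2 / \<mu>\<^sup>2 * (C * \<mu>\<^sup>2) \<le> (norm y)\<^sup>2 / \<mu>\<^sup>2 * w (inv_pt \<mu> y)"
          using mu2[OF mu] by (intro mult_left_mono) auto
        moreover have "(norm y)\<^sup>2 / \<mu>\<^sup>2 * (C * \<mu>\<^sup>2) = C * (norm y)\<^sup>2" using mu by simp
        ultimately show ?thesis using bd[of y] False by (simp add: kelvin_def)
      qed
    qed
  qed
qed

lemma inv_pt_small:
  assumes "d > 0" "norm y > \<nu>\<^sup>2 / d" "\<nu> \<noteq> 0"
  shows "norm (inv_pt \<nu> y) < d"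
proof -
  have "\<nu>\<^sup>2 / d > 0" using assms by simp
  then have "norm y > 0" using assms(2) by linarith
  then show ?thesis using assms by (simp add: norm_inv_pt field_simps)
qed

text \<open>A slightly larger radius works in three regions: near infinity because b \<mu>^2 < w 0,
  on a compact annulus because the comparison is strict there, and near the sphere because the Hopf
  lemma makes w(t u)/t decreasing.\<close>

lemma below_kelvin_open:
  assumes mu: "\<mu> > 0" and P: "below_kelvin \<mu>" and b: "b > 0" "\<And>y. norm y \<ge> R \<Longrightarrow> w y \<le> b * (norm y)\<^sup>2"
    and lt: "b * \<mu>\<^sup>2 < w 0"
  obtains \<delta> where "\<delta> > 0" "\<And>\<nu>. \<mu> \<le> \<nu> \<Longrightarrow> \<nu> \<le> \<mu> + \<delta> \<Longrightarrow> below_kelvin \<nu>"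
proof -
  \<comment> \<open>A level strictly between b \<mu>^2 and w 0, so that both inequalities persist
    for nearby radii and points.\<close>
  define m1 where "m1 = (w 0 + b * \<mu>\<^sup>2) / 2"
  have m1: "b * \<mu>\<^sup>2 < m1" "m1 < w 0" using lt by (auto simp: m1_def)
  have "isCont w 0" using has_derivative_continuous[OF w_deriv] by (simp add: continuous_at)
  then have "\<forall>\<^sub>F x in nhds 0. w x > m1" using m1(2) by (metis isContD order_tendstoD(1) tendsto_at_iff_tendsto_nhds)
  then obtain d where d: "d > 0" "\<And>x. norm x < d \<Longrightarrow> w x > m1" unfolding eventually_nhds_metric by auto
  have "\<exists>\<delta>>0. \<forall>\<nu>. dist \<nu> \<mu> < \<delta> \<longrightarrow> b * \<nu>\<^sup>2 < m1"
  proof -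
    have "((\<lambda>\<nu>. b * \<nu>\<^sup>2) \<longlongrightarrow> b * \<mu>\<^sup>2) (nhds \<mu>)" by (intro tendsto_intros filterlim_ident)
    then have "\<forall>\<^sub>F \<nu> in nhds \<mu>. b * \<nu>\<^sup>2 < m1" using m1(1) by (rule order_tendstoD)
    then show ?thesis unfolding eventually_nhds_metric .
  qed
  then obtain d1 where d1: "d1 > 0" "\<And>\<nu>. dist \<nu> \<mu> < d1 \<Longrightarrow> b * \<nu>\<^sup>2 < m1" by blast
  \<comment> \<open>Beyond this radius the growth bound holds, and reflection with any radius up to
    \<mu> + 1 lands where w > m1.\<close>
  define R1 where "R1 = max (max R (\<mu> + 2)) ((\<mu> + 1)\<^sup>2 / d + 1)"
  have large: "w y < kelvin \<nu> w y" if y: "norm y \<ge> R1" and nu: "\<mu> \<le> \<nu>" "\<nu> < \<mu> + d1" "\<nu> \<le> \<mu> + 1" for y \<nu>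
  proof -
    have n0: "\<nu> > 0" using nu mu by simp
    have "\<nu>\<^sup>2 / d \<le> (\<mu> + 1)\<^sup>2 / d" using nu n0 d(1) by (intro divide_right_mono power_mono) auto
    then have "norm (inv_pt \<nu> y) < d" using y d(1) n0 by (intro inv_pt_small) (auto simp: R1_def)
    then have wi: "w (inv_pt \<nu> y) > m1" by (rule d(2))
    have "b * \<nu>\<^sup>2 < m1" using nu by (intro d1(2)) (auto simp: dist_real_def)
    have y0: "norm y > 0" using y mu by (auto simp: R1_def)
    have "w y \<le> (norm y)\<^sup>2 / \<nu>\<^sup>2 * (b * \<nu>\<^sup>2)" using b(2)[of y] y n0 by (simp add: R1_def mult.commute)
    also have "\<dots> < (norm y)\<^sup>2 / \<nu>\<^sup>2 * w (inv_pt \<nu> y)"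
      using wi \<open>b * \<nu>\<^sup>2 < m1\<close> y0 n0 by (intro mult_strict_left_mono) auto
    finally show ?thesis by (simp add: kelvin_def)
  qed
  have "R1 \<ge> \<mu> + 2" by (simp add: R1_def)
  then have "R1 \<ge> 0" using mu by simp
  then obtain y1 :: "real^'n" where y1: "norm y1 = R1" using vector_choose_size by blast
  have strict: "w y < kelvin \<mu> w y" if "norm y > \<mu>" for y
    by (rule strong_comparison[OF mu P _ _ that, of y1]) (use y1 large[of y1 \<mu>] d1(1) in \<open>auto simp: R1_def\<close>)
  have sphere: "Dw y \<bullet> y < w y" if y: "norm y = \<mu>" for y
  proof -
    have yn: "y \<noteq> 0" using y mu by auto
    have Iy: "inv_pt \<mu> y = y" using y mu by (simp add: inv_pt_def)
    \<comment> \<open>The ball of radius \<mu> about 2y lies outside the sphere and touches it at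
      y.\<close>
    have "(Dkel \<mu> y - Dw y) \<bullet> (2 *\<^sub>R y - y) > 0"
    proof (rule kelvin_hopf[OF mu P mu])
      have out: "norm x \<ge> 2 * \<mu> - dist x (2 *\<^sub>R y)" for x
        using norm_triangle_sub[of "2 *\<^sub>R y" x] y by (simp add: dist_norm norm_minus_commute)
      show "norm x \<ge> \<mu>" if "x \<in> cball (2 *\<^sub>R y) \<mu>" for x using out[of x] that by (simp add: dist_commute)
      show "w x < kelvin \<mu> w x" if "x \<in> ball (2 *\<^sub>R y) \<mu>" for x
        using out[of x] that by (intro strict) (simp add: dist_commute)
      have "2 *\<^sub>R y - y = y" by (simp add: scaleR_2)
      then show "y \<in> sphere (2 *\<^sub>R y) \<mu>" using y by (simp add: dist_norm)
      show "kelvin \<mu> w y = w y" using y mu by (simp add: kelvin_def Iy)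
    qed
    moreover have e: "2 *\<^sub>R y - y = y" by (simp add: scaleR_2)
    ultimately have "(Dkel \<mu> y - Dw y) \<bullet> y > 0" by (simp only:)
    moreover have yy: "y \<bullet> y = \<mu>\<^sup>2" using y by (simp add: dot_square_norm)
    \<comment> \<open>On the sphere the derivative of the gap in direction y is twice w y - Dw y .
      y, the quantity that governs \<open>radial_nonincreasing\<close>.\<close>
    have "(Dkel \<mu> y - Dw y) \<bullet> y = 2 * w y - 2 * (y \<bullet> Dw y)"
      unfolding Dkel_def Iy inner_diff_left inner_add_left inner_scaleR_left yy using mu by simp
    ultimately show ?thesis by (simp add: inner_commute)
  qed
  obtain \<eta> where \<eta>: "\<eta> > 0" "\<eta> < \<mu>" "\<And>x. \<mu> - \<eta> \<le> norm x \<Longrightarrow> norm x \<le> \<mu> + \<eta> \<Longrightarrow> Dw x \<bullet> x \<le> w x"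
  proof -
    have op: "open {x. Dw x \<bullet> x < w x}" by (intro open_Collect_less continuous_intros cont_Dw cont_w)
    have "sphere 0 \<mu> \<subseteq> {x. Dw x \<bullet> x < w x}" using sphere by auto
    from compact_subset_open_imp_ball_epsilon_subset[OF compact_sphere op this]
    obtain e where e: "e > 0" "(\<Union>x\<in>sphere 0 \<mu>. ball x e) \<subseteq> {x. Dw x \<bullet> x < w x}" .
    define \<eta> where "\<eta> = min (e / 2) (\<mu> / 2)"
    show ?thesis
    proof (rule that[of \<eta>])
      show "\<eta> > 0" "\<eta> < \<mu>" using e mu by (auto simp: \<eta>_def min_def)
      fix x :: "real^'n" assume x: "\<mu> - \<eta> \<le> norm x" "norm x \<le> \<mu> + \<eta>"
      have x0: "norm x > 0" using x(1) \<open>\<eta> < \<mu>\<close> by linarith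
      define x' where "x' = (\<mu> / norm x) *\<^sub>R x"
      have "x' \<in> sphere 0 \<mu>" using x0 mu by (simp add: x'_def)
      moreover have "dist x' x < e"
      proof -
        have "x' - x = ((\<mu> - norm x) / norm x) *\<^sub>R x"
          using x0 by (simp add: x'_def diff_divide_distrib scaleR_diff_left)
        then have "dist x' x = \<bar>\<mu> - norm x\<bar>" using x0 by (simp add: dist_norm)
        also have "\<dots> < e" using x e(1) by (auto simp: \<eta>_def abs_le_iff min_def split: if_splits)
        finally show ?thesis .
      qed
      ultimately show "Dw x \<bullet> x \<le> w x" using e(2) by force
    qed
  qed
  define K where "K = {y::real^'n. \<mu> + \<eta> / 2 \<le> norm y \<and> norm y \<le> R1}"
  have cK: "compact K"
  proof -
    have "closed {y::real^'n. \<mu> + \<eta> / 2 \<le> norm y}" by (intro closed_Collect_le continuous_intros)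
    moreover have "K = cball 0 R1 \<inter> {y::real^'n. \<mu> + \<eta> / 2 \<le> norm y}" by (auto simp: K_def)
    ultimately show ?thesis by (simp add: compact_Int_closed)
  qed
  obtain d2 where d2: "d2 > 0" "\<And>\<nu> y. y \<in> K \<Longrightarrow> \<mu> \<le> \<nu> \<Longrightarrow> \<nu> \<le> \<mu> + 1 \<Longrightarrow> \<nu> < \<mu> + d2 \<Longrightarrow> w y < kelvin \<nu> w y"
  proof (cases "K = {}")
    case False
    define G where "G p = kelvin (fst p) w (snd p) - w (snd p)" for p
    have "continuous_on ({\<mu>..\<mu> + 1} \<times> K) G"
      unfolding G_def kelvin_def inv_pt_def
      by (intro continuous_intros continuous_on_compose2[OF cont_w[of UNIV]])
        (use mu \<eta> in \<open>auto simp: K_def\<close>)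
    then have uc: "uniformly_continuous_on ({\<mu>..\<mu> + 1} \<times> K) G"
      by (intro compact_uniformly_continuous compact_Times cK) auto
    have "continuous_on K (\<lambda>y. kelvin \<mu> w y - w y)"
      by (intro continuous_intros kelvin_continuous_on mu cont_w) (use mu \<eta> in \<open>auto simp: K_def\<close>)
    then obtain ym where ym: "ym \<in> K" "\<And>y. y \<in> K \<Longrightarrow> kelvin \<mu> w ym - w ym \<le> kelvin \<mu> w y - w y"
      using continuous_attains_inf[OF cK False] by blast
    define c where "c = kelvin \<mu> w ym - w ym"
    have "c > 0" using strict[of ym] ym(1) \<eta>(1) by (simp add: c_def K_def)
    then obtain d2 where d2: "d2 > 0" "\<And>p p'. p \<in> {\<mu>..\<mu> + 1} \<times> K \<Longrightarrow> p' \<in> {\<mu>..\<mu> + 1} \<times> K \<Longrightarrow> dist p' p < d2 \<Longrightarrow> dist (G p') (G p) < c"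
      using uc unfolding uniformly_continuous_on_def by metis
    show ?thesis
    proof (rule that[OF d2(1)])
      fix \<nu> y assume y: "y \<in> K" and nu: "\<mu> \<le> \<nu>" "\<nu> \<le> \<mu> + 1" "\<nu> < \<mu> + d2"
      have "dist (G (\<nu>, y)) (G (\<mu>, y)) < c"
        using y nu by (intro d2(2)) (auto simp: dist_Pair_Pair dist_real_def)
      moreover have "G (\<mu>, y) \<ge> c" using ym(2)[OF y] by (simp add: G_def c_def)
      ultimately show "w y < kelvin \<nu> w y" by (simp add: G_def dist_real_def)
    qed
  qed (auto intro: that[of 1])
  define \<delta> where "\<delta> = min (min (d1 / 2) (d2 / 2)) (min 1 (\<eta> / 2))"
  show ?thesis
  proof (rule that[of \<delta>])
    show "\<delta> > 0" using d1 d2 \<eta> by (simp add: \<delta>_def)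
    fix \<nu> assume nu: "\<mu> \<le> \<nu>" "\<nu> \<le> \<mu> + \<delta>"
    have nu': "\<nu> < \<mu> + d1" "\<nu> < \<mu> + d2" "\<nu> \<le> \<mu> + 1" "\<nu> \<le> \<mu> + \<eta> / 2"
      using nu d1(1) d2(1) by (auto simp: \<delta>_def min_def split: if_splits)
    show "below_kelvin \<nu>" unfolding below_kelvin_def
    proof (intro allI impI)
      fix y :: "real^'n" assume y: "norm y \<ge> \<nu>"
      consider "norm y \<ge> R1" | "y \<in> K" | "norm y < \<mu> + \<eta> / 2" by (fastforce simp: K_def)
      then show "w y \<le> kelvin \<nu> w y"
      proof cases
        case 1 then show ?thesis using large[of y \<nu>] nu nu' by simp
      next
        case 2 then show ?thesis using d2(2)[of y \<nu>] nu nu' by simp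
      next
        case 3
        have y0: "norm y > 0" using y nu mu by linarith
        \<comment> \<open>The reflected radius is at least \<mu> - \<eta>, because (\<mu> -
          \<eta>)(\<mu> + \<eta>/2) \<le> \<mu>^2.\<close>
        have "(\<mu> - \<eta>) * norm y \<le> (\<mu> - \<eta>) * (\<mu> + \<eta> / 2)" using 3 \<eta> by (intro mult_left_mono) auto
        also have "\<dots> = \<mu>\<^sup>2 - (\<eta> * \<mu> / 2 + \<eta>\<^sup>2 / 2)" by (simp add: field_simps power2_eq_square)
        also have "\<dots> \<le> \<mu>\<^sup>2" using mult_pos_pos[OF \<eta>(1) mu] zero_le_power2[of \<eta>] by linarith
        also have "\<dots> \<le> \<nu>\<^sup>2" using nu mu by (intro power_mono) auto
        finally have "\<mu> - \<eta> \<le> \<nu>\<^sup>2 / norm y" using y0 by (simp add: le_divide_eq)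
        then show ?thesis using nu mu y 3 \<eta>(1) by (intro below_kelvin_near_sphere[OF _ \<eta>(3)]) auto
      qed
    qed
  qed
qed

lemma below_kelvin_limit:
  assumes s0: "s > 0" and below: "\<And>\<nu>. 0 < \<nu> \<Longrightarrow> \<nu> < s \<Longrightarrow> below_kelvin \<nu>"
  shows "below_kelvin s"
  unfolding below_kelvin_def
  proof (intro allI impI)
    fix y :: "real^'n" assume y: "norm y \<ge> s"
    have "((\<lambda>\<nu>. kelvin \<nu> w y) \<longlongrightarrow> kelvin s w y) (at s)"
    proof -
      have "isCont w (inv_pt s y)" using has_derivative_continuous[OF w_deriv] by (simp add: continuous_at)
      moreover have "((\<lambda>\<nu>. inv_pt \<nu> y) \<longlongrightarrow> inv_pt s y) (at s)"
        unfolding inv_pt_def using y s0 by (intro tendsto_intros) auto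
      ultimately have "((\<lambda>\<nu>. w (inv_pt \<nu> y)) \<longlongrightarrow> w (inv_pt s y)) (at s)" by (rule isCont_tendsto_compose)
      then show ?thesis unfolding kelvin_def using s0 by (intro tendsto_intros) auto
    qed
    then have "((\<lambda>\<nu>. kelvin \<nu> w y) \<longlongrightarrow> kelvin s w y) (at_left s)" by (rule filterlim_mono) (auto simp: at_le)
    moreover have "\<forall>\<^sub>F \<nu> in at_left s. w y \<le> kelvin \<nu> w y"
      using eventually_at_left_real[OF s0] by eventually_elim (use below y in \<open>auto simp: below_kelvin_def\<close>)
    ultimately show "w y \<le> kelvin s w y" by (rule tendsto_lowerbound) simp
  qed

text \<open>The supremum of the admissible radii is admissible by \<open>below_kelvin_limit\<close>,
  and \<open>below_kelvin_open\<close> moves it further as long as it is less than \<mu>.\<close>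

theorem below_kelvin_all:
  assumes mu: "\<mu> > 0" and b: "b > 0" "\<And>y. norm y \<ge> R \<Longrightarrow> w y \<le> b * (norm y)\<^sup>2" and lt: "b * \<mu>\<^sup>2 < w 0"
  shows "below_kelvin \<mu>"
proof -
  define S where "S = {s. 0 < s \<and> s \<le> \<mu> \<and> (\<forall>\<nu>. 0 < \<nu> \<and> \<nu> \<le> s \<longrightarrow> below_kelvin \<nu>)}"
  obtain \<mu>0 where \<mu>0: "\<mu>0 > 0" "\<And>\<nu>. 0 < \<nu> \<Longrightarrow> \<nu> \<le> \<mu>0 \<Longrightarrow> below_kelvin \<nu>"
    using below_kelvin_start[OF b] by blast
  have mem: "min \<mu>0 \<mu> \<in> S" using \<mu>0 mu by (auto simp: S_def)
  have bdd: "bdd_above S" by (auto simp: S_def bdd_above_def)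
  define s where "s = Sup S"
  have s0: "s > 0" using cSup_upper[OF mem bdd] \<mu>0(1) mu by (simp add: s_def min_def split: if_splits)
  have smu: "s \<le> \<mu>" unfolding s_def by (rule cSup_least) (use mem in blast, auto simp: S_def)
  have below: "below_kelvin \<nu>" if nu: "0 < \<nu>" "\<nu> < s" for \<nu>
  proof -
    have "\<exists>t\<in>S. \<nu> < t" using nu(2) less_cSup_iff[of S \<nu>] mem bdd by (auto simp: s_def)
    then show ?thesis using nu(1) by (auto simp: S_def)
  qed
  have at: "below_kelvin s" by (rule below_kelvin_limit[OF s0 below])
  have "s = \<mu>"
  proof (rule ccontr)
    assume "s \<noteq> \<mu>"
    then have "s < \<mu>" using smu by simp
    have "b * s\<^sup>2 \<le> b * \<mu>\<^sup>2" using smu s0 b(1) by (intro mult_left_mono power_mono) auto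
    then have "b * s\<^sup>2 < w 0" using lt by simp
    from below_kelvin_open[OF s0 at b this]
    obtain \<delta> where \<delta>: "\<delta> > 0" "\<And>\<nu>. s \<le> \<nu> \<Longrightarrow> \<nu> \<le> s + \<delta> \<Longrightarrow> below_kelvin \<nu>" by blast
    have "min (s + \<delta>) \<mu> \<in> S"
      using \<delta> s0 mu below by (auto simp: S_def) (metis linorder_not_le)
    from cSup_upper[OF this bdd] show False using \<delta>(1) \<open>s < \<mu>\<close> by (simp add: s_def[symmetric] min_def split: if_splits)
  qed
  then show ?thesis using at by simp
qed

end

subsection \<open>Behaviour at infinity\<close>

context conformal_solution
begin

text \<open>The chart at infinity: with z = y / |y|^2 the value is w y / |y|^2, so growth of
  \<open>w\<close> becomes behaviour at the puncture 0.\<close>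

abbreviation what :: "real^'n \<Rightarrow> real" where "what \<equiv> kelvin 1 w"

lemma what_pos: "z \<noteq> 0 \<Longrightarrow> what z > 0"
  using w_pos by (simp add: kelvin_def)

text \<open>(S6) makes the trace of the conformal matrix positive: \<open>what\<close> is
  subharmonic in the viscosity sense, with a gradient term of favourable sign.\<close>

lemma what_touched_from_above:
  assumes z: "z \<noteq> 0" and X: "transpose X = X" and J: "jet2 U z p X" and U: "U z = what z"
    and le: "\<forall>\<^sub>F y in nhds z. what y \<le> U y"
  shows "what z * trace X > real CARD('n) / 2 * (norm p)\<^sup>2"
proof -
  have "eigvals (conf_mat (what z) p X) \<in> \<Gamma>"
    using w_supersolution_kelvin[OF w_super zero_less_one, unfolded tested_def, rule_format, of z X U p] assms
    by simp
  then have "eigvals (conf_mat (what z) p X) \<in> Gamma_1" using S6 by (auto simp: cond_S6_def)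
  moreover have "transpose (conf_mat (what z) p X) = conf_mat (what z) p X"
    by (simp add: conf_mat_def sym_matrix_simps X)
  ultimately have "trace (conf_mat (what z) p X) > 0" by (intro Gamma_1_imp_trace_pos)
  then show ?thesis by (simp add: conf_mat_def trace_sub trace_scaleR trace_I mult.commute)
qed

lemma jet2_radial:
  assumes "taylor2 g ((norm z)\<^sup>2) g1 g2"
  shows "jet2 (\<lambda>y. g ((norm y)\<^sup>2)) z ((2 * g1) *\<^sub>R z) ((2 * g1) *\<^sub>R mat 1 + (4 * g2) *\<^sub>R rank1 z)"
proof -
  have "rank1 (2 *\<^sub>R z) = 4 *\<^sub>R rank1 z" by (simp add: rank1_def vec_eq_iff)
  then show ?thesis
    using jet2_compose[OF jet2_norm_sq[of 0 z], of g g1 g2] assms by (simp add: mult.commute)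
qed

lemma DERIV_inverse_square:
  assumes "(u has_real_derivative u') (at s)" "u s \<noteq> 0"
  shows "((\<lambda>s. k / (u s)\<^sup>2) has_real_derivative - 2 * k * u' / (u s) ^ 3) (at s)"
  using assms by (auto intro!: derivative_eq_intros simp: field_simps power2_eq_square power3_eq_cube)

lemma DERIV_inverse_cube:
  fixes s :: real
  assumes "(u has_real_derivative \<epsilon> / s) (at s)" "u s \<noteq> 0" "s \<noteq> 0"
  shows "((\<lambda>s. c / (s * (u s) ^ 3)) has_real_derivative - c * (3 * \<epsilon> / (s\<^sup>2 * (u s) ^ 4) + 1 / (s\<^sup>2 * (u s) ^ 3))) (at s)"
proof -
  have "((\<lambda>s. c / (s * (u s) ^ 3)) has_real_derivative
      (0 * (s * (u s) ^ 3) - c * (1 * (u s) ^ 3 + (3 * (u s)\<^sup>2 * (\<epsilon> / s)) * s)) / ((s * (u s) ^ 3) * (s * (u s) ^ 3))) (at s)"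
    by (rule DERIV_divide DERIV_const DERIV_mult DERIV_ident)+
      (use assms in \<open>auto intro!: derivative_eq_intros\<close>)
  moreover have "(0 * (s * (u s) ^ 3) - c * (1 * (u s) ^ 3 + (3 * (u s)\<^sup>2 * (\<epsilon> / s)) * s)) / ((s * (u s) ^ 3) * (s * (u s) ^ 3))
      = - c * (3 * \<epsilon> / (s\<^sup>2 * (u s) ^ 4) + 1 / (s\<^sup>2 * (u s) ^ 3))"
    using assms(2,3) by (simp add: field_simps power2_eq_square power3_eq_cube power4_eq_xxxx)
  ultimately show ?thesis by simp
qed

text \<open>In terms of \<open>v\<close>, the barrier is a positive power of \<open>m + \<epsilon> ln |z|\<^sup>2\<close>; the power \<open>- 2\<close> of it is still a
  strict barrier for \<open>w\<close> in every dimension \<open>n \<ge> 3\<close>.\<close>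

lemma what_barrier:
  assumes M: "\<And>z. norm z = 1 \<Longrightarrow> what z * m\<^sup>2 \<le> 1" and m: "m > 0" and e: "\<epsilon> > 0"
    and z: "norm z \<le> 1" "z \<noteq> 0" "m + \<epsilon> * ln ((norm z)\<^sup>2) \<ge> 0"
  shows "what z * (m + \<epsilon> * ln ((norm z)\<^sup>2))\<^sup>2 \<le> 1"
proof (rule ccontr)
  assume neg: "\<not> ?thesis"
  define G where "G z = m + \<epsilon> * ln ((norm z)\<^sup>2)" for z :: "real^'n"
  \<comment> \<open>The radius at which m + \<epsilon> ln |z|^2 vanishes.\<close>
  define r0 where "r0 = exp (- m / (2 * \<epsilon>))"
  have r0: "r0 > 0" by (simp add: r0_def)
  have Gle: "G z \<ge> 0 \<longleftrightarrow> norm z \<ge> r0" and Gless: "G z > 0 \<longleftrightarrow> norm z > r0" if "z \<noteq> 0" for z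
  proof -
    have e': "exp (ln (norm z)) = norm z" using that by simp
    have "ln ((norm z)\<^sup>2) = 2 * ln (norm z)" using that by (simp add: ln_realpow)
    then have 1: "G z \<ge> 0 \<longleftrightarrow> ln (norm z) \<ge> - m / (2 * \<epsilon>)" "G z > 0 \<longleftrightarrow> ln (norm z) > - m / (2 * \<epsilon>)"
      using e by (auto simp: G_def field_simps)
    show "G z \<ge> 0 \<longleftrightarrow> norm z \<ge> r0" "G z > 0 \<longleftrightarrow> norm z > r0"
      unfolding 1 r0_def
      using exp_le_cancel_iff[of "- m / (2 * \<epsilon>)" "ln (norm z)"] exp_less_cancel_iff[of "- m / (2 * \<epsilon>)" "ln (norm z)"]
      unfolding e' by blast+
  qed
  define A where "A = {z::real^'n. r0 \<le> norm z \<and> norm z \<le> 1}"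
  have Anz: "0 \<notin> A" using r0 by (auto simp: A_def)
  have cA: "compact A"
  proof -
    have "closed {z::real^'n. r0 \<le> norm z}" by (intro closed_Collect_le continuous_intros)
    moreover have "A = cball 0 1 \<inter> {z. r0 \<le> norm z}" by (auto simp: A_def)
    ultimately show ?thesis by (simp add: compact_Int_closed)
  qed
  have zA: "z \<in> A" using z Gle[OF z(2)] by (simp add: A_def G_def)
  have "continuous_on A (\<lambda>z. what z * (G z)\<^sup>2)"
    unfolding G_def using Anz by (intro continuous_intros kelvin_continuous_on) auto
  \<comment> \<open>The product is at most 1 on the unit sphere by \<open>M\<close> and 0 at radius
    r0, so a value above 1 forces an interior maximum.\<close>
  then obtain zs where zs: "zs \<in> A" "\<And>y. y \<in> A \<Longrightarrow> what y * (G y)\<^sup>2 \<le> what zs * (G zs)\<^sup>2"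
    using continuous_attains_sup[OF cA] zA by blast
  define k where "k = what zs * (G zs)\<^sup>2"
  have k: "k > 1" using zs(2)[OF zA] neg by (simp add: k_def G_def)
  have zs0: "zs \<noteq> 0" using zs(1) Anz by auto
  have "norm zs \<noteq> 1"
  proof
    assume "norm zs = 1"
    then show False using M[of zs] k by (simp add: k_def G_def)
  qed
  moreover have "G zs \<noteq> 0" using k by (auto simp: k_def)
  then have Gp: "G zs > 0" using Gle[OF zs0] zs(1) by (simp add: A_def)
  ultimately have "norm zs < 1" "r0 < norm zs" using zs(1) Gless[OF zs0] by (auto simp: A_def)
  then have zo: "zs \<in> ball 0 1 - cball 0 r0" by simp
  define t where "t = (norm zs)\<^sup>2"
  have t: "t > 0" using zs0 by (simp add: t_def)
  let ?K = "G zs"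
  have K: "?K = m + \<epsilon> * ln t" by (simp add: G_def t_def)
  \<comment> \<open>As a function of s = |z|^2, the maximal value k over the square of the barrier;
    it touches \<open>what\<close> from above at zs.\<close>
  define g where "g s = k / (m + \<epsilon> * ln s)\<^sup>2" for s
  define g1 where "g1 s = - 2 * k * \<epsilon> / (s * (m + \<epsilon> * ln s) ^ 3)" for s
  define g2 where "g2 = k * (6 * \<epsilon>\<^sup>2 / (t\<^sup>2 * ?K ^ 4) + 2 * \<epsilon> / (t\<^sup>2 * ?K ^ 3))"
  have opS: "open {s. s > 0 \<and> m + \<epsilon> * ln s > 0}"
  proof -
    have "open ({0<..} \<inter> (\<lambda>s. m + \<epsilon> * ln s) -` {0<..})"
      by (intro continuous_open_preimage continuous_intros) auto
    moreover have "{0<..} \<inter> (\<lambda>s. m + \<epsilon> * ln s) -` {0<..} = {s. s > 0 \<and> m + \<epsilon> * ln s > 0}" by auto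
    ultimately show ?thesis by simp
  qed
  have T: "taylor2 g t (g1 t) g2"
  proof (rule taylor2_DERIV[OF opS])
    show "t \<in> {s. s > 0 \<and> m + \<epsilon> * ln s > 0}" using t Gp K by simp
    have ud: "((\<lambda>s. m + \<epsilon> * ln s) has_real_derivative \<epsilon> / s) (at s)" if "s > 0" for s
      using that by (auto intro!: derivative_eq_intros)
    show "(g has_real_derivative g1 s) (at s)" if "s \<in> {s. s > 0 \<and> m + \<epsilon> * ln s > 0}" for s
      using DERIV_inverse_square[OF ud[of s], of k] that unfolding g_def g1_def by (simp add: mult.commute)
    have "((\<lambda>s. (- 2 * k * \<epsilon>) / (s * (m + \<epsilon> * ln s) ^ 3)) has_real_derivative
        - (- 2 * k * \<epsilon>) * (3 * \<epsilon> / (t\<^sup>2 * (m + \<epsilon> * ln t) ^ 4) + 1 / (t\<^sup>2 * (m + \<epsilon> * ln t) ^ 3))) (at t)"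
      by (rule DERIV_inverse_cube[OF ud]) (use t Gp K in auto)
    moreover have "- (- 2 * k * \<epsilon>) * (3 * \<epsilon> / (t\<^sup>2 * (m + \<epsilon> * ln t) ^ 4) + 1 / (t\<^sup>2 * (m + \<epsilon> * ln t) ^ 3)) = g2"
      unfolding g2_def K by (simp add: algebra_simps power2_eq_square)
    ultimately show "(g1 has_real_derivative g2) (at t)" unfolding g1_def by simp
  qed
  define p where "p = (2 * g1 t) *\<^sub>R zs"
  define X where "X = (2 * g1 t) *\<^sub>R mat 1 + (4 * g2) *\<^sub>R rank1 zs"
  have J: "jet2 (\<lambda>y. g ((norm y)\<^sup>2)) zs p X" unfolding p_def X_def using jet2_radial T by (simp add: t_def)
  have Uzs: "g ((norm zs)\<^sup>2) = what zs" using Gp by (simp add: g_def k_def G_def)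
  have "open (ball 0 1 - cball 0 r0 :: (real^'n) set)" by (intro open_Diff) auto
  from eventually_nhds_in_open[OF this zo]
  have "\<forall>\<^sub>F y in nhds zs. what y \<le> g ((norm y)\<^sup>2)"
  proof eventually_elim
    case (elim y)
    then have y: "y \<in> A" "norm y > r0" by (auto simp: A_def)
    then have "G y > 0" using Gless[of y] Anz by auto
    moreover have "what y * (G y)\<^sup>2 \<le> k" using zs(2)[OF y(1)] by (simp add: k_def)
    ultimately show ?case by (simp add: g_def G_def[symmetric] le_divide_eq)
  qed
  from what_touched_from_above[OF zs0 _ J Uzs this]
  have ineq: "what zs * trace X > real CARD('n) / 2 * (norm p)\<^sup>2" by (simp add: X_def sym_matrix_simps)
  define n where "n = real CARD('n)"
  have n: "n \<ge> 3" using card_ge_3 by (simp add: n_def)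
  have "trace X = 2 * n * g1 t + 4 * g2 * t"
    by (simp add: X_def trace_add trace_scaleR trace_I trace_rank1 n_def t_def dot_square_norm)
  moreover have "(norm p)\<^sup>2 = 4 * (g1 t)\<^sup>2 * t" by (simp add: p_def power_mult_distrib t_def)
  moreover have "what zs = k / ?K\<^sup>2" using Uzs by (simp add: g_def G_def)
  ultimately have "k / ?K\<^sup>2 * (2 * n * g1 t + 4 * g2 * t) > n / 2 * (4 * (g1 t)\<^sup>2 * t)" using ineq by (simp add: n_def)
  moreover have "k / ?K\<^sup>2 * (2 * n * g1 t + 4 * g2 * t) = (k\<^sup>2 * \<epsilon> / (t * ?K ^ 6)) * ((8 - 4 * n) * ?K + 24 * \<epsilon>)"
  proof -
    have "k / H\<^sup>2 * (2 * n * (- 2 * k * \<epsilon> / (t * H ^ 3)) + 4 * (k * (6 * \<epsilon>\<^sup>2 / (t\<^sup>2 * H ^ 4) + 2 * \<epsilon> / (t\<^sup>2 * H ^ 3))) * t)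
        = (k\<^sup>2 * \<epsilon> / (t * H ^ 6)) * ((8 - 4 * n) * H + 24 * \<epsilon>)" if "H \<noteq> 0" for H
      using t that by (simp add: field_simps eval_nat_numeral)
    from this[of ?K] show ?thesis unfolding g1_def g2_def K[symmetric] using Gp by simp
  qed
  moreover have "n / 2 * (4 * (g1 t)\<^sup>2 * t) = (k\<^sup>2 * \<epsilon> / (t * ?K ^ 6)) * (8 * n * \<epsilon>)"
  proof -
    have "n / 2 * (4 * (- 2 * k * \<epsilon> / (t * H ^ 3))\<^sup>2 * t) = (k\<^sup>2 * \<epsilon> / (t * H ^ 6)) * (8 * n * \<epsilon>)" if "H \<noteq> 0" for H
      using t that by (simp add: field_simps eval_nat_numeral)
    from this[of ?K] show ?thesis unfolding g1_def K[symmetric] using Gp by simp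
  qed
  ultimately have "(k\<^sup>2 * \<epsilon> / (t * ?K ^ 6)) * (8 * n * \<epsilon>) < (k\<^sup>2 * \<epsilon> / (t * ?K ^ 6)) * ((8 - 4 * n) * ?K + 24 * \<epsilon>)" by simp
  moreover have "k\<^sup>2 * \<epsilon> / (t * ?K ^ 6) > 0" using k e t Gp by simp
  \<comment> \<open>Impossible for n \<ge> 3: the term in K is nonpositive and 24 \<le> 8 n.\<close>
  ultimately have "8 * n * \<epsilon> < (8 - 4 * n) * ?K + 24 * \<epsilon>"
    by (metis mult_less_cancel_left_pos)
  moreover have "(8 - 4 * n) * ?K \<le> 0" using n Gp by (simp add: mult_nonpos_nonneg)
  moreover have "24 * \<epsilon> \<le> 8 * n * \<epsilon>" using n e by simp
  ultimately show False by linarith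
qed

text \<open>Maximum principle on the punctured ball: letting \<epsilon> tend to 0 in
  \<open>what_barrier\<close> at fixed z bounds \<open>what\<close> by its maximum on the unit
  sphere.\<close>

lemma quadratic_growth:
  obtains b where "b > 0" "\<And>y. norm y \<ge> 1 \<Longrightarrow> w y \<le> b * (norm y)\<^sup>2"
proof -
  have "sphere (0::real^'n) 1 \<noteq> {}" using vector_choose_size[of 1] by (metis dist_0_norm empty_iff mem_sphere zero_le_one)
  moreover have "continuous_on (sphere 0 1) what" by (intro kelvin_continuous_on) auto
  ultimately obtain zM where zM: "zM \<in> sphere 0 1" "\<And>z. z \<in> sphere 0 1 \<Longrightarrow> what z \<le> what zM"
    using continuous_attains_sup[OF compact_sphere] by blast
  define M where "M = what zM"
  have M: "M > 0" unfolding M_def using zM(1) by (intro what_pos) auto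
  define m where "m = 1 / sqrt M"
  have m: "m > 0" "m\<^sup>2 = 1 / M" using M by (simp_all add: m_def power_divide)
  have bd: "what z \<le> M" if z: "norm z \<le> 1" "z \<noteq> 0" for z
  proof -
    have Mz: "what z * m\<^sup>2 \<le> 1" if "norm z = 1" for z
      using zM(2)[of z] that M by (simp add: m(2) M_def divide_le_eq)
    have lim: "((\<lambda>\<epsilon>. what z * (m + \<epsilon> * ln ((norm z)\<^sup>2))\<^sup>2) \<longlongrightarrow> what z * (m + 0 * ln ((norm z)\<^sup>2))\<^sup>2) (at_right 0)"
      by (intro tendsto_intros)
    have "((\<lambda>\<epsilon>. m + \<epsilon> * ln ((norm z)\<^sup>2)) \<longlongrightarrow> m + 0 * ln ((norm z)\<^sup>2)) (at_right 0)" by (intro tendsto_intros)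
    then have "\<forall>\<^sub>F \<epsilon> in at_right 0. m + \<epsilon> * ln ((norm z)\<^sup>2) > 0" using m(1) by (intro order_tendstoD(1)) auto
    moreover have "\<forall>\<^sub>F \<epsilon> in at_right (0::real). \<epsilon> > 0" by (simp add: eventually_at_filter)
    ultimately have "\<forall>\<^sub>F \<epsilon> in at_right 0. what z * (m + \<epsilon> * ln ((norm z)\<^sup>2))\<^sup>2 \<le> 1"
      by eventually_elim (use what_barrier[OF Mz m(1) _ z] in auto)
    from tendsto_upperbound[OF lim this] have "what z * m\<^sup>2 \<le> 1" by simp
    then show ?thesis using M by (simp add: m(2) divide_le_eq)
  qed
  show ?thesis
  proof (rule that[OF M])
    fix y :: "real^'n" assume y: "norm y \<ge> 1"
    then have y0: "y \<noteq> 0" by auto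
    have "what (inv_pt 1 y) \<le> M" using y y0 by (intro bd) (auto simp: norm_inv_pt inv_pt_nz)
    then have "(norm y)\<^sup>2 * what (inv_pt 1 y) \<le> (norm y)\<^sup>2 * M" by (intro mult_left_mono) auto
    moreover have "w y = (norm y)\<^sup>2 * what (inv_pt 1 y)"
      using kelvin_kelvin[of 1 y w] y0 by (simp add: kelvin_def[of 1 "kelvin 1 w"])
    ultimately show "w y \<le> M * (norm y)\<^sup>2" by (simp add: mult.commute)
  qed
qed

end

section \<open>Moving the centre of the spheres\<close>

lemma jet2_translate: "jet2 (\<lambda>y. W (a + y)) x p X \<longleftrightarrow> jet2 W (a + x) p X"
  by (simp add: jet2_def add.assoc)

lemma tested_translate:
  assumes "tested R Q UNIV w"
  shows "tested R Q UNIV (\<lambda>y. w (a + y))"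
  unfolding tested_def
proof (intro ballI allI impI)
  fix x p X W
  assume A: "transpose X = X" "jet2 W x p X" "W x = w (a + x)" "\<forall>\<^sub>F y in nhds x. R (w (a + y)) (W y)"
  have "jet2 (\<lambda>y. W (y - a)) (a + x) p X"
    using A(2) jet2_translate[of "\<lambda>y. W (y - a)" a x p X] by simp
  moreover have "\<forall>\<^sub>F k in nhds 0. R (w (a + (x + k))) (W (x + k))"
    using A(4) unfolding eventually_nhds_shift[of _ x] .
  then have "\<forall>\<^sub>F y in nhds (a + x). R (w y) (W (y - a))"
    unfolding eventually_nhds_shift[of _ "a + x"] by (simp add: add.assoc)
  ultimately show "Q (eigvals (conf_mat (w (a + x)) p X))"
    using assms[unfolded tested_def, rule_format, OF UNIV_I A(1), of "\<lambda>y. W (y - a)" "a + x" p] A(3) by simp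
qed

context conformal_solution
begin

lemma translated: "conformal_solution f \<Gamma> (\<lambda>y. w (a + y)) (\<lambda>y. Dw (a + y))"
proof unfold_locales
  show "w_supersolution f \<Gamma> UNIV (\<lambda>y. w (a + y))" by (rule tested_translate[OF w_super])
  show "w_subsolution f \<Gamma> UNIV (\<lambda>y. w (a + y))" by (rule tested_translate[OF w_sub])
  show "((\<lambda>y. w (a + y)) has_derivative (\<lambda>h. Dw (a + x) \<bullet> h)) (at x)" for x
    by (rule has_derivative_compose[of "\<lambda>y. a + y" "\<lambda>h. h" _ _ w, OF _ w_deriv]) (auto intro!: derivative_eq_intros)
  show "\<exists>L. L-lipschitz_on (cball 0 R) (\<lambda>y. Dw (a + y))" for R
  proof -
    obtain L where L: "L-lipschitz_on (cball 0 (norm a + R)) Dw" using Dw_lip by blast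
    have "L-lipschitz_on (cball 0 R) (\<lambda>y. Dw (a + y))"
    proof (rule lipschitz_onI)
      fix x y :: "real^'n" assume "x \<in> cball 0 R" "y \<in> cball 0 R"
      then have "a + x \<in> cball 0 (norm a + R)" "a + y \<in> cball 0 (norm a + R)"
        using norm_triangle_ineq[of a x] norm_triangle_ineq[of a y] by auto
      from lipschitz_onD[OF L this] show "dist (Dw (a + x)) (Dw (a + y)) \<le> L * dist x y" by simp
    qed (rule lipschitz_on_nonneg[OF L])
    then show ?thesis by blast
  qed
qed (rule w_pos)

end

subsection \<open>Classification\<close>

text \<open>The reflection of \<open>w\<close> in the sphere about x of squared radius \<mu>2, in
  the chart z = y / |y|^2 and multiplied by |z|^2. With Y = y - x one has |z|^2 Y = z - |z|^2 x and
  q z = |z|^2 |Y|^2, so this form is regular at z = 0.\<close>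

lemma inversion_chart_derivative:
  fixes w :: "'a::real_inner \<Rightarrow> real"
  assumes der: "(w has_derivative (\<lambda>h. D \<bullet> h)) (at x)" and mu: "\<mu>2 \<noteq> 0"
  defines "q \<equiv> \<lambda>z. 1 - 2 * (x \<bullet> z) + (x \<bullet> x) * (z \<bullet> z)"
  shows "((\<lambda>z. q z * w (x + \<mu>2 *\<^sub>R ((z - (z \<bullet> z) *\<^sub>R x) /\<^sub>R q z)) / \<mu>2) has_derivative
     (\<lambda>h. (D - (2 * (w x / \<mu>2)) *\<^sub>R x) \<bullet> h)) (at 0)"
proof -
  have q0: "q 0 = 1" by (simp add: q_def)
  have dq: "(q has_derivative (\<lambda>h. - 2 * (x \<bullet> h))) (at 0)"
    unfolding q_def by (auto intro!: derivative_eq_intros)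
  have dz: "((\<lambda>z. z - (z \<bullet> z) *\<^sub>R x) has_derivative (\<lambda>h. h)) (at 0)"
    by (auto intro!: derivative_eq_intros)
  have di: "((\<lambda>z. inverse (q z)) has_derivative (\<lambda>h. 2 * (x \<bullet> h))) (at 0)"
    using Deriv.has_derivative_inverse[OF _ dq] by (simp add: q0)
  have T0: "((\<lambda>z. inverse (q z) *\<^sub>R (z - (z \<bullet> z) *\<^sub>R x)) has_derivative (\<lambda>h. h)) (at 0)"
    using has_derivative_scaleR[OF di dz] by (simp add: q0)
  have dT: "((\<lambda>z. x + \<mu>2 *\<^sub>R ((z - (z \<bullet> z) *\<^sub>R x) /\<^sub>R q z)) has_derivative (\<lambda>h. \<mu>2 *\<^sub>R h)) (at 0)"
    using has_derivative_add[OF has_derivative_const[of x] has_derivative_scaleR_right[OF T0, of \<mu>2]] by simp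
  have "((\<lambda>z. w (x + \<mu>2 *\<^sub>R ((z - (z \<bullet> z) *\<^sub>R x) /\<^sub>R q z))) has_derivative (\<lambda>h. D \<bullet> (\<mu>2 *\<^sub>R h))) (at 0)"
    by (rule has_derivative_compose[OF dT]) (simp add: der)
  from has_derivative_mult[OF dq this]
  have "((\<lambda>z. q z * w (x + \<mu>2 *\<^sub>R ((z - (z \<bullet> z) *\<^sub>R x) /\<^sub>R q z))) has_derivative
      (\<lambda>h. D \<bullet> (\<mu>2 *\<^sub>R h) + - 2 * (x \<bullet> h) * w x)) (at 0)"
    by (simp add: q0)
  from bounded_linear.has_derivative[OF bounded_linear_divide this, of \<mu>2]
  have "((\<lambda>z. q z * w (x + \<mu>2 *\<^sub>R ((z - (z \<bullet> z) *\<^sub>R x) /\<^sub>R q z)) / \<mu>2) has_derivative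
      (\<lambda>h. (D \<bullet> (\<mu>2 *\<^sub>R h) + - 2 * (x \<bullet> h) * w x) / \<mu>2)) (at 0)" .
  moreover have "(\<lambda>h. (D \<bullet> (\<mu>2 *\<^sub>R h) + - 2 * (x \<bullet> h) * w x) / \<mu>2) = (\<lambda>h. (D - (2 * (w x / \<mu>2)) *\<^sub>R x) \<bullet> h)"
    using mu by (simp add: fun_eq_iff inner_diff_left field_simps)
  ultimately show ?thesis by simp
qed

section \<open>Upper limit of w y / |y|^2 and the critical radius\<close>

context conformal_solution
begin

text \<open>Eventual quadratic bounds; their infimum is the upper limit of w y / |y|^2. Taking b > 0
  makes it nonnegative at once.\<close>

definition growth_bounds :: "real set" where
  "growth_bounds = {b. b > 0 \<and> (\<exists>R. \<forall>y. norm y \<ge> R \<longrightarrow> w y \<le> b * (norm y)\<^sup>2)}"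

definition growth :: real where "growth = Inf growth_bounds"

lemma growth_bounds_ne: "growth_bounds \<noteq> {}"
proof -
  obtain b where "b > 0" "\<And>y. norm y \<ge> 1 \<Longrightarrow> w y \<le> b * (norm y)\<^sup>2" using quadratic_growth by blast
  then have "b \<in> growth_bounds" unfolding growth_bounds_def by blast
  then show ?thesis by blast
qed

lemma growth_bdd: "bdd_below growth_bounds"
  by (rule bdd_belowI[of _ 0]) (simp add: growth_bounds_def)

lemma growth_nonneg: "growth \<ge> 0"
  unfolding growth_def by (rule cInf_greatest[OF growth_bounds_ne]) (auto simp: growth_bounds_def)

lemma growth_upper:
  assumes "b > growth"
  shows "b \<in> growth_bounds"
proof -
  obtain b' where b': "b' \<in> growth_bounds" "b' < b"
    using assms cInf_less_iff[OF growth_bounds_ne growth_bdd] unfolding growth_def by auto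
  then obtain R where R: "b' > 0" "\<And>y. norm y \<ge> R \<Longrightarrow> w y \<le> b' * (norm y)\<^sup>2" by (auto simp: growth_bounds_def)
  have "w y \<le> b * (norm y)\<^sup>2" if "norm y \<ge> R" for y
  proof -
    have "b' * (norm y)\<^sup>2 \<le> b * (norm y)\<^sup>2" using b'(2) by (intro mult_right_mono) auto
    then show ?thesis using R(2)[OF that] by simp
  qed
  then show ?thesis using R(1) b'(2) unfolding growth_bounds_def by auto
qed

lemma growth_lower:
  assumes "b < growth" "b > 0"
  shows "\<exists>y. norm y \<ge> R \<and> w y > b * (norm y)\<^sup>2"
proof (rule ccontr)
  assume "\<not> ?thesis"
  then have "b \<in> growth_bounds" using assms(2) by (auto simp: growth_bounds_def not_less)
  then have "growth \<le> b" unfolding growth_def by (rule cInf_lower[OF _ growth_bdd])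
  then show False using assms(1) by simp
qed

lemma translated_growth:
  assumes "b > growth"
  shows "\<exists>R. \<forall>y. norm y \<ge> R \<longrightarrow> w (a + y) \<le> b * (norm y)\<^sup>2"
proof -
  obtain b' where b': "growth < b'" "b' < b" using dense[OF assms] by blast
  then have b0: "b' > 0" using growth_nonneg by simp
  obtain R where R: "\<And>y. norm y \<ge> R \<Longrightarrow> w y \<le> b' * (norm y)\<^sup>2"
    using growth_upper[OF b'(1)] by (auto simp: growth_bounds_def)
  \<comment> \<open>|a + y| \<le> s |y| for large y, and b' s^2 = b.\<close>
  define s where "s = sqrt (b / b')"
  have s: "s > 1" "s\<^sup>2 = b / b'" using b' b0 by (auto simp: s_def)
  define R' where "R' = max (R + norm a) (norm a / (s - 1))"
  have "w (a + y) \<le> b * (norm y)\<^sup>2" if y: "norm y \<ge> R'" for y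
  proof -
    have "norm y \<ge> R + norm a" using y by (simp add: R'_def)
    then have "norm (a + y) \<ge> R" using norm_triangle_sub[of y "- a"] by (simp add: add.commute)
    then have "w (a + y) \<le> b' * (norm (a + y))\<^sup>2" by (rule R)
    also have "norm (a + y) \<le> s * norm y"
    proof -
      have "norm a / (s - 1) \<le> norm y" using y by (simp add: R'_def)
      then have "norm a \<le> (s - 1) * norm y" using s(1) by (simp add: field_simps)
      then show ?thesis using norm_triangle_ineq[of a y] by (simp add: algebra_simps)
    qed
    then have "b' * (norm (a + y))\<^sup>2 \<le> b' * (s * norm y)\<^sup>2" using b0 by (intro mult_left_mono power_mono) auto
    also have "\<dots> = b * (norm y)\<^sup>2" using b0 by (simp add: power_mult_distrib s(2))
    finally show ?thesis by simp
  qed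
  then show ?thesis by blast
qed

lemma moving_sphere_strict:
  assumes mu: "\<mu> > 0" and lt: "growth * \<mu>\<^sup>2 < w a"
  shows "conformal_solution.below_kelvin (\<lambda>y. w (a + y)) \<mu>"
proof -
  interpret T: conformal_solution f \<Gamma> "\<lambda>y. w (a + y)" "\<lambda>y. Dw (a + y)" by (rule translated)
  have "growth < w a / \<mu>\<^sup>2" using mu lt by (simp add: less_divide_eq)
  then obtain b where b: "growth < b" "b < w a / \<mu>\<^sup>2" using dense by blast
  obtain R where R: "\<And>y. norm y \<ge> R \<Longrightarrow> w (a + y) \<le> b * (norm y)\<^sup>2" using translated_growth[OF b(1)] by blast
  show ?thesis
  proof (rule T.below_kelvin_all[OF mu _ R])
    show "b > 0" using b(1) growth_nonneg by simp
    show "b * \<mu>\<^sup>2 < w (a + 0)" using b(2) mu by (simp add: less_divide_eq)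
  qed
qed

lemma moving_sphere_critical:
  assumes g: "growth > 0" and mu: "\<mu> > 0" "growth * \<mu>\<^sup>2 = w a" and y: "norm y \<ge> \<mu>"
  shows "w (a + y) \<le> kelvin \<mu> (\<lambda>y. w (a + y)) y"
proof -
  interpret T: conformal_solution f \<Gamma> "\<lambda>y. w (a + y)" "\<lambda>y. Dw (a + y)" by (rule translated)
  have "T.below_kelvin \<mu>"
  proof (rule T.below_kelvin_limit[OF mu(1)])
    fix \<nu> assume nu: "0 < \<nu>" "\<nu> < \<mu>"
    have "\<nu>\<^sup>2 < \<mu>\<^sup>2" using nu by (intro power_strict_mono) auto
    then have "growth * \<nu>\<^sup>2 < w a" using g mu(2) by (metis mult_less_cancel_left_pos)
    then show "T.below_kelvin \<nu>" by (rule moving_sphere_strict[OF nu(1)])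
  qed
  then show ?thesis using y by (simp add: T.below_kelvin_def)
qed

lemma constant_if_no_growth:
  assumes g: "growth = 0"
  shows "\<exists>c. \<forall>x. w x = c"
proof -
  have slope: "Dw a \<bullet> y \<le> w a" for a y
  proof (cases "y = 0")
    case False
    define F where "F t = w (a - y + (1 - t) *\<^sub>R y) / (1 - t) - w a" for t
    have "((\<lambda>t. w (a - y + (1 - t) *\<^sub>R y)) has_derivative (\<lambda>s. Dw a \<bullet> (- s *\<^sub>R y))) (at 0)"
      by (rule has_derivative_compose[of "\<lambda>t. a - y + (1 - t) *\<^sub>R y" "\<lambda>s. - s *\<^sub>R y" _ _ w])
        (auto intro!: derivative_eq_intros simp: w_deriv)
    then have "((\<lambda>t. w (a - y + (1 - t) *\<^sub>R y)) has_real_derivative (- (Dw a \<bullet> y))) (at 0)"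
      unfolding has_field_derivative_def by (rule has_derivative_eq_rhs) (simp add: fun_eq_iff)
    then have "(F has_real_derivative (- (Dw a \<bullet> y) + w a)) (at 0)"
      unfolding F_def by (auto intro!: derivative_eq_intros)
    moreover have "F 0 = 0" by (simp add: F_def)
    moreover have "F t \<ge> 0" if t: "0 < t" "t < 1" for t
    proof -
      \<comment> \<open>With centre a - y and this radius the point a is reflected to a - t y, so
        the comparison at a reads F t \<ge> 0.\<close>
      define \<mu> where "\<mu> = sqrt (1 - t) * norm y"
      have mu: "\<mu> > 0" "\<mu>\<^sup>2 = (1 - t) * (norm y)\<^sup>2" using t False by (auto simp: \<mu>_def power_mult_distrib)
      have "\<mu> \<le> 1 * norm y" unfolding \<mu>_def using t by (intro mult_right_mono) auto
      then have "norm y \<ge> \<mu>" by simp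
      have "growth * \<mu>\<^sup>2 < w (a - y)" using g w_pos by simp
      from moving_sphere_strict[OF mu(1) this] \<open>norm y \<ge> \<mu>\<close>
      have "w (a - y + y) \<le> kelvin \<mu> (\<lambda>x. w (a - y + x)) y"
        unfolding conformal_solution.below_kelvin_def[OF translated] by blast
      moreover have "inv_pt \<mu> y = (1 - t) *\<^sub>R y" using False by (simp add: inv_pt_def mu(2))
      moreover have "(norm y)\<^sup>2 / \<mu>\<^sup>2 = 1 / (1 - t)" using False by (simp add: mu(2))
      ultimately show ?thesis by (simp add: kelvin_def F_def)
    qed
    ultimately have "- (Dw a \<bullet> y) + w a \<ge> 0"
      by (rule nonneg_right_imp_derivative_nonneg[where e = 1]) simp_all
    then show ?thesis by simp
  qed (simp add: w_pos less_imp_le)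
  have "Dw a = 0" for a
  proof (rule ccontr)
    assume "Dw a \<noteq> 0"
    then have p: "Dw a \<bullet> Dw a > 0" by simp
    \<comment> \<open>The multiple of Dw a at which the left-hand side equals w a + 1.\<close>
    have "Dw a \<bullet> (((w a + 1) / (Dw a \<bullet> Dw a)) *\<^sub>R Dw a) \<le> w a" by (rule slope)
    then show False using p by simp
  qed
  then have "(w has_derivative (\<lambda>h. 0)) (at x within UNIV)" for x using w_deriv[of x] by simp
  then have "\<exists>c. \<forall>x\<in>UNIV. w x = c" by (intro has_derivative_zero_constant) auto
  then show ?thesis by simp
qed

text \<open>The slope at z = 0 of the upper bound for \<open>what\<close> that the critical sphere
  about x provides.\<close>

definition Vec :: "real^'n \<Rightarrow> real^'n" where "Vec x = Dw x - (2 * growth) *\<^sub>R x"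

text \<open>The comparison at the critical radius about x, carried to the chart at infinity. Its
  right-hand side G is differentiable at 0, with value growth there because \<mu>^2 = w x /
  growth.\<close>

lemma what_upper_expansion:
  assumes g: "growth > 0" and e: "\<epsilon> > 0"
  shows "\<exists>r>0. \<forall>z. z \<noteq> 0 \<and> norm z \<le> r \<longrightarrow> what z \<le> growth + Vec x \<bullet> z + \<epsilon> * norm z"
proof -
  define \<mu>2 where "\<mu>2 = w x / growth"
  define \<mu> where "\<mu> = sqrt \<mu>2"
  have mu: "\<mu>2 > 0" "\<mu> > 0" "\<mu>\<^sup>2 = \<mu>2" using g w_pos[of x] by (simp_all add: \<mu>2_def \<mu>_def)
  have gm: "w x / \<mu>2 = growth" using g w_pos[of x] by (simp add: \<mu>2_def)
  define q where "q z = 1 - 2 * (x \<bullet> z) + (x \<bullet> x) * (z \<bullet> z)" for z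
  define G where "G z = q z * w (x + \<mu>2 *\<^sub>R ((z - (z \<bullet> z) *\<^sub>R x) /\<^sub>R q z)) / \<mu>2" for z
  have "(G has_derivative (\<lambda>h. Vec x \<bullet> h)) (at 0)"
    using inversion_chart_derivative[OF w_deriv[of x], of \<mu>2] mu(1)
    unfolding G_def[abs_def] q_def[symmetric] gm Vec_def by simp
  then obtain d where d: "d > 0" "\<And>z. norm z < d \<Longrightarrow> \<bar>G z - G 0 - Vec x \<bullet> z\<bar> \<le> \<epsilon> * norm z"
    using e unfolding has_derivative_at_alt by (metis diff_zero real_norm_def)
  have G0: "G 0 = growth" by (simp add: G_def q_def gm)
  \<comment> \<open>The second bound keeps the point with chart coordinate z at distance at least
    \<mu> from x.\<close>
  define r where "r = min (d / 2) (1 / (\<mu> + norm x + 1))"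
  have K: "\<mu> + norm x + 1 > 0" using mu(2) by (simp add: add_pos_nonneg)
  have r: "r > 0" using d(1) K by (simp add: r_def)
  have "what z \<le> growth + Vec x \<bullet> z + \<epsilon> * norm z" if z: "z \<noteq> 0" "norm z \<le> r" for z
  proof -
    define Y where "Y = inv_pt 1 z - x"
    have nz: "norm z > 0" using z by simp
    have "norm z * (\<mu> + norm x + 1) \<le> 1" using z(2) K by (simp add: r_def le_divide_eq)
    then have "\<mu> + norm x + 1 \<le> 1 / norm z" using nz by (simp add: field_simps)
    then have "norm Y \<ge> \<mu>"
      using norm_triangle_sub[of "inv_pt 1 z" x] unfolding Y_def by (simp add: norm_inv_pt)
    then have "w (x + Y) \<le> kelvin \<mu> (\<lambda>y. w (x + y)) Y"
      using moving_sphere_critical[OF g mu(2), of x Y] g mu(3) by (simp add: \<mu>2_def)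
    moreover have Yn: "Y \<noteq> 0" using \<open>norm Y \<ge> \<mu>\<close> mu(2) by auto
    have zz: "z \<bullet> z = (norm z)\<^sup>2" by (simp add: dot_square_norm)
    have zY: "(z \<bullet> z) *\<^sub>R Y = z - (z \<bullet> z) *\<^sub>R x"
      using nz by (simp add: Y_def inv_pt_def scaleR_diff_right zz)
    have qY: "q z = (norm z)\<^sup>2 * (norm Y)\<^sup>2"
    proof -
      have "(z \<bullet> z) * q z = (z - (z \<bullet> z) *\<^sub>R x) \<bullet> (z - (z \<bullet> z) *\<^sub>R x)"
        by (simp add: q_def inner_diff_left inner_diff_right inner_commute algebra_simps)
      also have "\<dots> = (z \<bullet> z) * ((z \<bullet> z) * (norm Y)\<^sup>2)"
        unfolding zY[symmetric] by (simp add: dot_square_norm power_mult_distrib)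
      finally have "q z = (z \<bullet> z) * (norm Y)\<^sup>2" using z(1) by simp
      then show ?thesis by (simp add: zz)
    qed
    have "inv_pt \<mu> Y = \<mu>2 *\<^sub>R ((z - (z \<bullet> z) *\<^sub>R x) /\<^sub>R q z)"
      unfolding zY[symmetric] using nz Yn by (simp add: inv_pt_def mu(3) qY zz divide_inverse)
    then have "(norm z)\<^sup>2 * kelvin \<mu> (\<lambda>y. w (x + y)) Y = G z"
      by (simp add: kelvin_def G_def qY mu(3))
    moreover have "what z = (norm z)\<^sup>2 * w (x + Y)" by (simp add: kelvin_def Y_def)
    ultimately have "what z \<le> G z" using mult_left_mono[of "w (x + Y)" _ "(norm z)\<^sup>2"] by fastforce
    moreover have "\<bar>G z - growth - Vec x \<bullet> z\<bar> \<le> \<epsilon> * norm z"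
      using d(2)[of z] z(2) d(1) by (simp add: G0 r_def)
    ultimately show ?thesis by linarith
  qed
  then show ?thesis using r by blast
qed

lemma taylor2_log_barrier:
  assumes "t > 0"
  shows "taylor2 (\<lambda>s. - \<epsilon> * ln s + c) t (- \<epsilon> / t) (\<epsilon> / t\<^sup>2)"
proof (rule taylor2_DERIV[of "{0<..}"])
  show "((\<lambda>s. - \<epsilon> * ln s + c) has_real_derivative - \<epsilon> / s) (at s)" if "s \<in> {0<..}" for s
    using that by (auto intro!: derivative_eq_intros)
  show "((\<lambda>s. - \<epsilon> / s) has_real_derivative \<epsilon> / t\<^sup>2) (at t)"
    using assms by (auto intro!: derivative_eq_intros simp: power2_eq_square)
qed (use assms in auto)

text \<open>Trace-free symmetric quadratic forms plus a multiple of \<open>- ln |z|\<close> are superharmonic, and the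
  logarithm absorbs the puncture.\<close>

lemma what_le_harmonic:
  fixes M :: "real^'n^'n"
  assumes r: "r > 0" and M: "transpose M = M" "trace M = 0" and bd: "\<And>z. z \<noteq> 0 \<Longrightarrow> norm z \<le> r \<Longrightarrow> what z \<le> B"
    and bdry: "\<And>z. norm z = r \<Longrightarrow> what z \<le> c + b \<bullet> z + (z \<bullet> (M *v z)) / 2"
    and z: "z \<noteq> 0" "norm z \<le> r"
  shows "what z \<le> c + b \<bullet> z + (z \<bullet> (M *v z)) / 2"
proof -
  define Q where "Q z = c + b \<bullet> z + (z \<bullet> (M *v z)) / 2" for z
  have contQ: "continuous_on S Q" for S
    unfolding Q_def by (intro continuous_intros continuous_on_compose2[OF matrix_vector_mult_linear_continuous_on]) auto
  obtain C where C: "\<And>z. norm z \<le> r \<Longrightarrow> - C \<le> Q z"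
  proof -
    obtain zm where "\<And>z. z \<in> cball 0 r \<Longrightarrow> Q zm \<le> Q z"
      using continuous_attains_inf[OF compact_cball _ contQ, of 0 r] r by force
    then show ?thesis using that[of "- Q zm"] by simp
  qed
  have main: "what z \<le> Q z + (- \<epsilon> * ln ((norm z)\<^sup>2) + \<epsilon> * ln (r\<^sup>2))" if e: "\<epsilon> > 0" for \<epsilon>
  proof (rule ccontr)
    assume neg: "\<not> ?thesis"
    define L where "L z = - \<epsilon> * ln ((norm z)\<^sup>2) + \<epsilon> * ln (r\<^sup>2)" for z :: "real^'n"
    \<comment> \<open>Larger than B + C: inside radius r' the logarithm exceeds E, so Q + L > B
      there and the maximum stays away from the puncture.\<close>
    define E where "E = max 0 (B + C) + 1"
    define r' where "r' = min (norm z) (r * exp (- E / (2 * \<epsilon>)))"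
    have E: "E > 0" "B + C < E" by (auto simp: E_def)
    have r': "r' > 0" "r' \<le> norm z" "r' \<le> r * exp (- E / (2 * \<epsilon>))" using z r by (auto simp: r'_def)
    have near: "what y < Q y + L y" if y: "y \<noteq> 0" "norm y \<le> r'" for y
    proof -
      have "ln (norm y) \<le> ln (r * exp (- E / (2 * \<epsilon>)))" using y r'(3) by (intro ln_mono) auto
      also have "\<dots> = ln r - E / (2 * \<epsilon>)" using r by (simp add: ln_mult)
      finally have "\<epsilon> * (2 * ln (norm y)) \<le> \<epsilon> * (2 * ln r - E / \<epsilon>)" using e by (intro mult_left_mono) (auto simp: field_simps)
      also have "\<dots> = \<epsilon> * (2 * ln r) - E" using e by (simp add: field_simps)
      finally have "L y \<ge> E" using y r by (simp add: L_def ln_realpow)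
      moreover have "norm y \<le> r" using y r' z by linarith
      ultimately show ?thesis using bd[OF y(1)] C[of y] E(2) by fastforce
    qed
    define A where "A = {y::real^'n. r' \<le> norm y \<and> norm y \<le> r}"
    have Anz: "0 \<notin> A" using r' by (auto simp: A_def)
    have cA: "compact A"
    proof -
      have "closed {y::real^'n. r' \<le> norm y}" by (intro closed_Collect_le continuous_intros)
      moreover have "A = cball 0 r \<inter> {y. r' \<le> norm y}" by (auto simp: A_def)
      ultimately show ?thesis by (simp add: compact_Int_closed)
    qed
    have zA: "z \<in> A" using z r' by (simp add: A_def)
    have "continuous_on A (\<lambda>y. what y - (Q y + L y))"
      unfolding L_def using Anz by (intro continuous_intros kelvin_continuous_on contQ) auto
    then obtain y where y: "y \<in> A" "\<And>x. x \<in> A \<Longrightarrow> what x - (Q x + L x) \<le> what y - (Q y + L y)"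
      using continuous_attains_sup[OF cA] zA by blast
    define k where "k = what y - (Q y + L y)"
    have k: "k > 0" using y(2)[OF zA] neg by (simp add: k_def L_def)
    have y0: "y \<noteq> 0" using y(1) Anz by auto
    have "norm y \<noteq> r" using bdry[of y] k by (auto simp: k_def Q_def L_def)
    moreover have "\<not> norm y \<le> r'" using near[OF y0] k by (auto simp: k_def)
    ultimately have yo: "y \<in> ball 0 r - cball 0 r'" using y(1) by (auto simp: A_def)
    define t where "t = (norm y)\<^sup>2"
    have t: "t > 0" using y0 by (simp add: t_def)
    have JL: "jet2 L y ((2 * (- \<epsilon> / t)) *\<^sub>R y) ((2 * (- \<epsilon> / t)) *\<^sub>R mat 1 + (4 * (\<epsilon> / t\<^sup>2)) *\<^sub>R rank1 y)"
      unfolding L_def[abs_def] using jet2_radial[OF taylor2_log_barrier[of "(norm y)\<^sup>2" \<epsilon> "\<epsilon> * ln (r\<^sup>2)"]] t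
      unfolding t_def by simp
    have JQ: "jet2 (\<lambda>z. Q z + k) y (b + M *v y) M"
      using jet2_affine_quadratic[OF M(1), of "c + k" b 0 y] by (simp add: Q_def[abs_def] ac_simps)
    note J = jet2_add[OF JQ JL]
    have "open (ball 0 r - cball 0 r' :: (real^'n) set)" by (intro open_Diff) auto
    from eventually_nhds_in_open[OF this yo]
    have "\<forall>\<^sub>F x in nhds y. what x \<le> Q x + k + L x"
    proof eventually_elim
      case (elim x)
      then have "x \<in> A" by (auto simp: A_def)
      from y(2)[OF this] show ?case by (simp add: k_def)
    qed
    from what_touched_from_above[OF y0 _ J _ this]
    have "what y * trace (M + ((2 * (- \<epsilon> / t)) *\<^sub>R mat 1 + (4 * (\<epsilon> / t\<^sup>2)) *\<^sub>R rank1 y))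
       > real CARD('n) / 2 * (norm (b + M *v y + (2 * (- \<epsilon> / t)) *\<^sub>R y))\<^sup>2"
      by (simp add: sym_matrix_simps M(1) k_def)
    then have "what y * trace (M + ((2 * (- \<epsilon> / t)) *\<^sub>R mat 1 + (4 * (\<epsilon> / t\<^sup>2)) *\<^sub>R rank1 y)) > 0"
      by (rule le_less_trans[rotated]) simp
    then have "trace (M + ((2 * (- \<epsilon> / t)) *\<^sub>R mat 1 + (4 * (\<epsilon> / t\<^sup>2)) *\<^sub>R rank1 y)) > 0"
      using what_pos[OF y0] by (simp add: zero_less_mult_iff)
    moreover have "trace (M + ((2 * (- \<epsilon> / t)) *\<^sub>R mat 1 + (4 * (\<epsilon> / t\<^sup>2)) *\<^sub>R rank1 y)) = (4 - 2 * real CARD('n)) * (\<epsilon> / t)"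
    proof -
      have "y \<bullet> y = t" by (simp add: t_def dot_square_norm)
      then show ?thesis using t by (simp add: trace_add trace_sub trace_scaleR trace_I trace_rank1 M(2) power2_eq_square field_simps)
    qed
    moreover have "(4 - 2 * real CARD('n)) * (\<epsilon> / t) \<le> 0" using card_ge_3 e t by (intro mult_nonpos_nonneg) auto
    ultimately show False by simp
  qed
  have "((\<lambda>\<epsilon>. Q z + (- \<epsilon> * ln ((norm z)\<^sup>2) + \<epsilon> * ln (r\<^sup>2))) \<longlongrightarrow> Q z + (- 0 * ln ((norm z)\<^sup>2) + 0 * ln (r\<^sup>2))) (at_right 0)"
    by (intro tendsto_intros)
  moreover have "\<forall>\<^sub>F \<epsilon> in at_right (0::real). what z \<le> Q z + (- \<epsilon> * ln ((norm z)\<^sup>2) + \<epsilon> * ln (r\<^sup>2))"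
    using main by (auto simp: eventually_at_filter)
  ultimately have "what z \<le> Q z + (- 0 * ln ((norm z)\<^sup>2) + 0 * ln (r\<^sup>2))"
    by (rule tendsto_lowerbound) simp
  then show ?thesis by (simp add: Q_def)
qed

text \<open>Two vectors V + d and V - d bound \<open>what\<close> by growth + V . z - |d . z| up to
  a small error. On a small sphere |d . z| dominates k (d . z)^2, whose trace-free part is harmonic
  and whose mean is D r / n. By \<open>what_le_harmonic\<close> the upper limit at 0 drops below
  growth.\<close>

lemma Vec_constant:
  assumes g: "growth > 0"
  shows "Vec x1 = Vec x2"
proof (rule ccontr)
  assume ne: "Vec x1 \<noteq> Vec x2"
  define d where "d = (Vec x1 - Vec x2) /\<^sub>R 2"
  define V where "V = (Vec x1 + Vec x2) /\<^sub>R 2"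
  define D where "D = norm d"
  define n where "n = real CARD('n)"
  have n: "n \<ge> 3" using card_ge_3 by (simp add: n_def)
  have D: "D > 0" using ne by (simp add: D_def d_def)
  have V12: "Vec x1 = V + d" "Vec x2 = V - d"
    by (simp_all add: V_def d_def vec_eq_iff field_simps)
  \<comment> \<open>Makes the error \<sigma> r smaller than the mean D r / n.\<close>
  define \<sigma> where "\<sigma> = D / (4 * n)"
  have \<sigma>: "\<sigma> > 0" using D n by (simp add: \<sigma>_def)
  obtain r1 where r1: "r1 > 0" "\<And>z. z \<noteq> 0 \<Longrightarrow> norm z \<le> r1 \<Longrightarrow> what z \<le> growth + Vec x1 \<bullet> z + \<sigma> * norm z"
    using what_upper_expansion[OF g \<sigma>, of x1] by blast
  obtain r2 where r2: "r2 > 0" "\<And>z. z \<noteq> 0 \<Longrightarrow> norm z \<le> r2 \<Longrightarrow> what z \<le> growth + Vec x2 \<bullet> z + \<sigma> * norm z"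
    using what_upper_expansion[OF g \<sigma>, of x2] by blast
  define r where "r = min r1 r2"
  have r: "r > 0" using r1 r2 by (simp add: r_def)
  have up: "what z \<le> growth + V \<bullet> z - \<bar>d \<bullet> z\<bar> + \<sigma> * norm z" if z: "z \<noteq> 0" "norm z \<le> r" for z
  proof -
    have "what z \<le> growth + (V \<bullet> z + d \<bullet> z) + \<sigma> * norm z" "what z \<le> growth + (V \<bullet> z - d \<bullet> z) + \<sigma> * norm z"
      using r1(2)[of z] r2(2)[of z] z by (auto simp: r_def V12 inner_add_left inner_diff_left)
    then show ?thesis by linarith
  qed
  \<comment> \<open>Since |d . y| \<le> D r on the sphere of radius r, this k gives k (d . y)^2
    \<le> |d . y|.\<close>
  define k where "k = 1 / (D * r)"
  have k: "k > 0" using D r by (simp add: k_def)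
  define M :: "real^'n^'n" where "M = (2 * k) *\<^sub>R ((D\<^sup>2 / n) *\<^sub>R mat 1 - rank1 d)"
  define c where "c = growth - D * r / n + \<sigma> * r"
  have qM: "z \<bullet> (M *v z) / 2 = - k * (d \<bullet> z)\<^sup>2 + k * D\<^sup>2 / n * (norm z)\<^sup>2" for z
    using n by (simp add: M_def quad_form_simps inner_simps dot_square_norm power2_eq_square inner_commute field_simps)
  have tM: "transpose M = M" by (simp add: M_def sym_matrix_simps)
  have trM: "trace M = 0"
    using n by (simp add: M_def trace_scaleR trace_sub trace_I trace_rank1 n_def D_def dot_square_norm)
  have kD: "k * D\<^sup>2 * r\<^sup>2 = D * r" using D r by (simp add: k_def power2_eq_square)
  have le: "what z \<le> c + V \<bullet> z + (z \<bullet> (M *v z)) / 2" if z: "z \<noteq> 0" "norm z \<le> r" for z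
  proof (rule what_le_harmonic[OF r tM trM _ _ z])
    fix y :: "real^'n" assume y: "y \<noteq> 0" "norm y \<le> r"
    have "V \<bullet> y \<le> norm V * r" using norm_cauchy_schwarz[of V y] mult_left_mono[OF y(2), of "norm V"] by simp
    moreover have "\<sigma> * norm y \<le> \<sigma> * r" using y(2) \<sigma> by (intro mult_left_mono) auto
    ultimately show "what y \<le> growth + norm V * r + \<sigma> * r" using up[OF y] by linarith
  next
    fix y :: "real^'n" assume y: "norm y = r"
    then have "y \<noteq> 0" using r by auto
    have "\<bar>d \<bullet> y\<bar> \<le> D * r" using Cauchy_Schwarz_ineq2[of d y] by (simp add: D_def y)
    then have "\<bar>d \<bullet> y\<bar> * \<bar>d \<bullet> y\<bar> \<le> \<bar>d \<bullet> y\<bar> * (D * r)" by (intro mult_left_mono) auto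
    then have "k * (d \<bullet> y)\<^sup>2 \<le> k * (\<bar>d \<bullet> y\<bar> * (D * r))" using k by (intro mult_left_mono) (auto simp: power2_eq_square)
    also have "\<dots> = \<bar>d \<bullet> y\<bar>" using D r by (simp add: k_def)
    finally have kd: "k * (d \<bullet> y)\<^sup>2 \<le> \<bar>d \<bullet> y\<bar>" .
    have e: "k * D\<^sup>2 / n * (norm y)\<^sup>2 = D * r / n" using kD by (simp add: y)
    show "what y \<le> c + V \<bullet> y + (y \<bullet> (M *v y)) / 2"
      using up[OF \<open>y \<noteq> 0\<close>, unfolded y] kd unfolding qM c_def e by linarith
  qed
  have c: "c < growth"
  proof -
    have "\<sigma> * r < D * r / n" using D r n by (simp add: \<sigma>_def field_simps)
    then show ?thesis by (simp add: c_def)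
  qed
  \<comment> \<open>Strictly between c and growth, and positive as \<open>growth_lower\<close>
    demands.\<close>
  define b where "b = (max c 0 + growth) / 2"
  have b: "b > 0" "c < b" "b < growth" using c g by (auto simp: b_def)
  have "isCont (\<lambda>z. c + V \<bullet> z + (z \<bullet> (M *v z)) / 2) 0"
    by (intro continuous_intros linear_continuous_at matrix_vector_mul_bounded_linear) simp
  then have "((\<lambda>z. c + V \<bullet> z + (z \<bullet> (M *v z)) / 2) \<longlongrightarrow> c + V \<bullet> 0 + (0 \<bullet> (M *v 0)) / 2) (nhds 0)"
    using tendsto_at_iff_tendsto_nhds[of "\<lambda>z. c + V \<bullet> z + (z \<bullet> (M *v z)) / 2" 0] unfolding isCont_def by blast
  then have "\<forall>\<^sub>F z in nhds 0. c + V \<bullet> z + (z \<bullet> (M *v z)) / 2 < b" using b(2) by (intro order_tendstoD) simp_all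
  then obtain s where s: "s > 0" "\<And>z. norm z < s \<Longrightarrow> c + V \<bullet> z + (z \<bullet> (M *v z)) / 2 < b"
    unfolding eventually_nhds_metric by auto
  define R where "R = max (1 / r) (2 / s)"
  have R0: "R > 0" using r by (simp add: R_def less_max_iff_disj)
  obtain y where y: "norm y \<ge> R" "w y > b * (norm y)\<^sup>2" using growth_lower[OF b(3,1)] by blast
  have yn: "norm y > 0" using y(1) R0 by linarith
  define z where "z = inv_pt 1 y"
  have z0: "z \<noteq> 0" using yn by (simp add: z_def inv_pt_nz)
  have zn: "norm z = 1 / norm y" by (simp add: z_def norm_inv_pt)
  have "1 / norm y \<le> r" "1 / norm y < s"
  proof -
    have "1 / r \<le> norm y" "2 / s \<le> norm y" using y(1) by (auto simp: R_def)
    then have "1 \<le> norm y * r" "2 \<le> norm y * s" using r s(1) by (auto simp: divide_le_eq)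
    then show "1 / norm y \<le> r" "1 / norm y < s" using yn by (auto simp: divide_le_eq divide_less_eq mult.commute)
  qed
  then have "what z < b" using le[OF z0] s(2)[of z] zn by fastforce
  moreover have "what z = (1 / norm y)\<^sup>2 * w y"
    using yn by (simp add: kelvin_def zn[symmetric]) (simp add: z_def inv_pt_inv_pt)
  then have "what z > b" using y(2) yn by (simp add: power_divide less_divide_eq mult.commute)
  ultimately show False by simp
qed

theorem classification:
  "(\<exists>c. \<forall>x. w x = c) \<or> (\<exists>x0 c b. c > 0 \<and> b > 0 \<and> (\<forall>x. w x = c + b * (norm (x - x0))\<^sup>2))"
proof (cases "growth = 0")
  case True
  then show ?thesis using constant_if_no_growth by blast
next
  case False
  then have g: "growth > 0" using growth_nonneg by simp
  define V where "V = Vec 0"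
  have Dw: "Dw x = (2 * growth) *\<^sub>R x + V" for x
    using Vec_constant[OF g, of x 0] by (simp add: Vec_def V_def algebra_simps)
  \<comment> \<open>The zero of the affine gradient Dw, hence the centre of the solution.\<close>
  define x0 where "x0 = (- 1 / (2 * growth)) *\<^sub>R V"
  have V: "V = - (2 * growth) *\<^sub>R x0" using g by (simp add: x0_def)
  have d: "((\<lambda>x. w x - growth * (norm (x - x0))\<^sup>2) has_derivative (\<lambda>h. 0)) (at x within UNIV)" for x
  proof -
    have "((\<lambda>x. w x - growth * ((x - x0) \<bullet> (x - x0))) has_derivative (\<lambda>h. Dw x \<bullet> h - growth * (2 * ((x - x0) \<bullet> h)))) (at x)"
      by (auto intro!: derivative_eq_intros w_deriv simp: fun_eq_iff inner_commute)
    moreover have "(\<lambda>h. Dw x \<bullet> h - growth * (2 * ((x - x0) \<bullet> h))) = (\<lambda>h. 0)"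
      by (simp add: Dw V fun_eq_iff inner_diff_left inner_add_left algebra_simps)
    ultimately show ?thesis by (simp add: power2_norm_eq_inner)
  qed
  then have "\<exists>c. \<forall>x\<in>UNIV. w x - growth * (norm (x - x0))\<^sup>2 = c"
    by (intro has_derivative_zero_constant) auto
  then obtain c where c: "\<And>x. w x = c + growth * (norm (x - x0))\<^sup>2" by (auto simp: algebra_simps)
  have "c > 0" using c[of x0] w_pos[of x0] by simp
  then show ?thesis using c g by blast
qed

end

section \<open>Passing from \<open>v\<close> to its power \<open>w\<close>\<close>

lemma linear_eq_inner_axis:
  fixes T :: "real^'n \<Rightarrow> real"
  assumes "linear T"
  shows "T h = (\<chi> i. T (axis i 1)) \<bullet> h"
proof -
  have "h = (\<Sum>i\<in>UNIV. (h $ i) *\<^sub>R axis i 1)"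
    using basis_expansion[of h] by (simp add: scalar_mult_eq_scaleR)
  then have "T h = T (\<Sum>i\<in>UNIV. (h $ i) *\<^sub>R axis i 1)" by simp
  also have "\<dots> = (\<Sum>i\<in>UNIV. h $ i * T (axis i 1))"
    by (simp add: linear_sum[OF assms] linear_cmul[OF assms])
  finally show ?thesis by (simp add: inner_vec_def mult.commute)
qed

lemma grad_has_derivative:
  fixes v :: "real^'n \<Rightarrow> real"
  assumes "v differentiable (at x)"
  shows "(v has_derivative (\<lambda>h. grad v x \<bullet> h)) (at x)"
proof -
  have d: "(v has_derivative frechet_derivative v (at x)) (at x)" using assms frechet_derivative_works by blast
  have "frechet_derivative v (at x) h = grad v x \<bullet> h" for h
    unfolding grad_def using linear_eq_inner_axis[OF linear_frechet_derivative[OF assms]] .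
  then have "frechet_derivative v (at x) = (\<lambda>h. grad v x \<bullet> h)" by blast
  then show ?thesis using d by simp
qed

lemma lipschitz_on_scaleR:
  fixes c :: "'a::metric_space \<Rightarrow> real" and G :: "'a \<Rightarrow> 'b::real_normed_vector"
  assumes "B-lipschitz_on S c" "L-lipschitz_on S G" and bd: "\<And>x. x \<in> S \<Longrightarrow> \<bar>c x\<bar> \<le> M" "\<And>x. x \<in> S \<Longrightarrow> norm (G x) \<le> N"
    and MN: "M \<ge> 0" "N \<ge> 0"
  shows "(M * L + B * N)-lipschitz_on S (\<lambda>x. c x *\<^sub>R G x)"
proof (rule lipschitz_onI)
  fix x y assume xy: "x \<in> S" "y \<in> S"
  have "c x *\<^sub>R G x - c y *\<^sub>R G y = c x *\<^sub>R (G x - G y) + (c x - c y) *\<^sub>R G y" by (simp add: algebra_simps)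
  then have "norm (c x *\<^sub>R G x - c y *\<^sub>R G y) \<le> \<bar>c x\<bar> * norm (G x - G y) + \<bar>c x - c y\<bar> * norm (G y)"
    by (metis norm_scaleR norm_triangle_ineq)
  also have "\<dots> \<le> M * (L * dist x y) + (B * dist x y) * N"
    using bd xy lipschitz_onD[OF assms(1) xy] lipschitz_onD[OF assms(2) xy] MN
      mult_nonneg_nonneg[OF lipschitz_on_nonneg[OF assms(1)] zero_le_dist[of x y]]
    by (intro add_mono mult_mono) (auto simp: dist_norm)
  finally show "dist (c x *\<^sub>R G x) (c y *\<^sub>R G y) \<le> (M * L + B * N) * dist x y"
    by (simp add: dist_norm algebra_simps)
next
  show "0 \<le> M * L + B * N"
    using MN lipschitz_on_nonneg[OF assms(1)] lipschitz_on_nonneg[OF assms(2)] by simp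
qed

lemma powr_has_derivative:
  fixes v :: "real^'n \<Rightarrow> real"
  assumes "v differentiable (at x)" "v x > 0"
  shows "((\<lambda>y. v y powr a) has_derivative (\<lambda>h. ((a * v x powr (a - 1)) *\<^sub>R grad v x) \<bullet> h)) (at x)"
proof -
  have "((\<lambda>s. s powr a) has_derivative (\<lambda>s. s * (a * v x powr (a - 1)))) (at (v x))"
    using has_real_derivative_powr[OF assms(2), of a] by (simp add: has_field_derivative_def mult_commute_abs)
  from has_derivative_compose[OF grad_has_derivative[OF assms(1)] this]
  show ?thesis by (simp add: mult.commute)
qed

text \<open>The scalar factor is Lipschitz on balls by the mean value inequality, the gradient by
  hypothesis; both are bounded there, so the product is Lipschitz.\<close>

lemma C11_powr:
  fixes v :: "real^'n \<Rightarrow> real"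
  assumes v: "C11_loc_on UNIV v" and pos: "\<And>x. v x > 0"
  shows "\<exists>L. L-lipschitz_on (cball 0 R) (\<lambda>x. (a * v x powr (a - 1)) *\<^sub>R grad v x)"
proof -
  let ?K = "cball (0::real^'n) R"
  have diff: "v differentiable (at x)" for x using v by (simp add: C11_loc_on_def)
  have contv: "continuous_on S v" for S
    using grad_has_derivative[OF diff] has_derivative_continuous continuous_at_imp_continuous_on by blast
  obtain L where L: "L-lipschitz_on ?K (grad v)"
    using v compact_cball unfolding C11_loc_on_def by blast
  have contg: "continuous_on ?K (grad v)" by (rule lipschitz_on_continuous_on[OF L])
  obtain N where N: "N > 0" "\<And>x. x \<in> ?K \<Longrightarrow> norm (grad v x) \<le> N"
    using compact_imp_bounded[OF compact_continuous_image[OF contg compact_cball]] by (auto simp: bounded_pos)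
  define c where "c x = a * v x powr (a - 1)" for x
  have contc: "continuous_on ?K c"
    unfolding c_def using pos by (intro continuous_intros contv) (metis less_irrefl)
  obtain M where M: "M > 0" "\<And>x. x \<in> ?K \<Longrightarrow> \<bar>c x\<bar> \<le> M"
    using compact_imp_bounded[OF compact_continuous_image[OF contc compact_cball]] by (auto simp: bounded_pos)
  define Dc where "Dc x = (a * ((a - 1) * v x powr (a - 1 - 1))) *\<^sub>R grad v x" for x
  have contD: "continuous_on ?K Dc"
    unfolding Dc_def using pos by (intro continuous_intros contv contg) (metis less_irrefl)
  obtain B where B: "B > 0" "\<And>x. x \<in> ?K \<Longrightarrow> norm (Dc x) \<le> B"
    using compact_imp_bounded[OF compact_continuous_image[OF contD compact_cball]] by (auto simp: bounded_pos)
  have dc: "(c has_derivative (\<lambda>h. Dc x \<bullet> h)) (at x)" for x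
    using has_derivative_mult_right[OF powr_has_derivative[OF diff pos, of "a - 1" x], of a]
    by (simp add: c_def[abs_def] Dc_def mult.assoc)
  have "B-lipschitz_on ?K c"
  proof (rule lipschitz_onI)
    fix x y assume "x \<in> ?K" "y \<in> ?K"
    then have "norm (c x - c y) \<le> B * norm (x - y)"
    proof (intro differentiable_bound[OF convex_cball, of 0 R c "\<lambda>x h. Dc x \<bullet> h" B x y])
      show "onorm (\<lambda>h. Dc z \<bullet> h) \<le> B" if "z \<in> ?K" for z
      proof (rule onorm_le)
        fix h
        have "norm (Dc z \<bullet> h) \<le> norm (Dc z) * norm h" by (simp add: Cauchy_Schwarz_ineq2)
        also have "\<dots> \<le> B * norm h" using B(2)[OF that] by (rule mult_right_mono) simp
        finally show "norm (Dc z \<bullet> h) \<le> B * norm h" .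
      qed
    qed (auto intro: has_derivative_at_withinI[OF dc])
    then show "dist (c x) (c y) \<le> B * dist x y" by (simp add: dist_norm)
  qed (use B in simp)
  from lipschitz_on_scaleR[OF this L M(2) N(2)] M(1) N(1) show ?thesis
    unfolding c_def by (auto simp: less_imp_le)
qed

theorem corollary1p4:
  fixes f :: "real^'n \<Rightarrow> real" and \<Gamma> :: "(real^'n) set" and v :: "real^'n \<Rightarrow> real"
  assumes "CARD('n) \<ge> 3"
    and "open \<Gamma>"
    and "continuous_on (closure \<Gamma>) f"
    and "cond_S1 f \<Gamma>" "cond_S2 f \<Gamma>" "cond_S3 f \<Gamma>" "cond_S4 f \<Gamma>" "cond_S5 f \<Gamma>" "cond_S6 \<Gamma>"
    and "C11_loc_on UNIV v"
    and "viscosity_solution f \<Gamma> UNIV v"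
  shows "(\<exists>c. \<forall>x. v x = c) \<or>
    (\<exists>x0 a b. a > 0 \<and> b > 0 \<and>
      (\<forall>x. v x = (a / (1 + b\<^sup>2 * (norm (x - x0))\<^sup>2)) powr ((real CARD('n) - 2) / 2)))"
proof -
  interpret conformal_equation f \<Gamma> by unfold_locales fact+
  have v: "v x > 0" and super: "viscosity_supersolution f \<Gamma> UNIV v" and sub: "viscosity_subsolution f \<Gamma> UNIV v" for x
    using assms(11) by (auto simp: viscosity_solution_def)
  define a where "a = - 2 / (real CARD('n) - 2)"
  define w where "w x = v x powr a" for x
  define Dw where "Dw x = (a * v x powr (a - 1)) *\<^sub>R grad v x" for x
  have w: "w x = v x powr (- 2 / (real CARD('n) - 2))" for x by (simp add: w_def a_def)
  interpret conformal_solution f \<Gamma> w Dw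
  proof unfold_locales
    show "w x > 0" for x using v[of x] by (simp add: w_def)
    show "w_supersolution f \<Gamma> UNIV w" by (rule w_supersolution_viscosity[OF v w super])
    show "w_subsolution f \<Gamma> UNIV w" by (rule w_subsolution_viscosity[OF v w sub])
    show "(w has_derivative (\<lambda>h. Dw x \<bullet> h)) (at x)" for x
      unfolding w_def[abs_def] Dw_def using assms(10) v by (intro powr_has_derivative) (auto simp: C11_loc_on_def)
    show "\<exists>L. L-lipschitz_on (cball 0 R) Dw" for R
      unfolding Dw_def[abs_def] by (rule C11_powr[OF assms(10) v])
  qed
  let ?m = "(real CARD('n) - 2) / 2"
  have vw: "v x = w x powr - ?m" for x by (rule v_powr[OF v w])
  from classification show ?thesis
  proof
    assume "\<exists>c. \<forall>x. w x = c"
    then show ?thesis using vw by metis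
  next
    assume "\<exists>x0 c b. c > 0 \<and> b > 0 \<and> (\<forall>x. w x = c + b * (norm (x - x0))\<^sup>2)"
    then obtain x0 c b where cb: "c > 0" "b > 0" "\<And>x. w x = c + b * (norm (x - x0))\<^sup>2" by blast
    \<comment> \<open>The parameters a and b of the theorem are 1/c and sqrt (b/c).\<close>
    have "v x = (1 / c / (1 + (sqrt (b / c))\<^sup>2 * (norm (x - x0))\<^sup>2)) powr ?m" for x
    proof -
      have "1 / c / (1 + (sqrt (b / c))\<^sup>2 * (norm (x - x0))\<^sup>2) = 1 / w x"
        using cb by (simp add: field_simps)
      moreover have "(1 / w x) powr ?m = w x powr - ?m"
        using w_pos[of x] by (simp add: powr_divide powr_minus_divide)
      ultimately show ?thesis by (simp only: vw)
    qed
    moreover have "1 / c > 0" "sqrt (b / c) > 0" using cb by auto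
    ultimately show ?thesis by blast
  qed
qed

end
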